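(* There exists a computable field $F$ of characteristic $0$, of infinite transcendence degree over its prime field $\mathbb{Q}$, which has an intrinsically computable transcendence basis over $\mathbb{Q}$; that is, there is a transcendence basis $A\subseteq F$ for $F$ over $\mathbb{Q}$ such that for every computable field $\tilde F$ and every (not necessarily computable) isomorphism $f:F\to\tilde F$, the image $f(A)$ is a computable set.
   Context: A computable field is a field whose domain is an initial segment of $\omega$ and whose addition and multiplication are computable functions. For a relation $R$ on a computable structure $\mathcal{M}$, the degree spectrum of $R$ on $\mathcal{M}$ is the set of Turing degrees $\deg(f(R))$, where $f$ ranges over all isomorphisms from $\mathcal{M}$ onto computable structures $\mathcal{B}$. The relation $R$ is intrinsically computable if its degree spectrum is $\{\boldsymbol{0}\}$, i.e. if all these images are computable. A transcendence basis is viewed as a unary relation on the field. *)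

theory Defs
  imports "HOL-Algebra.Algebra"
begin

section \<open>Computable functions and sets of natural numbers\<close>

text \<open>
  Codes for the partial recursive (mu-recursive) functions. Arities are not recorded in the codes:
  a code denotes a partial function on argument lists.
\<close>

datatype recf =
    Zero
  | Succ
  | Proj nat
  | Comp recf "recf list"
  | Prim recf recf
  | Mu recf

text \<open>
  \<open>computes p xs y\<close>: the partial function with code \<open>p\<close> is defined at \<open>xs\<close> and has value \<open>y\<close>.
  The recursion argument of \<open>Prim\<close> and the search variable of \<open>Mu\<close> come first; in the recursion
  step the list is the predecessor, then the previous value, then the parameters.
  An unbounded search only succeeds if the searched function is defined at all smaller arguments.
\<close>

inductive computes :: "recf \<Rightarrow> nat list \<Rightarrow> nat \<Rightarrow> bool" where
  zero: "computes Zero xs 0"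
| succ: "computes Succ (x # xs) (Suc x)"
| proj: "i < length xs \<Longrightarrow> computes (Proj i) xs (xs ! i)"
| comp: "list_all2 (\<lambda>g y. computes g xs y) gs ys \<Longrightarrow> computes f ys z \<Longrightarrow> computes (Comp f gs) xs z"
| prim_0: "computes f xs y \<Longrightarrow> computes (Prim f g) (0 # xs) y"
| prim_Suc: "computes (Prim f g) (n # xs) r \<Longrightarrow> computes g (n # r # xs) y
    \<Longrightarrow> computes (Prim f g) (Suc n # xs) y"
| mu: "computes f (n # xs) 0 \<Longrightarrow> (\<forall>i<n. \<exists>k. computes f (i # xs) (Suc k))
    \<Longrightarrow> computes (Mu f) xs n"

inductive_cases computes_ZeroE: "computes Zero xs z"
inductive_cases computes_SuccE: "computes Succ xs z"
inductive_cases computes_ProjE: "computes (Proj i) xs z"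
inductive_cases computes_CompE: "computes (Comp f gs) xs z"
inductive_cases computes_Prim_0E: "computes (Prim f g) (0 # xs) z"
inductive_cases computes_Prim_SucE: "computes (Prim f g) (Suc n # xs) z"
inductive_cases computes_MuE: "computes (Mu f) xs z"

lemma computes_deterministic:
  "computes p xs y \<Longrightarrow> computes p xs z \<Longrightarrow> y = z"
proof (induction arbitrary: z rule: computes.induct)
  case zero
  then show ?case by (rule computes_ZeroE) simp
next
  case succ
  then show ?case by (rule computes_SuccE) simp
next
  case proj
  from proj.prems show ?case by (rule computes_ProjE) simp
next
  case (comp xs gs ys f y)
  from comp.prems obtain ys' where ys': "list_all2 (\<lambda>g y. computes g xs y) gs ys'"
    and z: "computes f ys' z"
    by (rule computes_CompE)
  from comp.IH(1) ys' have "ys = ys'"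
    by (auto simp: list_all2_conv_all_nth intro!: nth_equalityI)
  with comp.IH(2) z show ?case by simp
next
  case prim_0
  from prim_0.prems show ?case by (rule computes_Prim_0E) (rule prim_0.IH)
next
  case (prim_Suc f g n xs r y)
  from prim_Suc.prems obtain r' where r': "computes (Prim f g) (n # xs) r'"
    and z: "computes g (n # r' # xs) z"
    by (rule computes_Prim_SucE)
  from prim_Suc.IH(1)[OF r'] z prim_Suc.IH(2) show ?case by blast
next
  case (mu f n xs)
  from mu.prems have z0: "computes f (z # xs) 0" and zS: "\<forall>i<z. \<exists>k. computes f (i # xs) (Suc k)"
    by (auto elim: computes_MuE)
  have "\<not> z < n"
    using mu.IH z0 by fastforce
  moreover have "\<not> n < z"
    using mu.IH(1) zS by fastforce
  ultimately show ?case by simp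
qed

definition computable1 :: "(nat \<Rightarrow> nat) \<Rightarrow> bool" where
  "computable1 f \<longleftrightarrow> (\<exists>p. \<forall>x. computes p [x] (f x))"

definition computable2 :: "(nat \<Rightarrow> nat \<Rightarrow> nat) \<Rightarrow> bool" where
  "computable2 f \<longleftrightarrow> (\<exists>p. \<forall>x y. computes p [x, y] (f x y))"

definition computable_set :: "nat set \<Rightarrow> bool" where
  "computable_set A \<longleftrightarrow> computable1 (\<lambda>x. if x \<in> A then 1 else 0)"


section \<open>Transcendence bases\<close>

definition (in ring) characteristic_zero :: bool where
  "characteristic_zero \<longleftrightarrow> (\<forall>n::nat. n > 0 \<longrightarrow> [n] \<cdot> \<one> \<noteq> \<zero>)"

definition (in field) prime_subfield :: "'a set" where
  "prime_subfield = generate_field R {}"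

text \<open>
  The value of a polynomial with variables indexed by \<open>'c\<close> when \<open>v i\<close> is substituted for the
  \<open>i\<close>-th variable. (The library's \<open>indexed_eval\<close> is a different operation.)
\<close>

definition (in cring) mpoly_value :: "('c \<Rightarrow> 'a) \<Rightarrow> ('c multiset \<Rightarrow> 'a) \<Rightarrow> 'a" where
  "mpoly_value v P =
     (\<Oplus>m \<in> {m. P m \<noteq> \<zero>}. P m \<otimes> (\<Otimes>i \<in> set_mset m. v i [^] count m i))"

text \<open>
  The elements of \<open>A\<close> themselves index the variables, so distinct variables receive distinct
  elements of \<open>A\<close>.
\<close>

definition (in cring) algebraically_independent :: "'a set \<Rightarrow> 'a set \<Rightarrow> bool" where
  "algebraically_independent K A \<longleftrightarrow> A \<subseteq> carrier R \<and>
     (\<forall>P \<in> K[\<X>\<^bsub>A\<^esub>]. mpoly_value (\<lambda>a. a) P = \<zero> \<longrightarrow> P = indexed_const \<zero>)"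

definition (in field) transcendence_basis :: "'a set \<Rightarrow> 'a set \<Rightarrow> bool" where
  "transcendence_basis K A \<longleftrightarrow> algebraically_independent K A \<and>
     (\<forall>x \<in> carrier R. (algebraic over generate_field R (K \<union> A)) x)"

text \<open>
  The transcendence degree is the common cardinality of all transcendence bases, so it is infinite
  as soon as one basis is.
\<close>

definition (in field) infinite_transcendence_degree :: "'a set \<Rightarrow> bool" where
  "infinite_transcendence_degree K \<longleftrightarrow> (\<exists>B. transcendence_basis K B \<and> infinite B)"


section \<open>Computable fields\<close>

text \<open>
  Record operations are total on \<open>nat\<close> but only meaningful on the carrier; as the carrier is an
  initial segment, they are computable there iff they agree there with total computable functions.
\<close>

definition computable_field :: "nat ring \<Rightarrow> bool" where
  "computable_field F \<longleftrightarrow> field F \<and>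
     (\<forall>x \<in> carrier F. {..<x} \<subseteq> carrier F) \<and>
     (\<exists>g. computable2 g \<and> (\<forall>x \<in> carrier F. \<forall>y \<in> carrier F. g x y = x \<oplus>\<^bsub>F\<^esub> y)) \<and>
     (\<exists>g. computable2 g \<and> (\<forall>x \<in> carrier F. \<forall>y \<in> carrier F. g x y = x \<otimes>\<^bsub>F\<^esub> y))"

definition intrinsically_computable :: "nat ring \<Rightarrow> nat set \<Rightarrow> bool" where
  "intrinsically_computable F A \<longleftrightarrow>
     (\<forall>G f. computable_field G \<longrightarrow> f \<in> ring_iso F G \<longrightarrow> computable_set (f ` A))"

end

theory Submission
  imports Defs "HOL-Library.Nat_Bijection" "HOL-Computational_Algebra.Computational_Algebra"
    "HOL-Computational_Algebra.Field_as_Ring" "HOL-Analysis.Continuum_Not_Denumerable"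
begin

text \<open>
The field \<open>F\<close> is built from independent generic points of one algebraic curve, and the transcendence
basis is recognised inside any copy of \<open>F\<close> by asking which elements are first coordinates of
points of that curve.

The curve is \<open>C : v^2 = 2 (u^6 + u + 1)\<close>. It has genus 2, no rational point (the right-hand side has odd
2-adic valuation), and no symmetry apart from \<open>v \<mapsto> - v\<close>. Choose complex numbers \<open>a p\<close>, one for
each prime \<open>p\<close>, each transcendental over the field generated by the earlier points; let
\<open>y p\<close> be a square root of \<open>2 (a p ^ 6 + a p + 1)\<close>, let \<open>F\<close> be generated by all \<open>a p\<close> and \<open>y p\<close>, and let \<open>A\<close>
be the set of all \<open>a p\<close>. The characteristic of \<open>F\<close> is 0 and \<open>A\<close> is a transcendence basis because the \<open>y p\<close> are
algebraic over \<open>A\<close>.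

The geometric fact behind everything is \<open>curve_points_F\<close>: the points of \<open>C\<close> with coordinates in \<open>F\<close> have
their first coordinate in \<open>A\<close>. Adjoining one generic point at a time, this
reduces to \<open>generic_point_rigid\<close>: over the function field of \<open>C\<close> the only point of \<open>C\<close> that is not constant is the generic
point, up to the sign of \<open>v\<close>. For a curve of genus 2 this follows from its two regular
differentials \<open>dx/y\<close> and \<open>x dx/y\<close>. If \<open>(u, v)\<close> is a point, then \<open>du/v\<close> and \<open>u du/v\<close> are again regular, hence are
multiples of \<open>dx/y\<close> by polynomials in \<open>x\<close> of degree at most 1, so that their quotient \<open>u\<close> is a Moebius transformation of \<open>x\<close>.
It must permute the six branch points, and only the identity does.
Regularity is proved without places: the curve is covered by two affine charts, and in each of them
\<open>du/v\<close> is shown to lie in the coordinate ring by multiplying it with denominators that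
generate the unit ideal (\<open>differential_regular\<close>).

Now let \<open>G\<close> be a computable copy of \<open>F\<close>. Membership of \<open>x\<close> in the image of \<open>A\<close> is witnessed by a point \<open>(x, c)\<close> of the
curve in \<open>G\<close>. Non-membership is also witnessed by a finite object, namely a derivation of \<open>x\<close> from
points \<open>(b, c)\<close> with \<open>b \<noteq> x\<close> by subtractions and divisions: if \<open>x\<close> is not in the image of \<open>A\<close>,
then these points are all the points and generate \<open>G\<close>; if \<open>x\<close> is the image of \<open>a p\<close>, then
they generate a field in which \<open>a p\<close> does not lie (\<open>a_not_in_F_without\<close>). Searching for
either witness decides membership, and the argument never refers to how the isomorphism acts
(\<open>computable_set_basis\<close>).

Finally \<open>F\<close> has a computable copy. The products of powers of the \<open>a p\<close> with a squarefree product of the \<open>y p\<close> are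
linearly independent over the rationals and multiply with computable natural structure constants, so
equality of fractions of integral combinations is decidable (\<open>computable_basis\<close>), and repetitions can
be removed from the resulting numbering (\<open>computable_numbering_bijective\<close>).
\<close>

section \<open>Computable functions and decidable predicates\<close>

text \<open>
Total computable functions of \<open>k\<close> arguments, given as a list; this is the form in which primitive recursion and
unbounded search are available. Everything else is phrased with unary functions, where several arguments are packed
into one by the pairing function \<open>prod_encode\<close>.
\<close>

definition total_computable :: "nat \<Rightarrow> (nat list \<Rightarrow> nat) \<Rightarrow> bool" where
  "total_computable k f \<longleftrightarrow> (\<exists>p. \<forall>xs. length xs = k \<longrightarrow> computes p xs (f xs))"

lemma total_computable_cong:
  "(\<And>xs. length xs = k \<Longrightarrow> f xs = g xs) \<Longrightarrow> total_computable k f \<Longrightarrow> total_computable k g"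
  unfolding total_computable_def by metis

lemma total_computable_comp:
  assumes "total_computable (length gs) f" "\<And>g. g \<in> set gs \<Longrightarrow> total_computable k g"
  shows "total_computable k (\<lambda>xs. f (map (\<lambda>g. g xs) gs))"
proof -
  from assms(1) obtain p where p: "\<And>xs. length xs = length gs \<Longrightarrow> computes p xs (f xs)"
    by (auto simp: total_computable_def)
  from assms(2) have "\<forall>g\<in>set gs. \<exists>q. \<forall>xs. length xs = k \<longrightarrow> computes q xs (g xs)"
    by (auto simp: total_computable_def)
  then obtain q where q: "\<And>g xs. g \<in> set gs \<Longrightarrow> length xs = k \<Longrightarrow> computes (q g) xs (g xs)"
    by metis
  have "computes (Comp p (map q gs)) xs (f (map (\<lambda>g. g xs) gs))" if "length xs = k" for xs
    by (rule computes.comp[where ys = "map (\<lambda>g. g xs) gs"])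
      (use that p q in \<open>auto simp: list_all2_conv_all_nth\<close>)
  then show ?thesis by (auto simp: total_computable_def)
qed

lemma total_computable_zero: "total_computable k (\<lambda>_. 0)"
  unfolding total_computable_def using computes.zero by blast

lemma total_computable_proj: "i < k \<Longrightarrow> total_computable k (\<lambda>xs. xs ! i)"
  unfolding total_computable_def using computes.proj by blast

lemma computable1_iff: "computable1 f \<longleftrightarrow> total_computable 1 (\<lambda>xs. f (xs ! 0))"
  unfolding computable1_def total_computable_def
  by (rule ex_cong1) (auto simp: length_Suc_conv)

lemma computable2_iff: "computable2 f \<longleftrightarrow> total_computable 2 (\<lambda>xs. f (xs ! 0) (xs ! 1))"
  unfolding computable2_def total_computable_def
proof (rule ex_cong1)
  fix p
  have "\<forall>x y. computes p [x, y] (f x y)" if "\<forall>xs. length xs = 2 \<longrightarrow> computes p xs (f (xs ! 0) (xs ! 1))"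
  proof (intro allI)
    fix x y show "computes p [x, y] (f x y)" using that[rule_format, of "[x, y]"] by simp
  qed
  then show "(\<forall>x y. computes p [x, y] (f x y)) = (\<forall>xs. length xs = 2 \<longrightarrow> computes p xs (f (xs ! 0) (xs ! 1)))"
    by (auto simp: length_Suc_conv numeral_2_eq_2)
qed

lemma total_computable_app1:
  "computable1 h \<Longrightarrow> total_computable k f \<Longrightarrow> total_computable k (\<lambda>xs. h (f xs))"
  using total_computable_comp[of "[f]" "\<lambda>xs. h (xs ! 0)" k] by (simp add: computable1_iff)

lemma total_computable_app2:
  "computable2 h \<Longrightarrow> total_computable k f \<Longrightarrow> total_computable k g \<Longrightarrow> total_computable k (\<lambda>xs. h (f xs) (g xs))"
  using total_computable_comp[of "[f, g]" "\<lambda>xs. h (xs ! 0) (xs ! 1)" k] by (auto simp: computable2_iff numeral_2_eq_2)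

lemma total_computable_rec:
  assumes "total_computable k f" "total_computable (Suc (Suc k)) g"
  shows "total_computable (Suc k) (\<lambda>xs. rec_nat (f (tl xs)) (\<lambda>n r. g (n # r # tl xs)) (hd xs))"
proof -
  from assms obtain p q where p: "\<And>xs. length xs = k \<Longrightarrow> computes p xs (f xs)"
    and q: "\<And>xs. length xs = Suc (Suc k) \<Longrightarrow> computes q xs (g xs)"
    by (auto simp: total_computable_def)
  have "computes (Prim p q) (n # xs) (rec_nat (f xs) (\<lambda>n r. g (n # r # xs)) n)" if "length xs = k" for n xs
    by (induction n) (use that p q in \<open>auto intro: computes.prim_0 computes.prim_Suc\<close>)
  then show ?thesis unfolding total_computable_def
    by (intro exI[of _ "Prim p q"]) (auto simp: length_Suc_conv)
qed

lemma total_computable_Least: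
  assumes "total_computable (Suc k) f" "\<And>xs. length xs = k \<Longrightarrow> \<exists>n. f (n # xs) = 0"
  shows "total_computable k (\<lambda>xs. LEAST n. f (n # xs) = 0)"
proof -
  from assms(1) obtain p where p: "\<And>xs. length xs = Suc k \<Longrightarrow> computes p xs (f xs)"
    by (auto simp: total_computable_def)
  have "computes (Mu p) xs (LEAST n. f (n # xs) = 0)" if "length xs = k" for xs
  proof (rule computes.mu)
    have "f ((LEAST n. f (n # xs) = 0) # xs) = 0"
      using assms(2)[OF that] by (rule LeastI_ex)
    then show "computes p ((LEAST n. f (n # xs) = 0) # xs) 0"
      using p[of "(LEAST n. f (n # xs) = 0) # xs"] that by simp
    show "\<forall>i<LEAST n. f (n # xs) = 0. \<exists>k. computes p (i # xs) (Suc k)"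
    proof (intro allI impI)
      fix i assume "i < (LEAST n. f (n # xs) = 0)"
      then have "f (i # xs) \<noteq> 0" by (rule not_less_Least)
      then show "\<exists>k. computes p (i # xs) (Suc k)" using p[of "i # xs"] that by (metis length_Cons not0_implies_Suc)
    qed
  qed
  then show ?thesis by (auto simp: total_computable_def)
qed

lemma computable1_Suc: "computable1 Suc"
  unfolding computable1_def using computes.succ by blast

lemma total_computable_Suc: "total_computable k f \<Longrightarrow> total_computable k (\<lambda>xs. Suc (f xs))"
  by (rule total_computable_app1[OF computable1_Suc])

lemma computable1_id: "computable1 (\<lambda>x. x)"
  by (simp add: computable1_iff total_computable_proj)

lemma computable1_const: "computable1 (\<lambda>_. c)"
  by (simp add: computable1_iff) (induction c, auto intro: total_computable_zero total_computable_Suc)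

lemma computable1_comp: "computable1 f \<Longrightarrow> computable1 g \<Longrightarrow> computable1 (\<lambda>x. f (g x))"
  by (subst computable1_iff) (rule total_computable_app1, simp_all add: computable1_iff)

lemma computable1_app2:
  "computable2 F \<Longrightarrow> computable1 f \<Longrightarrow> computable1 g \<Longrightarrow> computable1 (\<lambda>x. F (f x) (g x))"
  by (subst computable1_iff) (rule total_computable_app2, simp_all add: computable1_iff)

lemma computable2_rec:
  assumes "computable1 f" "total_computable 3 (\<lambda>xs. g (xs ! 0) (xs ! 1) (xs ! 2))"
  shows "computable2 (\<lambda>n x. rec_nat (f x) (\<lambda>n r. g n r x) n)"
proof -
  have "total_computable (Suc 1) (\<lambda>xs. rec_nat (f (tl xs ! 0)) (\<lambda>n r. g n r ((n # r # tl xs) ! 2)) (hd xs))"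
    using total_computable_rec[of 1 "\<lambda>xs. f (xs ! 0)" "\<lambda>xs. g (xs ! 0) (xs ! 1) (xs ! 2)"] assms
    by (simp add: computable1_iff numeral_3_eq_3)
  then show ?thesis unfolding computable2_iff numeral_2_eq_2 One_nat_def
    by (rule total_computable_cong[rotated]) (auto simp: length_Suc_conv numeral_2_eq_2)
qed

lemma computable2_swap: "computable2 F \<Longrightarrow> computable2 (\<lambda>x y. F y x)"
  by (subst computable2_iff) (rule total_computable_app2, simp_all add: total_computable_proj)

lemma computable2_add: "computable2 (+)"
proof -
  have "computable2 (\<lambda>n x. rec_nat x (\<lambda>n r. Suc r) n)"
    by (rule computable2_rec[OF computable1_id]) (intro total_computable_Suc total_computable_proj, simp)
  moreover have "rec_nat x (\<lambda>n r. Suc r) n = n + x" for n x by (induction n) auto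
  ultimately show ?thesis by simp
qed

lemma computable2_mult: "computable2 (*)"
proof -
  have "computable2 (\<lambda>n x. rec_nat 0 (\<lambda>n r. r + x) n)"
    by (rule computable2_rec[OF computable1_const])
      (intro total_computable_app2[OF computable2_add] total_computable_proj; simp)
  moreover have "rec_nat 0 (\<lambda>n r. r + x) n = n * x" for n x by (induction n) auto
  ultimately show ?thesis by simp
qed

lemma computable1_pred: "computable1 (\<lambda>x. x - 1)"
proof -
  have "computable2 (\<lambda>n x. rec_nat 0 (\<lambda>n r. n) n)"
    by (rule computable2_rec[OF computable1_const]) (intro total_computable_proj, simp)
  moreover have "rec_nat 0 (\<lambda>n r. n) n = n - 1" for n :: nat by (cases n) auto
  ultimately have "computable2 (\<lambda>n (x::nat). n - 1)" by simp
  from computable1_app2[OF this computable1_id computable1_id] show ?thesis .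
qed

lemma computable2_diff: "computable2 (-)"
proof -
  have "computable2 (\<lambda>n x. rec_nat x (\<lambda>n r. r - 1) n)"
    by (rule computable2_rec[OF computable1_id])
      (intro total_computable_app1[OF computable1_pred] total_computable_proj; simp)
  moreover have "rec_nat x (\<lambda>n r. r - 1) n = x - n" for n x :: nat by (induction n) auto
  ultimately have "computable2 (\<lambda>n x. x - n :: nat)" by simp
  then show ?thesis by (rule computable2_swap)
qed

lemma computable1_triangle: "computable1 triangle"
proof -
  have "computable2 (\<lambda>n x. rec_nat 0 (\<lambda>n r. r + Suc n) n)"
    by (rule computable2_rec[OF computable1_const])
      (intro total_computable_app2[OF computable2_add] total_computable_Suc total_computable_proj; simp)
  moreover have "rec_nat 0 (\<lambda>n r. r + Suc n) n = triangle n" for n by (induction n) auto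
  ultimately have "computable2 (\<lambda>n (x::nat). triangle n)" by simp
  from computable1_app2[OF this computable1_id computable1_id] show ?thesis .
qed

lemma computable2_prod_encode: "computable2 (\<lambda>x y. prod_encode (x, y))"
  unfolding prod_encode_def computable2_iff split
  by (intro total_computable_app2[OF computable2_add] total_computable_app1[OF computable1_triangle] total_computable_proj; simp)

abbreviation pfst :: "nat \<Rightarrow> nat" where "pfst z \<equiv> fst (prod_decode z)"
abbreviation psnd :: "nat \<Rightarrow> nat" where "psnd z \<equiv> snd (prod_decode z)"
abbreviation pair :: "nat \<Rightarrow> nat \<Rightarrow> nat" where "pair x y \<equiv> prod_encode (x, y)"

text \<open>
The code of \<open>(m, n)\<close> is \<open>triangle (m + n) + m\<close>, so \<open>m + n\<close> is found by a search and \<open>m\<close> by a subtraction; this makes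
the two projections computable.
\<close>

lemma prod_decode_diagonal:
  "pfst z + psnd z = (LEAST s. Suc z - triangle (Suc s) = 0)"
  "pfst z = z - triangle (pfst z + psnd z)"
proof -
  obtain a b where ab: "prod_decode z = (a, b)" by (cases "prod_decode z")
  then have z: "z = triangle (a + b) + a"
    using prod_decode_inverse[of z] by (simp add: prod_encode_def)
  have mono: "triangle m \<le> triangle n" if "m \<le> n" for m n
    using that by (induction rule: dec_induct) auto
  have "(LEAST s. Suc z - triangle (Suc s) = 0) = a + b"
  proof (rule Least_equality)
    show "Suc z - triangle (Suc (a + b)) = 0" using z by simp
    fix s assume "Suc z - triangle (Suc s) = 0"
    then have "triangle (a + b) < triangle (Suc s)" using z by simp
    then have "\<not> Suc s \<le> a + b" using mono[of "Suc s" "a + b"] by linarith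
    then show "a + b \<le> s" by simp
  qed
  then show "pfst z + psnd z = (LEAST s. Suc z - triangle (Suc s) = 0)" "pfst z = z - triangle (pfst z + psnd z)"
    using ab z by simp_all
qed

lemma computable1_diagonal: "computable1 (\<lambda>z. pfst z + psnd z)"
  unfolding prod_decode_diagonal(1) computable1_iff
proof (rule total_computable_cong[OF _ total_computable_Least[of 1 "\<lambda>xs. Suc (xs ! 1) - triangle (Suc (xs ! 0))"]])
  show "total_computable (Suc 1) (\<lambda>xs. Suc (xs ! 1) - triangle (Suc (xs ! 0)))"
    by (intro total_computable_app2[OF computable2_diff] total_computable_app1[OF computable1_triangle] total_computable_Suc total_computable_proj; simp)
  fix xs :: "nat list"
  have "n \<le> triangle n" for n by (induction n) auto
  then show "\<exists>n. Suc ((n # xs) ! 1) - triangle (Suc ((n # xs) ! 0)) = 0"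
    by (intro exI[of _ "xs ! 0"]) (simp del: triangle_Suc)
qed simp_all

lemma computable1_pfst: "computable1 (\<lambda>z. pfst z)"
proof -
  have "computable1 (\<lambda>z. z - triangle (pfst z + psnd z))"
    by (intro computable1_app2[OF computable2_diff] computable1_comp[OF computable1_triangle] computable1_diagonal computable1_id)
  then show ?thesis by (simp only: prod_decode_diagonal(2)[symmetric])
qed

lemma computable1_psnd: "computable1 (\<lambda>z. psnd z)"
proof -
  have "computable1 (\<lambda>z. (pfst z + psnd z) - pfst z)"
    by (intro computable1_app2[OF computable2_diff] computable1_pfst computable1_diagonal)
  then show ?thesis by simp
qed

lemma computable2_uncurry: "computable2 F \<longleftrightarrow> computable1 (\<lambda>z. F (pfst z) (psnd z))"
proof
  assume "computable2 F"
  then show "computable1 (\<lambda>z. F (pfst z) (psnd z))"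
    by (rule computable1_app2[OF _ computable1_pfst computable1_psnd])
next
  assume *: "computable1 (\<lambda>z. F (pfst z) (psnd z))"
  have "total_computable 2 (\<lambda>xs. (\<lambda>z. F (pfst z) (psnd z)) (pair (xs ! 0) (xs ! 1)))"
    by (intro total_computable_app1[OF *] total_computable_app2[OF computable2_prod_encode] total_computable_proj; simp)
  then show "computable2 F" by (simp add: computable2_iff)
qed

text \<open>
The rules collected here prove computability by following the syntax of a function: every rule has the form
that if the arguments are computable functions of an environment, then so is the result. A bound variable is added to the environment by
pairing.
\<close>

named_theorems comp_intros

definition decidable :: "(nat \<Rightarrow> bool) \<Rightarrow> bool" where
  "decidable P \<longleftrightarrow> computable1 (\<lambda>x. if P x then 1 else 0)"

lemmas [comp_intros] = computable1_id computable1_const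
  computable1_comp[OF computable1_Suc] computable1_app2[OF computable2_add] computable1_app2[OF computable2_mult]
  computable1_app2[OF computable2_diff] computable1_app2[OF computable2_prod_encode]
  computable1_comp[OF computable1_pfst] computable1_comp[OF computable1_psnd]

lemma computable1_rec [comp_intros]:
  assumes "computable1 b" "computable1 f" "computable1 (\<lambda>z. g (pfst z) (pfst (psnd z)) (psnd (psnd z)))"
  shows "computable1 (\<lambda>x. rec_nat (f x) (\<lambda>n r. g n r x) (b x))"
proof -
  have "total_computable 3 (\<lambda>xs. (\<lambda>z. g (pfst z) (pfst (psnd z)) (psnd (psnd z))) (pair (xs ! 0) (pair (xs ! 1) (xs ! 2))))"
    by (intro total_computable_app1[OF assms(3)] total_computable_app2[OF computable2_prod_encode] total_computable_proj; simp)
  then have "total_computable 3 (\<lambda>xs. g (xs ! 0) (xs ! 1) (xs ! 2))" by simp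
  from computable1_app2[OF computable2_rec[OF assms(2) this] assms(1) computable1_id] show ?thesis .
qed

lemma computable1_if [comp_intros]:
  assumes "decidable P" "computable1 f" "computable1 g"
  shows "computable1 (\<lambda>x. if P x then f x else g x)"
proof -
  have "computable1 (\<lambda>x. (if P x then 1 else 0) * f x + (1 - (if P x then 1 else 0)) * g x)"
    using assms unfolding decidable_def by (intro comp_intros)
  moreover have "(if P x then 1 else 0) * f x + (1 - (if P x then 1 else 0)) * g x = (if P x then f x else g x)" for x
    by simp
  ultimately show ?thesis by simp
qed

lemma decidable_eq [comp_intros]: 
  assumes "computable1 f" "computable1 g"
  shows "decidable (\<lambda>x. f x = g x)"
proof -
  have "computable1 (\<lambda>x. 1 - ((f x - g x) + (g x - f x)))"
    using assms by (intro comp_intros)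
  moreover have "1 - ((f x - g x) + (g x - f x)) = (if f x = g x then 1 else 0)" for x by auto
  ultimately show ?thesis by (simp add: decidable_def)
qed

lemma decidable_less [comp_intros]: 
  assumes "computable1 f" "computable1 g"
  shows "decidable (\<lambda>x. f x < g x)"
proof -
  have "computable1 (\<lambda>x. 1 - (Suc (f x) - g x))"
    using assms by (intro comp_intros)
  moreover have "1 - (Suc (f x) - g x) = (if f x < g x then 1 else 0)" for x by auto
  ultimately show ?thesis by (simp add: decidable_def)
qed

lemma decidable_not [comp_intros]: "decidable P \<Longrightarrow> decidable (\<lambda>x. \<not> P x)"
proof -
  assume "decidable P"
  then have "computable1 (\<lambda>x. 1 - (if P x then 1 else 0))" by (intro comp_intros)
  moreover have "1 - (if P x then 1 else 0) = (if \<not> P x then 1 else 0 :: nat)" for x by simp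
  ultimately show ?thesis by (simp only: decidable_def)
qed

lemma decidable_conj [comp_intros]: 
  assumes "decidable P" "decidable Q" shows "decidable (\<lambda>x. P x \<and> Q x)"
proof -
  have "computable1 (\<lambda>x. (if P x then 1 else 0) * (if Q x then 1 else 0))"
    using assms by (intro comp_intros)
  moreover have "(if P x then 1 else 0) * (if Q x then 1 else 0) = (if P x \<and> Q x then 1 else 0 :: nat)" for x by simp
  ultimately show ?thesis by (simp add: decidable_def)
qed

lemma decidable_disj [comp_intros]: 
  assumes "decidable P" "decidable Q" shows "decidable (\<lambda>x. P x \<or> Q x)"
proof -
  have "decidable (\<lambda>x. \<not> (\<not> P x \<and> \<not> Q x))" using assms by (intro comp_intros)
  then show ?thesis by simp
qed

lemma decidable_imp [comp_intros]: 
  assumes "decidable P" "decidable Q" shows "decidable (\<lambda>x. P x \<longrightarrow> Q x)"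
proof -
  have "decidable (\<lambda>x. \<not> P x \<or> Q x)" using assms by (intro comp_intros)
  then show ?thesis by (simp only: imp_conv_disj)
qed

lemma computable1_sum [comp_intros]:
  assumes "computable1 b" "computable1 (\<lambda>z. G (pfst z) (psnd z))"
  shows "computable1 (\<lambda>x. \<Sum>i<b x. G x i)"
proof -
  have "computable1 (\<lambda>z. G (psnd (psnd z)) (pfst z))"
    by (rule computable1_app2[OF computable2_uncurry[THEN iffD2, OF assms(2)]]) (intro comp_intros)+
  then have "computable1 (\<lambda>x. rec_nat 0 (\<lambda>n r. r + G x n) (b x))"
    by (intro comp_intros assms)
  moreover have "rec_nat 0 (\<lambda>n r. r + G x n) m = (\<Sum>i<m. G x i)" for x m
    by (induction m) simp_all
  ultimately show ?thesis by simp
qed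

lemma computable1_prod [comp_intros]:
  assumes "computable1 b" "computable1 (\<lambda>z. G (pfst z) (psnd z))"
  shows "computable1 (\<lambda>x. \<Prod>i<b x. G x i)"
proof -
  have "computable1 (\<lambda>z. G (psnd (psnd z)) (pfst z))"
    by (rule computable1_app2[OF computable2_uncurry[THEN iffD2, OF assms(2)]]) (intro comp_intros)+
  then have "computable1 (\<lambda>x. rec_nat 1 (\<lambda>n r. r * G x n) (b x))"
    by (intro comp_intros assms)
  moreover have "rec_nat 1 (\<lambda>n r. r * G x n) m = (\<Prod>i<m. G x i)" for x m
    by (induction m) simp_all
  ultimately show ?thesis by simp
qed

lemma decidable_all [comp_intros]:
  assumes "computable1 b" "decidable (\<lambda>z. P (pfst z) (psnd z))"
  shows "decidable (\<lambda>x. \<forall>i<b x. P x i)"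
proof -
  have "computable1 (\<lambda>x. \<Prod>i<b x. if P x i then 1 else 0)"
    using assms by (intro comp_intros)
  moreover have "(\<Prod>i<m. if P x i then 1 else 0) = (if \<forall>i<m. P x i then 1 else 0 :: nat)" for x m
    by (induction m) (auto simp: less_Suc_eq)
  ultimately show ?thesis by (simp add: decidable_def)
qed

lemma decidable_ex [comp_intros]:
  assumes "computable1 b" "decidable (\<lambda>z. P (pfst z) (psnd z))"
  shows "decidable (\<lambda>x. \<exists>i<b x. P x i)"
proof -
  have "decidable (\<lambda>x. \<not> (\<forall>i<b x. \<not> P x i))" using assms by (intro comp_intros)
  then show ?thesis by simp
qed

lemma computable1_Least:
  assumes "decidable (\<lambda>z. P (pfst z) (psnd z))" "\<And>x. \<exists>n. P x n"
  shows "computable1 (\<lambda>x. LEAST n. P x n)"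
proof -
  define F where "F n x = (if P x n then 0 else 1 :: nat)" for n x
  have "computable2 (\<lambda>x n. if P x n then 0 else 1 :: nat)"
    using assms(1) unfolding computable2_uncurry by (intro comp_intros)
  then have "computable2 F" unfolding F_def by (rule computable2_swap)
  then have "total_computable (Suc 1) (\<lambda>xs. F (xs ! 0) (xs ! 1))"
    by (simp add: computable2_iff numeral_2_eq_2)
  from total_computable_Least[OF this] assms(2)
  have "total_computable 1 (\<lambda>xs. LEAST n. F n (xs ! 0) = 0)" by (simp add: F_def)
  moreover have "(F n x = 0) = P x n" for n x by (simp add: F_def)
  ultimately show ?thesis by (simp add: computable1_iff)
qed

lemma decidable_comp: "decidable P \<Longrightarrow> computable1 f \<Longrightarrow> decidable (\<lambda>x. P (f x))"
  unfolding decidable_def by (rule computable1_comp)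

lemma decidable_dvd [comp_intros]:
  assumes "computable1 f" "computable1 g"
  shows "decidable (\<lambda>x. f x dvd g x)"
proof -
  have "decidable (\<lambda>x. \<exists>k<Suc (g x). g x = f x * k)"
    by (intro comp_intros computable1_comp[OF assms(1)] computable1_comp[OF assms(2)] assms)
  moreover have "(\<exists>k<Suc n. n = m * k) \<longleftrightarrow> m dvd n" for m n :: nat
  proof
    assume "m dvd n"
    then obtain k where k: "n = m * k" by (elim dvdE)
    show "\<exists>k<Suc n. n = m * k"
    proof (cases "m = 0")
      case False
      with k have "k < Suc n" by (cases m) auto
      with k show ?thesis by blast
    qed (use k in auto)
  qed auto
  ultimately show ?thesis by simp
qed

lemma computable1_power [comp_intros]:
  assumes "computable1 f" "computable1 g"
  shows "computable1 (\<lambda>x. f x ^ g x)"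
proof -
  have "computable1 (\<lambda>x. \<Prod>i<g x. f x)"
    by (intro comp_intros computable1_comp[OF assms(1)] assms)
  then show ?thesis by simp
qed

lemma decidable_prime:
  "decidable (\<lambda>p. Factorial_Ring.prime p)"
proof -
  have "decidable (\<lambda>p. 1 < p \<and> (\<forall>d<Suc p. d dvd p \<longrightarrow> d = 1 \<or> d = p))"
    by (intro comp_intros)
  moreover have "(1 < p \<and> (\<forall>d<Suc p. d dvd p \<longrightarrow> d = 1 \<or> d = p)) \<longleftrightarrow> Factorial_Ring.prime p" for p :: nat
  proof
    assume *: "1 < p \<and> (\<forall>d<Suc p. d dvd p \<longrightarrow> d = 1 \<or> d = p)"
    then have "m \<le> p" if "m dvd p" for m using that by (intro dvd_imp_le) auto
    with * show "Factorial_Ring.prime p" by (auto simp: prime_nat_iff less_Suc_eq_le)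
  qed (auto simp: prime_nat_iff)
  ultimately show ?thesis by simp
qed

text \<open>
This turns the multiplicity of a prime into a bounded sum, which is computable by the rules above.
\<close>

lemma multiplicity_count:
  assumes "Factorial_Ring.prime (p::nat)" "r > 0"
  shows "multiplicity p r = (\<Sum>k<r. if p ^ Suc k dvd r then 1 else 0)"
proof -
  have "{k. k < r \<and> p ^ Suc k dvd r} = {..<multiplicity p r}"
  proof safe
    fix k assume "p ^ Suc k dvd r"
    then show "k < multiplicity p r"
      using assms multiplicity_geI[of r p "Suc k"] prime_gt_1_nat[OF assms(1)] by auto
  next
    fix k assume "k < multiplicity p r"
    then show d: "p ^ Suc k dvd r" by (intro multiplicity_dvd') simp
    have "k < p ^ k" using prime_gt_1_nat[OF assms(1)] by (intro power_gt_expt) simp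
    also have "\<dots> \<le> p ^ Suc k" using prime_gt_1_nat[OF assms(1)] by simp
    also have "\<dots> \<le> r" using d assms(2) by (rule dvd_imp_le)
    finally show "k < r" .
  qed
  then show ?thesis by (simp add: sum.If_cases Int_def lessThan_def)
qed

section \<open>Differentials on an affine curve\<close>

text \<open>
The value at \<open>x\<close> of a polynomial whose coefficients are moved along \<open>c\<close>. For \<open>c\<close> the embedding of the constants into a function
field and \<open>x\<close> a coordinate function, its image is the ring of polynomial functions in \<open>x\<close>.
\<close>

definition evc :: "('a::comm_ring_1 \<Rightarrow> 'l::comm_ring_1) \<Rightarrow> 'l \<Rightarrow> 'a poly \<Rightarrow> 'l" where
  "evc c x p = poly (map_poly c p) x"

locale const_embedding =
  fixes c :: "complex \<Rightarrow> 'l::field"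
  assumes c_add: "c (a + b) = c a + c b"
    and c_mult: "c (a * b) = c a * c b"
    and c_one: "c 1 = 1"
begin

lemma c_zero: "c 0 = 0"
  using c_add[of 0 0] by (metis add_0 add_right_cancel)

lemma c_uminus: "c (- a) = - c a"
  using c_add[of a "- a"] c_zero by (simp add: add_eq_0_iff)

lemma c_of_nat: "c (of_nat n) = of_nat n"
  by (induction n) (simp_all add: c_zero c_add c_one)

lemma c_numeral: "c (numeral n) = numeral n"
  using c_of_nat[of "numeral n"] by simp

lemma c_eq_0_iff: "c a = 0 \<longleftrightarrow> a = 0"
proof
  assume "c a = 0"
  show "a = 0"
  proof (rule ccontr)
    assume "a \<noteq> 0"
    then have "c a * c (inverse a) = 1"
      by (simp add: c_mult[symmetric] c_one)
    with \<open>c a = 0\<close> show False by simp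
  qed
qed (simp add: c_zero)

lemma two_neq_0: "(2::'l) \<noteq> 0"
  using c_eq_0_iff[of 2] c_numeral[of "num.Bit0 num.One"] by simp

lemma evc_0: "evc c x 0 = 0"
  by (simp add: evc_def)

lemma evc_pCons: "evc c x (pCons a p) = c a + x * evc c x p"
  by (cases "p = 0 \<and> a = 0") (auto simp: evc_def map_poly_pCons c_zero)

lemma evc_add: "evc c x (p + q) = evc c x p + evc c x q"
  by (induction p q rule: poly_induct2) (simp_all add: evc_0 evc_pCons c_add algebra_simps)

lemma evc_smult: "evc c x (smult a p) = c a * evc c x p"
  by (induction p) (simp_all add: evc_0 evc_pCons c_mult algebra_simps)

lemma evc_mult: "evc c x (p * q) = evc c x p * evc c x q"
  by (induction p) (simp_all add: evc_0 evc_pCons evc_add evc_smult c_zero algebra_simps)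

lemma evc_1: "evc c x 1 = 1"
  by (simp add: one_pCons evc_pCons evc_0 c_one)

lemma evc_uminus: "evc c x (- p) = - evc c x p"
  using evc_add[of x p "- p"] by (simp add: evc_0 add_eq_0_iff)

lemma evc_diff: "evc c x (p - q) = evc c x p - evc c x q"
  using evc_add[of x p "- q"] by (simp add: evc_uminus)

lemma evc_power: "evc c x (p ^ n) = evc c x p ^ n"
  by (induction n) (simp_all add: evc_1 evc_mult)

lemma evc_const: "evc c x [:a:] = c a"
  by (simp add: evc_pCons evc_0)

lemma evc_X: "evc c x [:0, 1:] = x"
  by (simp add: evc_pCons evc_0 c_zero c_one)

lemmas evc_simps = evc_0 evc_1 evc_add evc_mult evc_uminus evc_diff evc_power evc_smult

end

text \<open>
A squarefree polynomial that is not constant is not a square in the field of rational functions; this is why \<open>1\<close> and \<open>y\<close> are linearly independent.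
\<close>

lemma poly_square_factor:
  fixes f p q :: "complex poly"
  assumes "squarefree f" "Polynomial.degree f > 0" "p ^ 2 = q ^ 2 * f"
  shows "p = 0 \<and> q = 0"
proof -
  have "q = 0"
  proof (rule ccontr)
    assume q: "q \<noteq> 0"
    have "q ^ 2 dvd p ^ 2" using assms(3) by simp
    then have "q dvd p" by (simp add: pow_divides_pow_iff)
    then obtain m where m: "p = q * m" by (elim dvdE)
    with assms(3) q have "m ^ 2 = f" by (simp add: power_mult_distrib)
    with assms(1) have u: "is_unit m" unfolding squarefree_def by auto
    then have "m \<noteq> 0" by auto
    with u have "Polynomial.degree m = 0" by (simp add: is_unit_iff_degree)
    with \<open>m ^ 2 = f\<close> assms(2) \<open>m \<noteq> 0\<close> show False
      by (metis Polynomial.degree_power_eq mult_0_right less_irrefl)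
  qed
  with assms(3) show ?thesis by simp
qed

text \<open>
Cancelling the common factor of \<open>d\<close> and \<open>q\<close> leaves the square of a divisor of \<open>f\<close>, which is a unit.
\<close>

lemma square_dvd_squarefree:
  fixes f d q :: "complex poly"
  assumes "squarefree f" "d ^ 2 dvd q ^ 2 * f"
  shows "d dvd q"
proof (cases "q = 0")
  case False
  define g where "g = gcd d q"
  from False have g: "g \<noteq> 0" by (simp add: g_def)
  obtain d' q' where dq: "d = g * d'" "q = g * q'" "coprime d' q'"
    using gcd_coprime_exists[of d q] False unfolding g_def by (metis gcd_eq_0_iff mult.commute)
  from assms(2) have "d' ^ 2 dvd q' ^ 2 * f"
    using g by (simp add: dq power_mult_distrib mult.assoc)
  then have "d' ^ 2 dvd f"
    using dq(3) by (simp add: coprime_dvd_mult_right_iff)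
  with assms(1) have "is_unit d'" by (auto simp: squarefree_def)
  then show ?thesis using dq by (simp add: unit_imp_dvd)
qed auto

lemma squarefree_if_bezout_pderiv:
  fixes f a b :: "complex poly"
  assumes "a * f + b * pderiv f = 1"
  shows "squarefree f"
  unfolding squarefree_def
proof (intro allI impI)
  fix d assume "d ^ 2 dvd f"
  then obtain k where k: "f = d * d * k" by (auto simp: power2_eq_square elim: dvdE)
  then have "d dvd f" "d dvd pderiv f"
    by (auto simp: pderiv_mult algebra_simps)
  then have "d dvd a * f + b * pderiv f" by simp
  with assms show "is_unit d" by simp
qed

text \<open>
An affine chart of the curve \<open>y^2 = f(x)\<close>, inside a field with a derivation \<open>\<delta>\<close> that kills the constants. The normalisation
\<open>\<delta> x = y\<close> makes \<open>\<delta>\<close> the derivation dual to the differential \<open>dx/y\<close>: the function \<open>\<delta> u / v\<close> is the quotient of \<open>du/v\<close> and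
\<open>dx/y\<close>. The Bezout identity says that \<open>f\<close> is squarefree, i.e. that the chart is smooth.
\<close>

locale curve_chart = const_embedding c for c :: "complex \<Rightarrow> 'l::field" +
  fixes x y :: 'l and \<delta> :: "'l \<Rightarrow> 'l" and f fa fb :: "complex poly"
  assumes d_add: "\<delta> (u + v) = \<delta> u + \<delta> v"
    and d_mult: "\<delta> (u * v) = \<delta> u * v + u * \<delta> v"
    and d_const: "\<delta> (c k) = 0"
    and d_x: "\<delta> x = y"
    and y_sq: "y ^ 2 = evc c x f"
    and indep: "evc c x p + evc c x q * y = 0 \<Longrightarrow> p = 0 \<and> q = 0"
    and f_bezout: "fa * f + fb * pderiv f = 1"
begin

abbreviation ev :: "complex poly \<Rightarrow> 'l" where "ev \<equiv> evc c x"

lemma f_squarefree: "squarefree f"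
  using f_bezout by (rule squarefree_if_bezout_pderiv)

lemma ev_eq_0_iff: "ev p = 0 \<longleftrightarrow> p = 0"
  using indep[of p 0] by (auto simp: evc_0)

lemma indep_eq:
  assumes "ev p + ev q * y = ev p' + ev q' * y"
  shows "p = p' \<and> q = q'"
  using indep[of "p - p'" "q - q'"] assms by (simp add: evc_simps algebra_simps)

lemma y_neq_0: "y \<noteq> 0"
  using indep[of 0 1] by (auto simp: evc_simps)

lemma d_0: "\<delta> 0 = 0" and d_1: "\<delta> 1 = 0"
  using d_const[of 0] d_const[of 1] by (simp_all add: c_zero c_one)

lemma d_evc: "\<delta> (evc c u p) = evc c u (pderiv p) * \<delta> u"
  by (induction p)
     (simp_all add: evc_0 evc_pCons pderiv_pCons evc_add d_0 d_add d_mult d_const c_zero algebra_simps)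

lemma d_inverse:
  assumes "u \<noteq> 0"
  shows "\<delta> (1 / u) = - \<delta> u / u ^ 2"
proof -
  define w where "w = 1 / u"
  have "u * w = 1" using assms by (simp add: w_def)
  then have "\<delta> u * w + u * \<delta> w = 0" using d_1 d_mult by metis
  then have "u * \<delta> (1 / u) = - \<delta> u / u" unfolding w_def by (simp add: add_eq_0_iff)
  then show ?thesis using assms by (simp add: field_simps power2_eq_square)
qed

lemma d_y: "\<delta> y = ev (pderiv f) / 2"
proof -
  have "\<delta> (y ^ 2) = ev (pderiv f) * y"
    unfolding y_sq by (simp only: d_evc d_x)
  then have "\<delta> y * y + y * \<delta> y = ev (pderiv f) * y"
    by (simp only: power2_eq_square d_mult)
  then have "y * (2 * \<delta> y) = y * ev (pderiv f)" by (simp add: algebra_simps)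
  then have "2 * \<delta> y = ev (pderiv f)" using y_neq_0 by (metis mult_left_cancel)
  then show ?thesis using two_neq_0 by (metis nonzero_mult_div_cancel_left)
qed

text \<open>
\<open>R\<close> is the coordinate ring of the chart and \<open>L\<close> the function field of the curve.
\<close>

definition R :: "'l set" where "R = {ev p + ev q * y | p q. True}"
definition L :: "'l set" where "L = {(ev p + ev q * y) / ev d | p q d. d \<noteq> 0}"

lemma RI: "z = ev p + ev q * y \<Longrightarrow> z \<in> R" by (auto simp: R_def)
lemma LI: "z = (ev p + ev q * y) / ev d \<Longrightarrow> d \<noteq> 0 \<Longrightarrow> z \<in> L" by (auto simp: L_def)

lemma R_ev: "ev p \<in> R" by (rule RI[of _ p 0]) (simp add: evc_simps)
lemma R_c: "c a \<in> R" using R_ev[of "[:a:]"] by (simp add: evc_const)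
lemma R_0: "0 \<in> R" and R_1: "1 \<in> R" using R_ev[of 0] R_ev[of 1] by (simp_all add: evc_simps)

lemma R_add: "u \<in> R \<Longrightarrow> v \<in> R \<Longrightarrow> u + v \<in> R"
proof -
  assume "u \<in> R" "v \<in> R"
  then obtain p q p' q' where "u = ev p + ev q * y" "v = ev p' + ev q' * y" by (auto simp: R_def)
  then have "u + v = ev (p + p') + ev (q + q') * y" by (simp add: evc_simps algebra_simps)
  then show ?thesis by (rule RI)
qed

lemma R_mult: assumes "u \<in> R" "v \<in> R" shows "u * v \<in> R"
proof -
  from assms obtain p q p' q' where "u = ev p + ev q * y" "v = ev p' + ev q' * y" by (auto simp: R_def)
  then have "u * v = ev (p * p' + q * q' * f) + ev (p * q' + q * p') * y"
    by (simp add: evc_simps y_sq[symmetric] power2_eq_square algebra_simps)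
  then show ?thesis by (rule RI)
qed

lemma R_uminus: "u \<in> R \<Longrightarrow> - u \<in> R"
  using R_mult[OF R_c[of "-1"]] by (simp add: c_uminus c_one)
lemma R_diff: "u \<in> R \<Longrightarrow> v \<in> R \<Longrightarrow> u - v \<in> R"
  using R_add[OF _ R_uminus, of u v] by simp
lemma R_power: "u \<in> R \<Longrightarrow> u ^ n \<in> R"
  by (induction n) (simp_all add: R_1 R_mult)
lemma R_y: "y \<in> R" by (rule RI[of _ 0 1]) (simp add: evc_simps)
lemma R_half: "u / 2 \<in> R" if "u \<in> R"
proof -
  have "c 2 * c (1 / 2) = 1" by (simp add: c_one flip: c_mult)
  then have "c (1 / 2) = 1 / 2" using two_neq_0 by (metis c_numeral nonzero_mult_div_cancel_left)
  then have "u * c (1 / 2) = u / 2" by (simp only: times_divide_eq_right mult_1_right)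
  then show ?thesis using R_mult[OF that R_c[of "1/2"]] by (simp only:)
qed

text \<open>
The coordinate ring is stable under \<open>\<delta>\<close> because \<open>\<delta> y = f'(x) / 2\<close> is again a polynomial: \<open>dx/y\<close> has no zero in the chart.
\<close>

lemma R_d: assumes "u \<in> R" shows "\<delta> u \<in> R"
proof -
  from assms obtain p q where u: "u = ev p + ev q * y" by (auto simp: R_def)
  have "\<delta> u = ev (pderiv p) * y + (ev (pderiv q) * y * y + ev q * (ev (pderiv f) / 2))"
    by (simp add: u d_add d_mult d_evc d_x d_y)
  also have "\<dots> \<in> R" by (intro R_add R_mult R_ev R_y R_half)
  finally show ?thesis .
qed

lemma L_add: assumes "u \<in> L" "v \<in> L" shows "u + v \<in> L"
proof -
  from assms obtain p q d p' q' d' where uv: "u = (ev p + ev q * y) / ev d" "v = (ev p' + ev q' * y) / ev d'"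
    and d: "d \<noteq> 0" "d' \<noteq> 0" by (auto simp: L_def)
  from d have ed: "ev d \<noteq> 0" "ev d' \<noteq> 0" by (simp_all add: ev_eq_0_iff)
  have "u + v = (ev (p * d' + p' * d) + ev (q * d' + q' * d) * y) / ev (d * d')"
    unfolding uv using ed by (simp add: evc_simps add_frac_eq) (simp add: algebra_simps)
  then show ?thesis by (rule LI) (use d in simp)
qed

lemma L_mult: assumes "u \<in> L" "v \<in> L" shows "u * v \<in> L"
proof -
  from assms obtain p q d p' q' d' where uv: "u = (ev p + ev q * y) / ev d" "v = (ev p' + ev q' * y) / ev d'"
    and d: "d \<noteq> 0" "d' \<noteq> 0" by (auto simp: L_def)
  from d have ed: "ev d \<noteq> 0" "ev d' \<noteq> 0" by (simp_all add: ev_eq_0_iff)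
  have "u * v = (ev (p * p' + q * q' * f) + ev (p * q' + q * p') * y) / ev (d * d')"
    unfolding uv using ed by (simp add: evc_simps y_sq[symmetric] power2_eq_square) (simp add: algebra_simps)
  then show ?thesis by (rule LI) (use d in simp)
qed

lemma L_R: "u \<in> R \<Longrightarrow> u \<in> L"
  unfolding R_def by (auto intro!: LI[of _ _ _ 1] simp: evc_simps)

lemma L_inverse: assumes "u \<in> L" shows "1 / u \<in> L"
proof (cases "u = 0")
  case False
  from assms obtain p q d where u: "u = (ev p + ev q * y) / ev d" and d: "d \<noteq> 0" by (auto simp: L_def)
  from False u have n1: "ev p + ev q * y \<noteq> 0" by auto
  then have n2: "ev p - ev q * y \<noteq> 0"
    using indep[of p "- q"] by (auto simp: evc_simps)
  have nm: "ev (p ^ 2 - q ^ 2 * f) = (ev p + ev q * y) * (ev p - ev q * y)"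
    by (simp add: evc_simps y_sq[symmetric] power2_eq_square algebra_simps)
  then have nz: "p ^ 2 - q ^ 2 * f \<noteq> 0" using n1 n2 by (metis ev_eq_0_iff mult_eq_0_iff)
  have "1 / u = (ev (d * p) + ev (- (d * q)) * y) / ev (p ^ 2 - q ^ 2 * f)"
  proof -
    have "ev (d * p) + ev (- (d * q)) * y = ev d * (ev p - ev q * y)" by (simp add: evc_simps algebra_simps)
    then show ?thesis unfolding nm u using n1 n2 by simp
  qed
  then show ?thesis using nz by (rule LI)
qed (use L_R[OF R_0] in simp)

lemma L_power: "u \<in> L \<Longrightarrow> u ^ n \<in> L"
  by (induction n) (simp_all add: L_R R_1 L_mult)
lemma L_divide: "u \<in> L \<Longrightarrow> v \<in> L \<Longrightarrow> u / v \<in> L"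
  using L_mult[OF _ L_inverse, of u v] by simp

text \<open>
The chart is smooth, so its coordinate ring is integrally closed; square roots are the only integral equations that occur below.
\<close>

lemma integrally_closed:
  assumes "z \<in> L" "z * z \<in> R"
  shows "z \<in> R"
proof -
  from assms(1) obtain p q d where z: "z = (ev p + ev q * y) / ev d" and d: "d \<noteq> 0" by (auto simp: L_def)
  from assms(2) obtain m n where zz: "z * z = ev m + ev n * y" by (auto simp: R_def)
  have ev2: "ev 2 = 2" using evc_add[of x 1 1] by (simp add: evc_1)
  have zd: "z * ev d = ev p + ev q * y" using d by (simp add: z ev_eq_0_iff)
  have "ev (p ^ 2 + q ^ 2 * f) + ev (2 * p * q) * y = (z * ev d) * (z * ev d)"
    unfolding zd by (simp add: evc_simps ev2 y_sq[symmetric] power2_eq_square algebra_simps)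
  also have "\<dots> = ev (d ^ 2 * m) + ev (d ^ 2 * n) * y"
  proof -
    have "(z * ev d) * (z * ev d) = (ev d * ev d) * (z * z)" by (simp only: mult_ac)
    then show ?thesis unfolding zz by (simp add: evc_simps power2_eq_square algebra_simps)
  qed
  finally have e: "p ^ 2 + q ^ 2 * f = d ^ 2 * m" "2 * p * q = d ^ 2 * n"
    using indep_eq by blast+
  \<comment> \<open>The norm of \<open>z\<close> is regular because its square is; trace and norm of \<open>z^2\<close> then give \<open>d^2 | 2 p^2\<close> and \<open>d^2 | 2 q^2 f\<close>.\<close>
  have "(p ^ 2 - q ^ 2 * f) ^ 2 = (p ^ 2 + q ^ 2 * f) ^ 2 - (2 * p * q) ^ 2 * f"
    by (simp add: power2_eq_square algebra_simps)
  also have "\<dots> = (d ^ 2) ^ 2 * (m ^ 2 - n ^ 2 * f)"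
    unfolding e by (simp add: power2_eq_square algebra_simps)
  finally have "(d ^ 2) ^ 2 dvd (p ^ 2 - q ^ 2 * f) ^ 2" by simp
  then have dv: "d ^ 2 dvd p ^ 2 - q ^ 2 * f" by (simp only: pow_divides_pow_iff zero_less_numeral)
  have dv': "d ^ 2 dvd p ^ 2 + q ^ 2 * f" using e by simp
  have two: "is_unit (2 :: complex poly)"
    by (rule dvdI[of _ _ "[:1 / 2:]"]) (simp add: numeral_poly one_pCons)
  have "d ^ 2 dvd 2 * p ^ 2" using dvd_add[OF dv dv'] by simp
  then have "d ^ 2 dvd p ^ 2" using two by (simp add: dvd_mult_unit_iff')
  then have "d dvd p" by (simp add: pow_divides_pow_iff)
  have "d ^ 2 dvd 2 * (q ^ 2 * f)" using dvd_diff[OF dv' dv] by (simp add: mult.commute)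
  then have "d ^ 2 dvd q ^ 2 * f" using two by (simp add: dvd_mult_unit_iff')
  then have "d dvd q" using f_squarefree square_dvd_squarefree by blast
  from \<open>d dvd p\<close> \<open>d dvd q\<close> obtain p' q' where "p = d * p'" "q = d * q'" by (auto elim!: dvdE)
  then have "z = ev p' + ev q' * y" using d by (simp add: z evc_simps ev_eq_0_iff field_simps)
  then show ?thesis by (rule RI)
qed

text \<open>
If \<open>z\<close> is a denominator of \<open>u\<close>, then \<open>z ^ n\<close> is a denominator of every polynomial in \<open>u\<close> of degree at most \<open>n\<close>.
\<close>

lemma R_evc_clear:
  assumes "z \<in> R" "z * u \<in> R" "Polynomial.degree p \<le> n"
  shows "z ^ n * evc c u p \<in> R"
  using assms(3)
proof (induction p arbitrary: n)
  case 0
  then show ?case by (simp add: evc_0 R_0)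
next
  case (pCons a p)
  show ?case
  proof (cases "p = 0")
    case True
    then show ?thesis by (simp add: evc_pCons evc_0 R_mult R_power assms R_c)
  next
    case False
    with pCons.prems obtain m where m: "n = Suc m" "Polynomial.degree p \<le> m" by (cases n) auto
    have "z ^ n * evc c u (pCons a p) = z ^ n * c a + (z * u) * (z ^ m * evc c u p)"
      by (simp add: m evc_pCons algebra_simps)
    also have "\<dots> \<in> R"
      by (rule R_add[OF R_mult[OF R_power[OF assms(1)] R_c] R_mult[OF assms(2) pCons.IH[OF m(2)]]])
    finally show ?thesis .
  qed
qed

text \<open>
On the open set where \<open>z\<close> does not vanish, \<open>u\<close> is regular, and so is \<open>v\<close> because its square is a polynomial in \<open>u\<close>. The Bezout identity
for \<open>\<phi>\<close> removes the denominator of \<open>du/v\<close> there.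
\<close>

lemma differential_regular_where_finite:
  assumes \<phi>: "a * \<phi> + b * pderiv \<phi> = 1" "Polynomial.degree \<phi> \<le> 6"
    and uv: "v \<in> L" "v ^ 2 = evc c u \<phi>" "v \<noteq> 0"
    and z: "z \<in> R" "z * u \<in> R"
  shows "\<exists>N. z ^ N * (\<delta> u / v) \<in> R \<and> z ^ N * (\<delta> u / v * u) \<in> R"
proof -
  \<comment> \<open>By the Bezout identity \<open>du/v = a(u) v du + 2 b(u) dv\<close>, which no longer has a denominator.\<close>
  define A B where "A = evc c u a" and "B = evc c u b"
  define i j where "i = Polynomial.degree a" and "j = Polynomial.degree b"
  have zA: "z ^ i * A \<in> R" and zB: "z ^ j * B \<in> R"
    unfolding A_def B_def i_def j_def using z by (intro R_evc_clear; simp)+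
  have "(z ^ 3 * v) * (z ^ 3 * v) = (z ^ 3) ^ 2 * v ^ 2"
    by (simp add: power2_eq_square)
  also have "\<dots> = z ^ 6 * evc c u \<phi>" by (simp add: uv(2) flip: power_mult)
  also have "\<dots> \<in> R" using z \<phi> by (intro R_evc_clear)
  finally have zv: "z ^ 3 * v \<in> R"
    by (rule integrally_closed[OF L_mult[OF L_power[OF L_R[OF z(1)]] uv(1)]])
  have "z ^ 2 * \<delta> u = z * \<delta> (z * u) - \<delta> z * (z * u)"
    by (simp add: d_mult power2_eq_square algebra_simps)
  also have "\<dots> \<in> R" by (rule R_diff[OF R_mult[OF z(1) R_d[OF z(2)]] R_mult[OF R_d[OF z(1)] z(2)]])
  finally have zdu: "z ^ 2 * \<delta> u \<in> R" .
  have dz3: "\<delta> (z ^ 3) = 3 * z ^ 2 * \<delta> z"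
    by (simp add: d_mult power2_eq_square power3_eq_cube algebra_simps)
  have "z ^ 4 * \<delta> v = z * \<delta> (z ^ 3 * v) - c 3 * \<delta> z * (z ^ 3 * v)"
    by (simp add: d_mult dz3 c_numeral algebra_simps power4_eq_xxxx power2_eq_square power3_eq_cube)
  also have "\<dots> \<in> R" by (rule R_diff[OF R_mult[OF z(1) R_d[OF zv]] R_mult[OF R_mult[OF R_c R_d[OF z(1)]] zv]])
  finally have zdv: "z ^ 4 * \<delta> v \<in> R" .
  have "2 * v * \<delta> v = evc c u (pderiv \<phi>) * \<delta> u"
    using d_mult[of v v] d_evc[of u \<phi>] uv(2) by (simp add: power2_eq_square algebra_simps)
  moreover have "A * v ^ 2 + B * evc c u (pderiv \<phi>) = 1"
    unfolding A_def B_def uv(2) by (simp flip: evc_mult evc_add add: \<phi>(1) evc_1)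
  ultimately have "\<delta> u = A * v ^ 2 * \<delta> u + B * (2 * v * \<delta> v)"
    by (metis distrib_right mult.assoc mult_1)
  then have h: "\<delta> u / v = A * v * \<delta> u + c 2 * B * \<delta> v"
    using uv(3) by (simp add: c_numeral field_simps power2_eq_square)
  define N where "N = i + j + 5"
  have "z ^ N * (\<delta> u / v) = (z ^ j) * ((z ^ i * A) * (z ^ 3 * v) * (z ^ 2 * \<delta> u))
          + c 2 * (z ^ i * z) * (z ^ j * B) * (z ^ 4 * \<delta> v)"
  proof -
    have "z ^ 5 = z ^ 3 * z ^ 2" "z ^ 5 = z * z ^ 4" by (simp_all flip: power_add power_Suc)
    then have N: "z ^ N = z ^ i * z ^ j * (z ^ 3 * z ^ 2)" "z ^ N = z ^ i * z ^ j * (z * z ^ 4)"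
      by (simp_all add: N_def power_add)
    have "z ^ N * (A * v * \<delta> u) = (z ^ j) * ((z ^ i * A) * (z ^ 3 * v) * (z ^ 2 * \<delta> u))"
      unfolding N(1) by (simp only: mult_ac)
    moreover have "z ^ N * (c 2 * B * \<delta> v) = c 2 * (z ^ i * z) * (z ^ j * B) * (z ^ 4 * \<delta> v)"
      unfolding N(2) by (simp only: mult_ac)
    ultimately show ?thesis unfolding h by (simp only: distrib_left)
  qed
  also have "\<dots> \<in> R"
    by (rule R_add[OF R_mult[OF R_power[OF z(1)] R_mult[OF R_mult[OF zA zv] zdu]]
          R_mult[OF R_mult[OF R_mult[OF R_c R_mult[OF R_power[OF z(1)] z(1)]] zB] zdv]])
  finally have 1: "z ^ N * (\<delta> u / v) \<in> R" .
  have "z ^ Suc N * (\<delta> u / v) \<in> R" using R_mult[OF z(1) 1] by (simp add: mult.assoc)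
  moreover have "z ^ Suc N * (\<delta> u / v * u) \<in> R" using R_mult[OF z(2) 1] by (simp add: algebra_simps)
  ultimately show ?thesis by blast
qed

text \<open>
The radical of an ideal is closed under addition, by the binomial theorem.
\<close>

lemma radical_unit_ideal:
  assumes J: "\<And>a b. a \<in> J \<Longrightarrow> b \<in> J \<Longrightarrow> a + b \<in> J" "\<And>r a. r \<in> R \<Longrightarrow> a \<in> J \<Longrightarrow> r * a \<in> J" "0 \<in> J"
    and "a \<in> R" "b \<in> R" "a ^ n \<in> J" "b ^ m \<in> J"
  shows "(a + b) ^ (n + m) \<in> J"
proof -
  have s: "(\<Sum>k\<in>K. g k) \<in> J" if "\<And>k. k \<in> K \<Longrightarrow> g k \<in> J" for K :: "nat set" and g
    using that by (induction K rule: infinite_finite_induct) (auto simp: J)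
  have "(a + b) ^ (n + m) = (\<Sum>k\<le>n + m. of_nat ((n + m) choose k) * a ^ k * b ^ (n + m - k))"
    by (rule binomial_ring)
  also have "\<dots> \<in> J"
  proof (rule s)
    fix k
    show "of_nat ((n + m) choose k) * a ^ k * b ^ (n + m - k) \<in> J"
    proof (cases "n \<le> k")
      case True
      then have "a ^ k = a ^ (k - n) * a ^ n" by (simp flip: power_add)
      then have "of_nat ((n + m) choose k) * a ^ k * b ^ (n + m - k)
        = (c (of_nat ((n + m) choose k)) * a ^ (k - n) * b ^ (n + m - k)) * a ^ n"
        by (simp only: c_of_nat mult_ac)
      also have "\<dots> \<in> J" using assms by (intro J(2) R_mult R_power R_c)
      finally show ?thesis .
    next
      case False
      then have "n + m - k = (n - k) + m" by simp
      then have "of_nat ((n + m) choose k) * a ^ k * b ^ (n + m - k)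
        = (c (of_nat ((n + m) choose k)) * a ^ k * b ^ (n - k)) * b ^ m"
        by (simp only: c_of_nat power_add mult_ac)
      also have "\<dots> \<in> J" using assms by (intro J(2) R_mult R_power R_c)
      finally show ?thesis .
    qed
  qed
  finally show ?thesis .
qed

text \<open>
If \<open>u\<close> satisfies a primitive quadratic equation with coefficients \<open>\<alpha>, \<beta>, \<gamma>\<close>, then \<open>\<alpha>\<close> and \<open>\<alpha> u + \<beta>\<close> are denominators of \<open>u\<close>,
while \<open>\<gamma>\<close> and \<open>\<alpha> u\<close> are denominators of \<open>1/u\<close>. Near a zero of \<open>1/u\<close> one passes to the point \<open>(1/u, v/u^3)\<close> of the curve with the
reversed polynomial \<open>\<phi>'\<close>; this exchanges \<open>du/v\<close> and \<open>u du/v\<close> up to sign. Since \<open>\<alpha>, \<beta>, \<gamma>\<close> generate the unit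
ideal, the local statements combine.
\<close>

lemma differential_regular:
  assumes \<phi>: "a * \<phi> + b * pderiv \<phi> = 1" "Polynomial.degree \<phi> \<le> 6"
    and \<phi>': "a' * \<phi>' + b' * pderiv \<phi>' = 1" "Polynomial.degree \<phi>' \<le> 6"
    and swap: "\<And>t. t \<noteq> 0 \<Longrightarrow> evc c (1 / t) \<phi>' = evc c t \<phi> / t ^ 6"
    and uv: "u \<in> L" "v \<in> L" "v ^ 2 = evc c u \<phi>" "v \<noteq> 0" "u \<noteq> 0"
  shows "\<delta> u / v \<in> R \<and> \<delta> u / v * u \<in> R"
proof -
  from uv(1) obtain p q d where u: "u = (ev p + ev q * y) / ev d" and d: "d \<noteq> 0" by (auto simp: L_def)
  \<comment> \<open>\<open>u\<close> is a root of \<open>al T^2 + be T + ga\<close>, whose coefficients are made coprime by dividing by \<open>g\<close>.\<close>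
  define al0 be0 ga0 where "al0 = d ^ 2" and "be0 = - (2 * d * p)" and "ga0 = p ^ 2 - q ^ 2 * f"
  define g where "g = gcd al0 (gcd be0 ga0)"
  have al0: "al0 \<noteq> 0" using d by (simp add: al0_def)
  then have g: "g \<noteq> 0" by (simp add: g_def)
  have ev2: "ev 2 = 2" using evc_add[of x 1 1] by (simp add: evc_1)
  have "ev al0 * u ^ 2 + ev be0 * u + ev ga0 = 0"
    unfolding al0_def be0_def ga0_def u
    using d by (simp add: evc_simps ev2 ev_eq_0_iff field_simps power2_eq_square y_sq[symmetric, unfolded power2_eq_square])
  moreover obtain al be ga where abg: "al0 = g * al" "be0 = g * be" "ga0 = g * ga"
    unfolding g_def by (meson dvdE gcd_dvd1 gcd_dvd2 dvd_trans)
  ultimately have "ev g * (ev al * u ^ 2 + ev be * u + ev ga) = 0"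
    by (simp add: evc_simps algebra_simps)
  then have quad: "ev al * u ^ 2 + ev be * u + ev ga = 0" using g by (simp add: ev_eq_0_iff)
  have al: "al \<noteq> 0" using al0 abg by auto
  obtain e1 e2 e3 where "e1 * al0 + e2 * be0 + e3 * ga0 = g"
  proof -
    obtain r s where rs: "r * be0 + s * ga0 = gcd be0 ga0" using bezout_coefficients_fst_snd by blast
    obtain r' s' where "r' * al0 + s' * gcd be0 ga0 = g" unfolding g_def using bezout_coefficients_fst_snd by blast
    then have "r' * al0 + (s' * r) * be0 + (s' * s) * ga0 = g"
      unfolding rs[symmetric] by (simp add: algebra_simps)
    then show ?thesis by (rule that)
  qed
  then have "g * (e1 * al + e2 * be + e3 * ga) = g * 1" by (simp add: abg algebra_simps)
  then have bez: "e1 * al + e2 * be + e3 * ga = 1" using g by (simp only: mult_cancel_left) auto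

  define s where "s = ev al * u"
  define w where "w = s + ev be"
  have su: "s * s + ev be * s + ev (al * ga) = 0"
  proof -
    have "ev al * (ev al * u ^ 2 + ev be * u + ev ga) = 0" using quad by simp
    then show ?thesis by (simp add: s_def evc_simps power2_eq_square algebra_simps)
  qed
  have "s \<in> R"
  proof -
    define t where "t = ev be / 2"
    have "t + t = 2 * t" by simp
    also have "\<dots> = ev be" unfolding t_def using two_neq_0 by (metis nonzero_mult_div_cancel_left times_divide_eq_right)
    finally have "s * s + (t + t) * s + ev (al * ga) = 0" using su by (simp only:)
    then have "(s + t) * (s + t) - (t * t - ev (al * ga)) = 0" by (simp only: algebra_simps) simp
    then have "(s + ev be / 2) * (s + ev be / 2) = (ev be / 2) * (ev be / 2) - ev (al * ga)"
      by (simp only: t_def right_minus_eq)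
    also have "\<dots> \<in> R" by (intro R_diff R_mult R_half R_ev)
    finally have "s + ev be / 2 \<in> R" unfolding s_def
      by (rule integrally_closed[OF L_add[OF L_mult[OF L_R[OF R_ev] uv(1)] L_R[OF R_half[OF R_ev]]]])
    then show ?thesis using R_diff[OF _ R_half[OF R_ev[of be]], of "s + ev be / 2"] by simp
  qed
  then have w: "w \<in> R" unfolding w_def by (intro R_add R_ev)
  have wu: "w * u = - ev ga" using quad by (simp add: w_def s_def power2_eq_square algebra_simps add_eq_0_iff)

  \<comment> \<open>\<open>J\<close> is the ideal of denominators of both differentials. Its radical contains \<open>al\<close>, \<open>w\<close>, \<open>s\<close>, \<open>ga\<close>,
    hence also \<open>be = w - s\<close>, and these generate the unit ideal.\<close>
  define h where "h = \<delta> u / v"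
  define J where "J = {r \<in> R. r * h \<in> R \<and> r * (h * u) \<in> R}"
  have J: "\<And>a b. a \<in> J \<Longrightarrow> b \<in> J \<Longrightarrow> a + b \<in> J" "\<And>r a. r \<in> R \<Longrightarrow> a \<in> J \<Longrightarrow> r * a \<in> J" "0 \<in> J"
    unfolding J_def by (auto simp: R_add R_mult R_0 distrib_right mult.assoc)
  have loc: "\<exists>N. z ^ N \<in> J" if "z \<in> R" "z * u \<in> R" for z
    using differential_regular_where_finite[OF \<phi> uv(2,3,4) that] that by (auto simp: J_def h_def R_power)
  have loc': "\<exists>N. z ^ N \<in> J" if "z \<in> R" "z * (1 / u) \<in> R" for z
  proof -
    have 1: "v / u ^ 3 \<in> L" using uv by (intro L_divide L_power)
    have 2: "(v / u ^ 3) ^ 2 = evc c (1 / u) \<phi>'"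
      using uv swap[of u] by (simp add: power_divide)
    have 3: "\<delta> (1 / u) / (v / u ^ 3) = - (h * u)" "- (h * u) * (1 / u) = - h"
      using uv by (simp_all add: h_def d_inverse field_simps power2_eq_square power3_eq_cube)
    have "\<exists>N. z ^ N * (- (h * u)) \<in> R \<and> z ^ N * (- h) \<in> R"
      using differential_regular_where_finite[OF \<phi>' 1 2 _ that] uv unfolding 3 by simp
    then obtain N where "z ^ N * (- (h * u)) \<in> R" "z ^ N * (- h) \<in> R" by blast
    then have "z ^ N * (h * u) \<in> R" "z ^ N * h \<in> R"
      using R_uminus by (metis minus_minus mult_minus_right)+
    then show ?thesis using that by (auto simp: J_def R_power)
  qed
  have "\<exists>N. (ev e1 * ev al) ^ N \<in> J" using loc[of "ev al"] \<open>s \<in> R\<close>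
    by (metis J(2) R_ev R_power power_mult_distrib s_def)
  moreover have "\<exists>N. (ev e2 * w) ^ N \<in> J" using loc[of w] w wu
    by (metis J(2) R_ev R_power R_uminus power_mult_distrib)
  moreover have "\<exists>N. (- ev e2 * s) ^ N \<in> J" using loc'[of s] \<open>s \<in> R\<close> uv
    by (metis J(2) R_ev R_power R_uminus power_mult_distrib s_def mult.assoc nonzero_mult_div_cancel_right times_divide_eq_right mult.right_neutral)
  moreover have "\<exists>N. (ev e3 * ev ga) ^ N \<in> J"
  proof -
    have "ev ga * (1 / u) = - w" using wu uv by (simp add: field_simps)
    then show ?thesis using loc'[of "ev ga"] w R_uminus
      by (metis J(2) R_ev R_power power_mult_distrib)
  qed
  ultimately obtain n1 n2 n3 n4 where n: "(ev e1 * ev al) ^ n1 \<in> J" "(ev e2 * w) ^ n2 \<in> J"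
    "(- ev e2 * s) ^ n3 \<in> J" "(ev e3 * ev ga) ^ n4 \<in> J" by blast
  have one: "((ev e1 * ev al + ev e2 * w) + - ev e2 * s) + ev e3 * ev ga = 1"
    using arg_cong[OF bez, of ev] by (simp add: w_def evc_simps algebra_simps)
  have "(((ev e1 * ev al + ev e2 * w) + - ev e2 * s) + ev e3 * ev ga) ^ (((n1 + n2) + n3) + n4) \<in> J"
    using n \<open>s \<in> R\<close> w by (intro radical_unit_ideal[OF J] R_add R_mult R_ev R_uminus)
  then have "1 \<in> J" unfolding one by simp
  then show ?thesis by (simp add: J_def h_def)
qed

end

section \<open>Rigidity of the generic point\<close>

unbundle fps_syntax

text \<open>
The hypothesis says that \<open>x \<mapsto> (a x + b) / (c x + d)\<close> preserves the zeros of \<open>x^6 + x + 1\<close>. That polynomial has second derivative \<open>30 x^4\<close>. If \<open>c\<close> were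
not 0, comparing second and third derivatives at the pole of the transformation would
force \<open>b = 0\<close>, and then the coefficients of \<open>x^2\<close> and \<open>x^3\<close> give \<open>a = - 3 c\<close> and \<open>a = - 2 c\<close>.
\<close>

lemma mobius_rigid:
  fixes a b c d k :: complex
  assumes eq: "[:b, a:] ^ 6 + [:b, a:] * [:d, c:] ^ 5 + [:d, c:] ^ 6 = smult k [:1, 1, 0, 0, 0, 0, 1:]"
    and det: "a * d - b * c \<noteq> 0"
  shows "c = 0 \<and> b = 0 \<and> a = d"
proof -
  have cf: "poly.coeff ([:b, a:] ^ 6 + [:b, a:] * [:d, c:] ^ 5 + [:d, c:] ^ 6) n
      = k * poly.coeff [:1, 1, 0, 0, 0, 0, 1:] n" for n
    unfolding eq by (simp only: coeff_smult)
  have E6: "a ^ 6 + a * c ^ 5 + c ^ 6 = k"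
    using cf[of 6] by (simp add: numeral_eq_Suc algebra_simps)
  have E5: "6 * a ^ 5 * b + b * c ^ 5 + 5 * a * c ^ 4 * d + 6 * c ^ 5 * d = 0"
    using cf[of 5] by (simp add: numeral_eq_Suc algebra_simps)
  have E3: "20 * a ^ 3 * b ^ 3 + 10 * b * c ^ 3 * d ^ 2 + 10 * a * c ^ 2 * d ^ 3 + 20 * c ^ 3 * d ^ 3 = 0"
    using cf[of 3] by (simp add: numeral_eq_Suc algebra_simps)
  have E2: "15 * a ^ 2 * b ^ 4 + 10 * b * c ^ 2 * d ^ 3 + 5 * a * c * d ^ 4 + 15 * c ^ 2 * d ^ 4 = 0"
    using cf[of 2] by (simp add: numeral_eq_Suc algebra_simps)
  have E1: "6 * a * b ^ 5 + 5 * b * c * d ^ 4 + a * d ^ 5 + 6 * c * d ^ 5 = k"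
    using cf[of 1] by (simp add: numeral_eq_Suc algebra_simps)
  have E0: "b ^ 6 + b * d ^ 5 + d ^ 6 = k"
    using cf[of 0] by (simp add: numeral_eq_Suc algebra_simps)
  show ?thesis
  proof (cases "c = 0")
    case True
    with det have ad: "a \<noteq> 0" "d \<noteq> 0" by auto
    with E5 True have b: "b = 0" by simp
    with E0 E1 True have "a * d ^ 5 = d ^ 6" by simp
    then have "a * d ^ 5 = d * d ^ 5" by (simp flip: power_Suc)
    with ad b True show ?thesis by simp
  next
    case c: False
    \<comment> \<open>At the root \<open>t\<close> of \<open>c x + d\<close> the second and third derivatives of the last two summands vanish.\<close>
    define t w where "t = - d / c" and "w = a * t + b"
    have ct: "d + t * c = 0" "d + c * t = 0" using c by (simp_all add: t_def)
    have bt: "b + t * a = w" "b + a * t = w" by (simp_all add: w_def)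
    have "w * c = - (a * d - b * c)" using c by (simp add: w_def t_def field_simps)
    with det have w: "w \<noteq> 0" by auto
    define M N where "M = [:b, a:]" and "N = [:d, c:]"
    have MN: "pderiv M = [:a:]" "pderiv N = [:c:]" "poly M t = w" "poly N t = 0"
      using ct bt by (simp_all add: M_def N_def pderiv_pCons)
    let ?l = "M ^ 6 + M * N ^ 5 + N ^ 6"
    let ?r = "smult k [:1, 1, 0, 0, 0, 0, 1:]"
    have eq': "?l = ?r" using eq by (simp only: M_def N_def)
    have "poly (pderiv (pderiv ?l)) t = poly (pderiv (pderiv ?r)) t" unfolding eq' ..
    then have W2: "a ^ 2 * w ^ 4 = k * t ^ 4"
      by (simp add: pderiv_add pderiv_mult pderiv_power pderiv_pCons pderiv_smult MN algebra_simps power2_eq_square power4_eq_xxxx)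
    have "poly (pderiv (pderiv (pderiv ?l))) t = poly (pderiv (pderiv (pderiv ?r))) t" unfolding eq' ..
    then have W3: "a ^ 3 * w ^ 3 = k * t ^ 3"
      by (simp add: pderiv_add pderiv_mult pderiv_power pderiv_pCons pderiv_smult MN algebra_simps power2_eq_square power3_eq_cube)
    show ?thesis
    proof (cases "d = 0")
      case True
      then have "t = 0" by (simp add: t_def)
      with W2 w have "a = 0" by simp
      with E5 True c have "b = 0" by simp
      with \<open>a = 0\<close> det show ?thesis by simp
    next
      case False
      then have t: "t \<noteq> 0" using c by (simp add: t_def)
      have "a \<noteq> 0"
      proof
        assume "a = 0"
        with W2 t have "k = 0" by simp
        with E6 \<open>a = 0\<close> c show False by simp
      qed
      have "a ^ 2 * w ^ 3 * w = a ^ 2 * w ^ 3 * (a * t)"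
      proof -
        have "a ^ 2 * w ^ 3 * w = k * t ^ 4" unfolding W2[symmetric] by (simp add: power3_eq_cube power4_eq_xxxx)
        also have "\<dots> = (a ^ 3 * w ^ 3) * t" unfolding W3 by (simp add: power3_eq_cube power4_eq_xxxx)
        finally show ?thesis by (simp add: power2_eq_square power3_eq_cube algebra_simps)
      qed
      with \<open>a \<noteq> 0\<close> w have "w = a * t" by simp
      then have b: "b = 0" by (simp add: w_def)
      from E2 b have "(5 * c * d ^ 4) * (a + 3 * c) = 0" by (simp add: algebra_simps power2_eq_square)
      with c False have 1: "a + 3 * c = 0" by simp
      from E3 b have "(10 * c ^ 2 * d ^ 3) * (a + 2 * c) = 0"
        by (simp add: algebra_simps power2_eq_square power3_eq_cube)
      with c False have 2: "a + 2 * c = 0" by simp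
      from 1 2 have "(a + 3 * c) - (a + 2 * c) = 0" by simp
      then have "c = 0" by simp
      with c show ?thesis by simp
    qed
  qed
qed

text \<open>
The curve is \<open>y^2 = sextic x\<close>. Its chart at infinity has the coordinates \<open>1/x\<close> and \<open>y/x^3\<close> and the reversed polynomial.
\<close>

definition sextic :: "complex poly" where "sextic = [:2, 2, 0, 0, 0, 0, 2:]"
definition sextic_rev :: "complex poly" where "sextic_rev = [:2, 0, 0, 0, 0, 2, 2:]"

lemma degree_sextic: "Polynomial.degree sextic = 6" "Polynomial.degree sextic_rev = 6"
  by (simp_all add: sextic_def sextic_rev_def)

lemma degree_sextic_pos: "0 < Polynomial.degree sextic" "0 < Polynomial.degree sextic_rev"
  unfolding degree_sextic by simp_all

text \<open>
The cofactors are the solution of a linear system; \<open>43531 = 6^6 - 5^5\<close> is the discriminant of \<open>x^6 + x + 1\<close> up to sign.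
\<close>

lemma sextic_bezout:
  "smult (1 / 43531) [:23328, -19440, 16200, -13500, 11250:] * sextic
     + smult (1 / 87062) [:-3125, -7776, 6480, -5400, 4500, -3750:] * pderiv sextic = 1"
  by (simp add: sextic_def pderiv_pCons one_pCons)

lemma sextic_rev_bezout:
  "smult (1 / 87062) [:43531, 0, 0, 0, 6480:] * sextic_rev
     + smult (1 / 87062) [:-1296, -7151, -125, 150, -180, -1080:] * pderiv sextic_rev = 1"
  by (simp add: sextic_rev_def pderiv_pCons one_pCons)

text \<open>
The function field of the curve is realised inside the field of Laurent series at \<open>x = 0\<close>, where the derivation with respect to \<open>x\<close> is
at hand and its kernel is known to be the field of constants. A square root of the sextic exists there
because \<open>sextic 0 \<noteq> 0\<close>.
\<close>

definition generic_y :: "complex fls" where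
  "generic_y = fps_to_fls (fps_radical (\<lambda>_. csqrt) 2 (fps_of_poly sextic))"

interpretation fls: const_embedding "fls_const :: complex \<Rightarrow> complex fls"
  by unfold_locales (simp_all add: fls_plus_const)

lemma evc_fls_X_nth:
  fixes p :: "complex poly"
  shows "evc fls_const fls_X p $$ n = (if n \<ge> 0 then poly.coeff p (nat n) else 0)"
proof (induction p arbitrary: n)
  case (pCons a p)
  then show ?case
    by (cases "n > 0") (auto simp: fls.evc_pCons fls_X_times_conv_shift coeff_pCons Suc_nat_eq_nat_zadd1 nat_diff_distrib split: nat.split)
qed (simp add: fls.evc_0)

lemma evc_fls_X_inv_nth:
  fixes p :: "complex poly"
  shows "evc fls_const fls_X_inv p $$ n = (if n \<le> 0 then poly.coeff p (nat (- n)) else 0)"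
proof (induction p arbitrary: n)
  case (pCons a p)
  then show ?case
    by (cases "n < 0") (auto simp: fls.evc_pCons fls_X_inv_times_conv_shift coeff_pCons Suc_nat_eq_nat_zadd1 nat_diff_distrib split: nat.split)
qed (simp add: fls.evc_0)

lemma evc_fls_X_eq:
  fixes p :: "complex poly"
  shows "evc fls_const fls_X p = fps_to_fls (fps_of_poly p)"
  by (intro fls_eqI) (auto simp: evc_fls_X_nth)

lemma generic_y_sq: "generic_y ^ 2 = evc fls_const fls_X sextic"
proof -
  let ?s = "fps_of_poly sextic"
  have "?s $ 0 \<noteq> 0" by (simp add: sextic_def)
  from power_radical[OF this, of "\<lambda>_. csqrt" 1] have "fps_radical (\<lambda>_. csqrt) (Suc 1) ?s ^ Suc 1 = ?s"
    by (simp add: power2_csqrt[unfolded power2_eq_square])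
  then have "fps_radical (\<lambda>_. csqrt) 2 ?s ^ 2 = ?s" by (simp add: numeral_2_eq_2)
  then show ?thesis by (simp add: generic_y_def evc_fls_X_eq flip: fps_to_fls_power)
qed

lemma evc_sextic: "evc fls_const u sextic = 2 * u ^ 6 + 2 * u + 2"
  by (simp add: sextic_def fls.evc_pCons fls.evc_0 algebra_simps numeral_eq_Suc fls_plus_const[symmetric])

lemma evc_sextic_rev: "evc fls_const u sextic_rev = 2 * u ^ 6 + 2 * u ^ 5 + 2"
  by (simp add: sextic_rev_def fls.evc_pCons fls.evc_0 algebra_simps numeral_eq_Suc fls_plus_const[symmetric])

lemma fls_X_X_inv: "fls_X * fls_X_inv = (1 :: complex fls)"
  using right_inverse[of "fls_X :: complex fls"] by (simp add: fls_inverse_X)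

text \<open>
Both charts get the independence of \<open>1\<close> and \<open>y\<close> from this, once their coordinate is known to be transcendental.
\<close>

lemma indep_from_injective:
  fixes p q f :: "complex poly"
  assumes inj: "\<And>p. evc fls_const x p = 0 \<Longrightarrow> p = 0" and y: "y ^ 2 = evc fls_const x f"
    and f: "squarefree f" "Polynomial.degree f > 0"
    and eq: "evc fls_const x p + evc fls_const x q * y = 0"
  shows "p = 0 \<and> q = 0"
proof -
  from eq have "evc fls_const x p = - (evc fls_const x q * y)" by (simp add: add_eq_0_iff)
  then have "evc fls_const x p ^ 2 = evc fls_const x q ^ 2 * evc fls_const x f"
    by (simp add: power_mult_distrib y)
  then have "evc fls_const x (p ^ 2 - q ^ 2 * f) = 0" by (simp add: fls.evc_simps)
  then have "p ^ 2 = q ^ 2 * f" using inj by fastforce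
  with f show ?thesis by (rule poly_square_factor)
qed

interpretation fin: curve_chart fls_const fls_X generic_y "\<lambda>g. generic_y * fls_deriv g" sextic
    "smult (1 / 43531) [:23328, -19440, 16200, -13500, 11250:]"
    "smult (1 / 87062) [:-3125, -7776, 6480, -5400, 4500, -3750:]"
proof unfold_locales
  fix p q
  assume "evc fls_const fls_X p + evc fls_const fls_X q * generic_y = 0"
  then show "p = 0 \<and> q = 0"
  proof (rule indep_from_injective[rotated -1])
    show "p = 0" if "evc fls_const fls_X p = 0" for p :: "complex poly"
    proof (rule poly_eqI)
      fix n show "poly.coeff p n = poly.coeff 0 n"
        using arg_cong[OF that, of "\<lambda>g. g $$ int n"] by (simp add: evc_fls_X_nth)
    qed
  qed (fact generic_y_sq squarefree_if_bezout_pderiv[OF sextic_bezout] degree_sextic_pos)+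
qed (fact generic_y_sq sextic_bezout | simp add: algebra_simps)+

text \<open>
At infinity \<open>d(1/x) / (y/x^3) = - x dx/y\<close>, so the derivation of this chart is \<open>- 1/x\<close> times that of the finite chart.
\<close>

interpretation inf: curve_chart fls_const fls_X_inv "generic_y * fls_X_inv ^ 3" "\<lambda>g. - (generic_y * fls_X_inv * fls_deriv g)" sextic_rev
    "smult (1 / 87062) [:43531, 0, 0, 0, 6480:]"
    "smult (1 / 87062) [:-1296, -7151, -125, 150, -180, -1080:]"
proof unfold_locales
  have *: "(generic_y * fls_X_inv ^ 3) ^ 2 = evc fls_const fls_X_inv sextic_rev"
  proof -
    have "(2 * x ^ 6 + 2 * x + 2) * z ^ 6 = 2 * (x * z) ^ 6 + 2 * (x * z) * z ^ 5 + 2 * z ^ 6" for x z :: "complex fls"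
      by (simp add: algebra_simps power_mult_distrib numeral_eq_Suc)
    from this[of fls_X fls_X_inv] show ?thesis
      by (simp add: power_mult_distrib generic_y_sq evc_sextic evc_sextic_rev fls_X_X_inv flip: power_mult)
  qed
  then show "(generic_y * fls_X_inv ^ 3) ^ 2 = evc fls_const fls_X_inv sextic_rev" .
  fix p q
  assume "evc fls_const fls_X_inv p + evc fls_const fls_X_inv q * (generic_y * fls_X_inv ^ 3) = 0"
  then show "p = 0 \<and> q = 0"
  proof (rule indep_from_injective[rotated -1])
    show "p = 0" if "evc fls_const fls_X_inv p = 0" for p :: "complex poly"
    proof (rule poly_eqI)
      fix n show "poly.coeff p n = poly.coeff 0 n"
        using arg_cong[OF that, of "\<lambda>g. g $$ (- int n)"] by (simp add: evc_fls_X_inv_nth)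
    qed
  qed (fact * squarefree_if_bezout_pderiv[OF sextic_rev_bezout] degree_sextic_pos)+
qed (fact sextic_rev_bezout | simp add: algebra_simps power2_eq_square power3_eq_cube)+

lemma fin_L_subset_inf_L: "u \<in> fin.L \<Longrightarrow> u \<in> inf.L"
proof -
  have X: "fls_X \<in> inf.L"
  proof -
    have "fls_X_inv \<noteq> (0 :: complex fls)" using fls_X_X_inv by (metis mult_zero_right zero_neq_one)
    then have "fls_X = 1 / (fls_X_inv :: complex fls)" using fls_X_X_inv by (rule eq_divide_imp)
    moreover have "1 / fls_X_inv \<in> inf.L"
      using inf.L_inverse[OF inf.L_R[OF inf.R_ev[of "[:0, 1:]"]]] by (simp only: fls.evc_X)
    ultimately show ?thesis by (simp only:)
  qed
  have generic_y: "generic_y \<in> inf.L"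
  proof -
    have "(generic_y * fls_X_inv ^ 3) * fls_X ^ 3 = generic_y * (fls_X * fls_X_inv) ^ 3" by (simp only: power_mult_distrib mult_ac)
    then have "generic_y = (generic_y * fls_X_inv ^ 3) * fls_X ^ 3" by (simp add: fls_X_X_inv)
    also have "\<dots> \<in> inf.L" by (rule inf.L_mult[OF inf.L_R[OF inf.R_y] inf.L_power[OF X]])
    finally show ?thesis .
  qed
  have ev: "evc fls_const fls_X p \<in> inf.L" for p
    by (induction p) (auto simp: fls.evc_0 fls.evc_pCons inf.L_R inf.R_0 intro!: inf.L_add inf.L_mult[OF X] inf.L_R[OF inf.R_c])
  show "u \<in> fin.L \<Longrightarrow> u \<in> inf.L"
    unfolding fin.L_def by (auto intro!: inf.L_divide[OF inf.L_add[OF ev inf.L_mult[OF ev generic_y]] ev])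
qed

lemma fls_X_power_clears:
  fixes p :: "complex poly"
  shows "Polynomial.degree p \<le> n \<Longrightarrow> \<exists>r. fls_X ^ n * evc fls_const fls_X_inv p = evc fls_const fls_X r"
proof (induction p arbitrary: n)
  case 0
  then show ?case by (auto simp: fls.evc_0 intro!: exI[of _ 0])
next
  case (pCons a p)
  show ?case
  proof (cases "p = 0")
    case True
    then show ?thesis
      by (intro exI[of _ "[:0, 1:] ^ n * [:a:]"]) (simp add: fls.evc_pCons fls.evc_0 fls.evc_simps fls.evc_X fls.evc_const)
  next
    case False
    with pCons.prems obtain m where m: "n = Suc m" "Polynomial.degree p \<le> m" by (cases n) auto
    from pCons.IH[OF m(2)] obtain r where r: "fls_X ^ m * evc fls_const fls_X_inv p = evc fls_const fls_X r" by blast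
    have "fls_X ^ n * evc fls_const fls_X_inv (pCons a p)
        = fls_X ^ n * fls_const a + (fls_X * fls_X_inv) * (fls_X ^ m * evc fls_const fls_X_inv p)"
      by (simp add: m fls.evc_pCons algebra_simps)
    also have "\<dots> = evc fls_const fls_X ([:0, 1:] ^ n * [:a:] + r)"
      by (simp add: r fls_X_X_inv fls.evc_simps fls.evc_X fls.evc_const)
    finally show ?thesis by blast
  qed
qed

text \<open>
If \<open>g dx/y\<close> is regular in both charts, then \<open>g\<close> is a polynomial in \<open>x\<close> and \<open>y\<close> while \<open>g/x\<close> is one in \<open>1/x\<close> and
\<open>y/x^3\<close>. Comparing exponents leaves only \<open>1\<close> and \<open>x\<close>: the space of regular differentials has dimension 2.
\<close>

lemma linear_if_regular_everywhere:
  assumes "g \<in> fin.R" "- (fls_X_inv * g) \<in> inf.R"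
  shows "\<exists>a b. g = fls_const a + fls_const b * fls_X"
proof -
  from assms(1) obtain p q where g: "g = fin.ev p + fin.ev q * generic_y" by (auto simp: fin.R_def)
  from assms(2) obtain p' q' where g': "- (fls_X_inv * g) = inf.ev p' + inf.ev q' * (generic_y * fls_X_inv ^ 3)"
    by (auto simp: inf.R_def)
  define N where "N = Suc (Polynomial.degree p' + Polynomial.degree q')"
  define P Q where "P = fin.ev p + fls_X * inf.ev p'" and "Q = fin.ev q + fls_X_inv ^ 2 * inf.ev q'"
  note XX = fls_X_X_inv
  have "g + fls_X * (inf.ev p' + inf.ev q' * (generic_y * fls_X_inv ^ 3)) = g - (fls_X * fls_X_inv) * g"
    unfolding g'[symmetric] by (simp add: algebra_simps)
  then have "g + fls_X * (inf.ev p' + inf.ev q' * (generic_y * fls_X_inv ^ 3)) = 0" by (simp add: XX)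
  moreover have "g + fls_X * (inf.ev p' + inf.ev q' * (generic_y * fls_X_inv ^ 3))
      = P + (fin.ev q + (fls_X * fls_X_inv) * (fls_X_inv ^ 2 * inf.ev q')) * generic_y"
    by (simp add: g P_def algebra_simps power2_eq_square power3_eq_cube)
  ultimately have PQ: "P + Q * generic_y = 0" by (simp add: XX Q_def)
  obtain r where r: "fls_X ^ N * inf.ev p' = fin.ev r"
    using fls_X_power_clears[of p' N] by (auto simp: N_def)
  obtain s where s: "fls_X ^ N * inf.ev q' = fin.ev s"
    using fls_X_power_clears[of q' N] by (auto simp: N_def)
  define x where "x = [:0, 1 :: complex:]"
  have ev_x: "fin.ev x = fls_X" by (simp add: x_def fls.evc_X)
  have P2: "fls_X ^ (N + 2) * P = fin.ev (x ^ (N + 2) * p + x ^ 3 * r)"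
    by (simp add: P_def fls.evc_simps ev_x r[symmetric] power_add algebra_simps power2_eq_square power3_eq_cube)
  have "fls_X ^ (N + 2) * Q = fls_X ^ (N + 2) * fin.ev q + (fls_X * fls_X_inv) ^ 2 * (fls_X ^ N * inf.ev q')"
    by (simp add: Q_def power_add power_mult_distrib algebra_simps power2_eq_square)
  then have Q2: "fls_X ^ (N + 2) * Q = fin.ev (x ^ (N + 2) * q + s)"
    by (simp add: XX fls.evc_simps ev_x s)
  have "fls_X ^ (N + 2) * P + (fls_X ^ (N + 2) * Q) * generic_y = 0"
    using arg_cong[OF PQ, of "\<lambda>g. fls_X ^ (N + 2) * g"] by (simp only: distrib_left mult.assoc mult_zero_right)
  then have "x ^ (N + 2) * p + x ^ 3 * r = 0 \<and> x ^ (N + 2) * q + s = 0"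
    unfolding P2 Q2 by (rule fin.indep)
  then have "fls_X ^ (N + 2) * P = 0 \<and> fls_X ^ (N + 2) * Q = 0"
    unfolding P2 Q2 by (simp only: fls.evc_0)
  then have P: "P = 0" and Q: "Q = 0" by auto
  have q: "q = 0"
  proof (rule poly_eqI)
    fix n
    have "0 = Q $$ int n" by (simp add: Q)
    also have "\<dots> = poly.coeff q n + inf.ev q' $$ (int n + 2)"
      by (simp only: Q_def fls_plus_nth evc_fls_X_nth fls_X_inv_power_times_conv_shift(1) fls_shift_nth) simp
    also have "\<dots> = poly.coeff q n" by (simp only: evc_fls_X_inv_nth) simp
    finally show "poly.coeff q n = poly.coeff 0 n" by simp
  qed
  have high: "poly.coeff p n = 0" if "n > 1" for n
  proof -
    have "0 = P $$ int n" by (simp add: P)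
    also have "\<dots> = poly.coeff p n + inf.ev p' $$ (int n - 1)"
      by (simp only: P_def fls_plus_nth evc_fls_X_nth fls_X_times_conv_shift(1) fls_shift_nth) simp
    also have "\<dots> = poly.coeff p n" using that by (simp only: evc_fls_X_inv_nth) simp
    finally show ?thesis by simp
  qed
  have "p = [:poly.coeff p 0, poly.coeff p 1:]"
    by (intro poly_eqI) (auto simp: coeff_pCons high split: nat.split)
  then obtain a b where "p = [:a, b:]" by blast
  then show ?thesis by (auto simp: g q fls.evc_pCons fls.evc_0 mult.commute)
qed

text \<open>
The two regular differentials \<open>h dx/y = du/v\<close> and \<open>h u dx/y = u du/v\<close> exhibit \<open>u\<close> as a Moebius transformation of \<open>x\<close>, and then
\<open>v^2 = sextic u\<close> says that it preserves the branch points.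
\<close>

theorem generic_point_rigid:
  assumes u: "u \<in> fin.L" and v: "v \<in> fin.L" and eq: "v ^ 2 = 2 * u ^ 6 + 2 * u + 2"
  shows "(\<exists>k. u = fls_const k) \<or> u = fls_X"
proof (rule disjCI)
  assume "u \<noteq> fls_X"
  show "\<exists>k. u = fls_const k"
  proof (rule ccontr)
  assume nc: "\<not> (\<exists>k. u = fls_const k)"
  have eq': "v ^ 2 = evc fls_const u sextic" by (simp add: evc_sextic eq)
  have du: "fls_deriv u \<noteq> 0" using nc fls_deriv_eq_0_iff by blast
  have u0: "u \<noteq> 0" using nc fls_const_0 by metis
  have v0: "v \<noteq> 0"
  proof
    assume "v = 0"
    with eq' have 0: "evc fls_const u sextic = 0" by simp
    with fin.d_evc[of u sextic] du fin.y_neq_0 have "evc fls_const u (pderiv sextic) = 0" by simp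
    with 0 have "evc fls_const u (A * sextic + B * pderiv sextic) = 0" for A B
      by (simp add: fls.evc_add fls.evc_mult)
    from this[of "smult (1 / 43531) [:23328, -19440, 16200, -13500, 11250:]"
        "smult (1 / 87062) [:-3125, -7776, 6480, -5400, 4500, -3750:]"]
    have "evc fls_const u 1 = 0" unfolding sextic_bezout .
    then show False by (simp add: fls.evc_1)
  qed
  have sw1: "evc fls_const (1 / t) sextic_rev = evc fls_const t sextic / t ^ 6"
   and sw2: "evc fls_const (1 / t) sextic = evc fls_const t sextic_rev / t ^ 6" if "t \<noteq> 0" for t
    using that by (simp_all add: evc_sextic evc_sextic_rev field_simps numeral_eq_Suc)
  define h where "h = generic_y * fls_deriv u / v"
  have dg: "Polynomial.degree sextic \<le> 6" "Polynomial.degree sextic_rev \<le> 6"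
    by (simp_all add: sextic_def sextic_rev_def)
  have 1: "h \<in> fin.R \<and> h * u \<in> fin.R" unfolding h_def
    by (rule fin.differential_regular[OF sextic_bezout dg(1) sextic_rev_bezout dg(2) sw1 u v eq' v0 u0])
  have "- (generic_y * fls_X_inv * fls_deriv u) / v \<in> inf.R \<and> - (generic_y * fls_X_inv * fls_deriv u) / v * u \<in> inf.R"
    by (rule inf.differential_regular[OF sextic_bezout dg(1) sextic_rev_bezout dg(2) sw1
          fin_L_subset_inf_L[OF u] fin_L_subset_inf_L[OF v] eq' v0 u0])
  moreover have "- (generic_y * fls_X_inv * fls_deriv u) / v = - (fls_X_inv * h)" 
    "- (generic_y * fls_X_inv * fls_deriv u) / v * u = - (fls_X_inv * (h * u))"
    by (simp_all add: h_def)
  ultimately have 2: "- (fls_X_inv * h) \<in> inf.R" "- (fls_X_inv * (h * u)) \<in> inf.R" by (simp_all only:)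
  obtain d c where h: "h = fls_const d + fls_const c * fls_X"
    using linear_if_regular_everywhere 1 2 by blast
  obtain b a where hu: "h * u = fls_const b + fls_const a * fls_X"
    using linear_if_regular_everywhere 1 2 by blast
  have h0: "h \<noteq> 0" using du v0 fin.y_neq_0 by (simp add: h_def)
  define \<Delta> where "\<Delta> = a * d - b * c"
  \<comment> \<open>\<open>u = (b + a x) / (d + c x)\<close> has derivative \<open>\<Delta> / h^2\<close>, whence \<open>v = \<Delta> y / h^3\<close>.\<close>
  have dh: "fls_deriv h = fls_const c" by (simp add: h)
  have "fls_deriv (h * u) = fls_const c * u + h * fls_deriv u"
    unfolding fls_deriv_mult dh by simp
  moreover have "fls_deriv (h * u) = fls_const a" unfolding hu by simp
  ultimately have "h * fls_deriv u = fls_const a - fls_const c * u"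
    by (simp only: eq_diff_eq add.commute)
  then have "h * (h * fls_deriv u) = h * (fls_const a - fls_const c * u)" by (simp only:)
  then have "h ^ 2 * fls_deriv u = fls_const a * h - fls_const c * (h * u)"
    by (simp only: power2_eq_square right_diff_distrib mult_ac)
  also have "\<dots> = fls_const \<Delta>"
    unfolding hu unfolding h by (simp add: \<Delta>_def algebra_simps flip: fls_const_mult_const fls_minus_const)
  finally have d2: "h ^ 2 * fls_deriv u = fls_const \<Delta>" .
  then have D0: "\<Delta> \<noteq> 0" using h0 du by auto
  have "v * h = generic_y * fls_deriv u" using v0 by (simp add: h_def)
  then have "v * h ^ 3 = generic_y * (h ^ 2 * fls_deriv u)" by (simp add: power2_eq_square power3_eq_cube algebra_simps)
  then have "(v * h ^ 3) ^ 2 = generic_y ^ 2 * fls_const (\<Delta> ^ 2)"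
    unfolding d2 by (simp add: power_mult_distrib fls_const_power)
  then have "h ^ 6 * (2 * u ^ 6 + 2 * u + 2) = generic_y ^ 2 * fls_const (\<Delta> ^ 2)"
    by (simp add: power_mult_distrib eq mult.commute flip: power_mult)
  moreover have "h ^ 6 * (2 * u ^ 6 + 2 * u + 2) = 2 * ((h * u) ^ 6 + (h * u) * h ^ 5 + h ^ 6)"
    by (simp add: power_mult_distrib algebra_simps numeral_eq_Suc)
  ultimately have "2 * ((h * u) ^ 6 + (h * u) * h ^ 5 + h ^ 6) = 2 * (fls_const (\<Delta> ^ 2) * (fls_X ^ 6 + fls_X + 1))"
    by (simp add: generic_y_sq evc_sextic algebra_simps)
  then have "(h * u) ^ 6 + (h * u) * h ^ 5 + h ^ 6 = fls_const (\<Delta> ^ 2) * (fls_X ^ 6 + fls_X + 1)"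
    by (metis fls.two_neq_0 mult_left_cancel)
  moreover have "h = fin.ev [:d, c:]" "h * u = fin.ev [:b, a:]"
    unfolding hu by (simp_all add: h fls.evc_pCons fls.evc_0 mult.commute)
  moreover have "fin.ev [:1, 1, 0, 0, 0, 0, 1:] = fls_X ^ 6 + fls_X + 1"
    by (simp add: fls.evc_pCons fls.evc_0 algebra_simps numeral_eq_Suc)
  ultimately have "fin.ev ([:b, a:] ^ 6 + [:b, a:] * [:d, c:] ^ 5 + [:d, c:] ^ 6) = fin.ev (smult (\<Delta> ^ 2) [:1, 1, 0, 0, 0, 0, 1:])"
    by (simp add: fls.evc_simps del: mult_pCons_left mult_pCons_right smult_pCons power2_eq_square)
  then have "fin.ev ([:b, a:] ^ 6 + [:b, a:] * [:d, c:] ^ 5 + [:d, c:] ^ 6 - smult (\<Delta> ^ 2) [:1, 1, 0, 0, 0, 0, 1:]) = 0"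
    unfolding fls.evc_diff by simp
  then have "[:b, a:] ^ 6 + [:b, a:] * [:d, c:] ^ 5 + [:d, c:] ^ 6 = smult (\<Delta> ^ 2) [:1, 1, 0, 0, 0, 0, 1:]"
    unfolding fin.ev_eq_0_iff by simp
  from mobius_rigid[OF this] D0 have "c = 0" "b = 0" "a = d" by (auto simp: \<Delta>_def)
  with h hu h0 have "fls_const d * u = fls_const d * fls_X" "fls_const d \<noteq> 0" by auto
  then have "u = fls_X" by simp
  with \<open>u \<noteq> fls_X\<close> show False by simp
  qed
qed

section \<open>Adjoining a generic point\<close>

text \<open>
The subfield of the complex numbers generated by \<open>S\<close>. Division by 0 yields 0, so it can be allowed.
\<close>

inductive_set field_gen :: "complex set \<Rightarrow> complex set" for S where
  gen: "z \<in> S \<Longrightarrow> z \<in> field_gen S"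
| one: "1 \<in> field_gen S"
| diff: "x \<in> field_gen S \<Longrightarrow> y \<in> field_gen S \<Longrightarrow> x - y \<in> field_gen S"
| divide: "x \<in> field_gen S \<Longrightarrow> y \<in> field_gen S \<Longrightarrow> x / y \<in> field_gen S"

definition is_subfield :: "complex set \<Rightarrow> bool" where
  "is_subfield K \<longleftrightarrow> 1 \<in> K \<and> (\<forall>x\<in>K. \<forall>y\<in>K. x - y \<in> K \<and> x / y \<in> K)"

lemma is_subfield_field_gen: "is_subfield (field_gen S)"
  unfolding is_subfield_def by (auto intro: field_gen.intros)

lemma field_gen_least: "is_subfield K \<Longrightarrow> S \<subseteq> K \<Longrightarrow> field_gen S \<subseteq> K"
proof
  fix z assume "is_subfield K" "S \<subseteq> K" "z \<in> field_gen S"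
  from this(3,1,2) show "z \<in> K"
    by (induction rule: field_gen.induct) (auto simp: is_subfield_def)
qed

lemma field_gen_mono: "S \<subseteq> T \<Longrightarrow> field_gen S \<subseteq> field_gen T"
  by (rule field_gen_least[OF is_subfield_field_gen]) (auto intro: field_gen.gen)

context
  fixes K assumes K: "is_subfield K"
begin

lemma subf_1: "1 \<in> K"
  and subf_diff: "x \<in> K \<Longrightarrow> y \<in> K \<Longrightarrow> x - y \<in> K"
  and subf_divide: "x \<in> K \<Longrightarrow> y \<in> K \<Longrightarrow> x / y \<in> K"
  using K by (auto simp: is_subfield_def)

lemma subf_0: "0 \<in> K" using subf_diff[OF subf_1 subf_1] by simp
lemma subf_uminus: "x \<in> K \<Longrightarrow> - x \<in> K" using subf_diff[OF subf_0, of x] by simp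
lemma subf_add: "x \<in> K \<Longrightarrow> y \<in> K \<Longrightarrow> x + y \<in> K" using subf_diff[OF _ subf_uminus, of x y] by simp
lemma subf_inverse: "x \<in> K \<Longrightarrow> inverse x \<in> K" using subf_divide[OF subf_1, of x] by (simp add: inverse_eq_divide)
lemma subf_mult: "x \<in> K \<Longrightarrow> y \<in> K \<Longrightarrow> x * y \<in> K" using subf_divide[OF _ subf_inverse, of x y] by (simp add: divide_inverse)
lemma subf_power: "x \<in> K \<Longrightarrow> x ^ n \<in> K" by (induction n) (simp_all add: subf_1 subf_mult)
lemma subf_of_nat: "of_nat n \<in> K" by (induction n) (simp_all add: subf_0 subf_1 subf_add)
lemma subf_numeral: "numeral n \<in> K" using subf_of_nat[of "numeral n"] by simp
lemma subf_sum: "(\<And>i. i \<in> A \<Longrightarrow> g i \<in> K) \<Longrightarrow> sum g A \<in> K"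
  by (induction A rule: infinite_finite_induct) (auto simp: subf_0 subf_add)
lemma subf_prod: "(\<And>i. i \<in> A \<Longrightarrow> g i \<in> K) \<Longrightarrow> prod g A \<in> K"
  by (induction A rule: infinite_finite_induct) (auto simp: subf_1 subf_mult)

end

definition polys_over :: "complex set \<Rightarrow> complex poly set" where
  "polys_over K = {p. \<forall>i. poly.coeff p i \<in> K}"

definition transcendental_over :: "complex set \<Rightarrow> complex \<Rightarrow> bool" where
  "transcendental_over K x \<longleftrightarrow> (\<forall>p \<in> polys_over K. poly p x = 0 \<longrightarrow> p = 0)"

definition sextic_value :: "complex \<Rightarrow> complex" where
  "sextic_value z = 2 * z ^ 6 + 2 * z + 2"

lemma poly_sextic: "poly sextic z = sextic_value z"
  by (simp add: sextic_def sextic_value_def algebra_simps numeral_eq_Suc)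

lemma countable_field_gen:
  assumes "countable S"
  shows "countable (field_gen S)"
proof -
  define step where "step T = T \<union> (\<lambda>(x, y). x - y) ` (T \<times> T) \<union> (\<lambda>(x, y). x / y) ` (T \<times> T)"
    for T :: "complex set"
  define U where "U = (\<Union>n. (step ^^ n) (insert 1 S))"
  have c: "countable ((step ^^ n) (insert 1 S))" for n
    by (induction n) (use assms in \<open>auto simp: step_def intro!: countable_SIGMA\<close>)
  have mono: "(step ^^ n) T \<subseteq> (step ^^ (n + k)) T" for n k T
    by (induction k) (auto simp: step_def)
  have "field_gen S \<subseteq> U"
  proof (rule field_gen_least)
    show "S \<subseteq> U" unfolding U_def by (auto intro!: UN_I[of 0])
    show "is_subfield U"
      unfolding is_subfield_def
    proof (intro conjI ballI)
      show "1 \<in> U" unfolding U_def by (force intro: exI[of _ 0])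
      fix x y assume "x \<in> U" "y \<in> U"
      then obtain m n where "x \<in> (step ^^ m) (insert 1 S)" "y \<in> (step ^^ n) (insert 1 S)"
        by (auto simp: U_def)
      then have "x \<in> (step ^^ (m + n)) (insert 1 S)" "y \<in> (step ^^ (m + n)) (insert 1 S)"
        using mono[of m "insert 1 S" n] mono[of n "insert 1 S" m] by (auto simp: add.commute)
      then have "x - y \<in> (step ^^ Suc (m + n)) (insert 1 S)" "x / y \<in> (step ^^ Suc (m + n)) (insert 1 S)"
        by (force simp: step_def)+
      then show "x - y \<in> U" "x / y \<in> U" unfolding U_def by blast+
    qed
  qed
  moreover have "countable U" unfolding U_def using c by auto
  ultimately show ?thesis using countable_subset by blast
qed

lemma ex_transcendental_over:
  assumes "countable K"
  shows "\<exists>z. transcendental_over K z"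
proof (rule ccontr)
  assume no: "\<nexists>z. transcendental_over K z"
  have "polys_over K \<subseteq> Poly ` lists K"
  proof
    fix p assume "p \<in> polys_over K"
    then have "range (poly.coeff p) \<subseteq> K" by (auto simp: polys_over_def)
    then have "set (coeffs p) \<subseteq> K" by (simp add: range_coeff)
    then show "p \<in> Poly ` lists K" by (intro image_eqI[of _ _ "coeffs p"]) auto
  qed
  then have "countable (polys_over K)"
    using assms by (meson countable_image countable_lists countable_subset)
  then have "countable (\<Union>p \<in> polys_over K - {0}. {z. poly p z = 0})"
    by (intro countable_UN) (simp_all add: countable_Diff countable_finite poly_roots_finite)
  moreover have "(\<Union>p \<in> polys_over K - {0}. {z. poly p z = 0}) = UNIV"
    using no by (auto simp: transcendental_over_def)
  ultimately have "countable (UNIV :: complex set)" by simp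
  then have "countable (range complex_of_real)" by (rule countable_subset[rotated]) simp
  then have "countable (UNIV :: real set)"
    by (rule countable_image_inj_on) (simp add: inj_on_def)
  then show False using uncountable_UNIV_real by simp
qed

definition curve_gens :: "(nat \<Rightarrow> complex) \<Rightarrow> nat set \<Rightarrow> complex set" where
  "curve_gens a I = a ` I \<union> (\<lambda>i. csqrt (sextic_value (a i))) ` I"

text \<open>
Each \<open>a n\<close> only has to avoid the numbers algebraic over a countable field, of which there are countably many.
\<close>

lemma ex_generic_sequence:
  "\<exists>a. \<forall>n. transcendental_over (field_gen (curve_gens a {..<n})) (a n)"
proof (rule dependent_wellorder_choice)
  fix r :: complex and f g :: "nat \<Rightarrow> complex" and n :: nat
  assume "\<And>m. m < n \<Longrightarrow> f m = g m"
  then have "curve_gens f {..<n} = curve_gens g {..<n}" by (simp add: curve_gens_def)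
  then show "transcendental_over (field_gen (curve_gens f {..<n})) r = transcendental_over (field_gen (curve_gens g {..<n})) r"
    by simp
next
  fix n :: nat and f
  have "countable (curve_gens f {..<n})" by (auto simp: curve_gens_def)
  then show "\<exists>r. transcendental_over (field_gen (curve_gens f {..<n})) r"
    by (intro ex_transcendental_over countable_field_gen)
qed

lemma polys_over_mult:
  assumes K: "is_subfield K" and "p \<in> polys_over K" "q \<in> polys_over K"
  shows "p * q \<in> polys_over K"
  using assms by (auto simp: polys_over_def coeff_mult intro!: subf_sum subf_mult)

lemma polys_over_closed:
  assumes K: "is_subfield K"
  shows "0 \<in> polys_over K" "1 \<in> polys_over K"
    "p \<in> polys_over K \<Longrightarrow> q \<in> polys_over K \<Longrightarrow> p + q \<in> polys_over K"
    "p \<in> polys_over K \<Longrightarrow> q \<in> polys_over K \<Longrightarrow> p - q \<in> polys_over K"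
    "p \<in> polys_over K \<Longrightarrow> - p \<in> polys_over K"
    "k \<in> K \<Longrightarrow> p \<in> polys_over K \<Longrightarrow> smult k p \<in> polys_over K"
    "k \<in> K \<Longrightarrow> p \<in> polys_over K \<Longrightarrow> pCons k p \<in> polys_over K"
    "p \<in> polys_over K \<Longrightarrow> q \<in> polys_over K \<Longrightarrow> p * q \<in> polys_over K"
  using subf_0[OF K] subf_1[OF K] polys_over_mult[OF K]
  by (auto simp: polys_over_def coeff_pCons subf_add[OF K] subf_diff[OF K] subf_uminus[OF K] subf_mult[OF K] split: nat.split)

lemma sextic_in_polys_over: "is_subfield K \<Longrightarrow> sextic \<in> polys_over K"
  unfolding sextic_def by (intro polys_over_closed) (auto simp: subf_numeral subf_0)

text \<open>
The field \<open>K(x, y)\<close> obtained from \<open>K\<close> by adjoining a generic point of the curve.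
\<close>

locale generic_extension =
  fixes K :: "complex set" and x y :: complex
  assumes K: "is_subfield K" and x: "transcendental_over K x" and y: "y ^ 2 = sextic_value x"
begin

lemmas closed = polys_over_closed[OF K] sextic_in_polys_over[OF K]

lemma poly_x_0: "p \<in> polys_over K \<Longrightarrow> poly p x = 0 \<Longrightarrow> p = 0"
  using x by (auto simp: transcendental_over_def)

lemma indep_K:
  assumes "p \<in> polys_over K" "q \<in> polys_over K" "poly p x + poly q x * y = 0"
  shows "p = 0 \<and> q = 0"
proof -
  from assms(3) have "poly p x = - (poly q x * y)" by (simp add: add_eq_0_iff)
  then have "poly (p * p - q * q * sextic) x = 0"
    by (simp add: poly_sextic y[symmetric] power2_eq_square)
  moreover have "p * p - q * q * sextic \<in> polys_over K" using assms by (intro closed)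
  ultimately have "p * p - q * q * sextic = 0" by (rule poly_x_0[rotated])
  then have "p ^ 2 = q ^ 2 * sextic" by (simp add: power2_eq_square)
  with squarefree_if_bezout_pderiv[OF sextic_bezout] degree_sextic_pos(1)
  show ?thesis by (rule poly_square_factor)
qed

text \<open>
The relation between an element of \<open>K(x, y)\<close> and the rational function on the curve that represents it. It is an isomorphism onto its image
because \<open>x\<close> is transcendental over \<open>K\<close>, and it carries points of the curve to points over the function field, where
\<open>generic_point_rigid\<close> applies.
\<close>

definition formal :: "complex \<Rightarrow> complex fls \<Rightarrow> bool" where
  "formal u u' \<longleftrightarrow> (\<exists>p q d. p \<in> polys_over K \<and> q \<in> polys_over K \<and> d \<in> polys_over K \<and> d \<noteq> 0 \<and>
     u = (poly p x + poly q x * y) / poly d x \<and> u' = (fin.ev p + fin.ev q * generic_y) / fin.ev d)"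

lemma formalI:
  "p \<in> polys_over K \<Longrightarrow> q \<in> polys_over K \<Longrightarrow> d \<in> polys_over K \<Longrightarrow> d \<noteq> 0 \<Longrightarrow>
   u = (poly p x + poly q x * y) / poly d x \<Longrightarrow> u' = (fin.ev p + fin.ev q * generic_y) / fin.ev d \<Longrightarrow> formal u u'"
  unfolding formal_def by blast

lemma cross:
  assumes "p \<in> polys_over K" "q \<in> polys_over K" "d \<in> polys_over K" "d \<noteq> 0"
    "p' \<in> polys_over K" "q' \<in> polys_over K" "d' \<in> polys_over K" "d' \<noteq> 0"
  shows "(poly p x + poly q x * y) / poly d x = (poly p' x + poly q' x * y) / poly d' x
     \<longleftrightarrow> (fin.ev p + fin.ev q * generic_y) / fin.ev d = (fin.ev p' + fin.ev q' * generic_y) / fin.ev d'"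
proof -
  have nz: "poly d x \<noteq> 0" "poly d' x \<noteq> 0" "fin.ev d \<noteq> 0" "fin.ev d' \<noteq> 0"
    using assms poly_x_0 by (auto simp: fin.ev_eq_0_iff)
  let ?p = "p * d' - p' * d" and ?q = "q * d' - q' * d"
  have "(poly p x + poly q x * y) / poly d x = (poly p' x + poly q' x * y) / poly d' x
     \<longleftrightarrow> poly ?p x + poly ?q x * y = 0"
    using nz by (simp add: frac_eq_eq) (simp add: algebra_simps)
  also have "\<dots> \<longleftrightarrow> ?p = 0 \<and> ?q = 0"
  proof
    assume "poly ?p x + poly ?q x * y = 0"
    with _ _ show "?p = 0 \<and> ?q = 0"
      by (rule indep_K) (intro closed assms)+
  next
    assume "?p = 0 \<and> ?q = 0"
    then show "poly ?p x + poly ?q x * y = 0" by (simp only: poly_0) simp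
  qed
  also have "\<dots> \<longleftrightarrow> fin.ev ?p + fin.ev ?q * generic_y = 0"
    using fin.indep[of ?p ?q] by (auto simp only: fls.evc_0 mult_zero_left add_0)
  also have "\<dots> \<longleftrightarrow> (fin.ev p + fin.ev q * generic_y) / fin.ev d = (fin.ev p' + fin.ev q' * generic_y) / fin.ev d'"
    using nz by (simp add: frac_eq_eq fls.evc_simps) (simp add: algebra_simps)
  finally show ?thesis .
qed

lemma formal_iff: "formal u u' \<Longrightarrow> formal v v' \<Longrightarrow> u = v \<longleftrightarrow> u' = v'"
  unfolding formal_def using cross by (elim exE conjE) (simp only:)

lemma formal_in_L: "formal u u' \<Longrightarrow> u' \<in> fin.L"
  unfolding formal_def fin.L_def by blast

lemma formal_add: assumes "formal u u'" "formal v v'" shows "formal (u + v) (u' + v')"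
proof -
  from assms obtain p q d p' q' d' where mem: "p \<in> polys_over K" "q \<in> polys_over K" "d \<in> polys_over K" "d \<noteq> 0"
      "p' \<in> polys_over K" "q' \<in> polys_over K" "d' \<in> polys_over K" "d' \<noteq> 0"
    and u: "u = (poly p x + poly q x * y) / poly d x" "u' = (fin.ev p + fin.ev q * generic_y) / fin.ev d"
    and v: "v = (poly p' x + poly q' x * y) / poly d' x" "v' = (fin.ev p' + fin.ev q' * generic_y) / fin.ev d'"
    unfolding formal_def by blast
  have nz: "poly d x \<noteq> 0" "poly d' x \<noteq> 0" "fin.ev d \<noteq> 0" "fin.ev d' \<noteq> 0"
    using mem poly_x_0 by (auto simp: fin.ev_eq_0_iff)
  show ?thesis
  proof (rule formalI)
    show "u + v = (poly (p * d' + p' * d) x + poly (q * d' + q' * d) x * y) / poly (d * d') x"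
      unfolding u v using nz by (simp add: add_frac_eq) (simp add: algebra_simps)
    show "u' + v' = (fin.ev (p * d' + p' * d) + fin.ev (q * d' + q' * d) * generic_y) / fin.ev (d * d')"
      unfolding u v using nz by (simp add: add_frac_eq fls.evc_simps) (simp add: algebra_simps)
  qed (use mem in \<open>auto intro!: closed\<close>)
qed

lemma formal_mult: assumes "formal u u'" "formal v v'" shows "formal (u * v) (u' * v')"
proof -
  from assms obtain p q d p' q' d' where mem: "p \<in> polys_over K" "q \<in> polys_over K" "d \<in> polys_over K" "d \<noteq> 0"
      "p' \<in> polys_over K" "q' \<in> polys_over K" "d' \<in> polys_over K" "d' \<noteq> 0"
    and u: "u = (poly p x + poly q x * y) / poly d x" "u' = (fin.ev p + fin.ev q * generic_y) / fin.ev d"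
    and v: "v = (poly p' x + poly q' x * y) / poly d' x" "v' = (fin.ev p' + fin.ev q' * generic_y) / fin.ev d'"
    unfolding formal_def by blast
  show ?thesis
  proof (rule formalI)
    show "u * v = (poly (p * p' + q * q' * sextic) x + poly (p * q' + q * p') x * y) / poly (d * d') x"
      unfolding u v by (simp add: poly_sextic y[symmetric] power2_eq_square) (simp add: algebra_simps)
    show "u' * v' = (fin.ev (p * p' + q * q' * sextic) + fin.ev (p * q' + q * p') * generic_y) / fin.ev (d * d')"
      unfolding u v by (simp add: fls.evc_simps fin.y_sq[symmetric] power2_eq_square) (simp add: algebra_simps)
  qed (use mem in \<open>auto intro!: closed\<close>)
qed

lemma formal_const: "k \<in> K \<Longrightarrow> formal k (fls_const k)"
  by (rule formalI[of "[:k:]" 0 1]) (auto simp: closed fls.evc_const fls.evc_simps)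

lemma formal_x: "formal x fls_X"
  by (rule formalI[of "[:0, 1:]" 0 1]) (auto simp: closed subf_0[OF K] subf_1[OF K] fls.evc_X fls.evc_simps)

lemma formal_y: "formal y generic_y"
  by (rule formalI[of 0 1 1]) (auto simp: closed fls.evc_simps)

lemma formal_inverse: assumes "formal u u'" shows "\<exists>w. formal (inverse u) w"
proof (cases "u = 0")
  case True
  then show ?thesis using formal_const[OF subf_0[OF K]] by auto
next
  case False
  from assms obtain p q d where mem: "p \<in> polys_over K" "q \<in> polys_over K" "d \<in> polys_over K" "d \<noteq> 0"
    and u: "u = (poly p x + poly q x * y) / poly d x"
    unfolding formal_def by blast
  from False u have n1: "poly p x + poly q x * y \<noteq> 0" and "p \<noteq> 0 \<or> q \<noteq> 0" by auto
  then have n2: "poly p x - poly q x * y \<noteq> 0"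
    using indep_K[of p "- q"] mem closed by auto
  have nm: "poly (p * p - q * q * sextic) x = (poly p x + poly q x * y) * (poly p x - poly q x * y)"
    by (simp add: poly_sextic y[symmetric] power2_eq_square algebra_simps)
  have "formal (inverse u) ((fin.ev (d * p) + fin.ev (- (d * q)) * generic_y) / fin.ev (p * p - q * q * sextic))"
  proof (rule formalI)
    have "poly (d * p) x + poly (- (d * q)) x * y = poly d x * (poly p x - poly q x * y)" by (simp add: algebra_simps)
    then show "inverse u = (poly (d * p) x + poly (- (d * q)) x * y) / poly (p * p - q * q * sextic) x"
      unfolding nm u using n1 n2 by simp
    show "p * p - q * q * sextic \<noteq> 0" using nm n1 n2 by (metis mult_eq_0_iff poly_0)
  qed (use mem in \<open>auto intro!: closed\<close>)
  then show ?thesis by blast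
qed

lemma field_gen_formal:
  assumes "u \<in> field_gen (K \<union> {x, y})"
  shows "\<exists>u'. formal u u'"
proof -
  have "is_subfield {u. \<exists>u'. formal u u'}"
    unfolding is_subfield_def
  proof (intro conjI ballI)
    show "1 \<in> {u. \<exists>u'. formal u u'}" using formal_const[OF subf_1[OF K]] by auto
    fix u v assume "u \<in> {u. \<exists>u'. formal u u'}" "v \<in> {u. \<exists>u'. formal u u'}"
    then obtain u' v' w where f: "formal u u'" "formal v v'" "formal (inverse v) w" using formal_inverse by blast
    have "formal (- 1 * v) (fls_const (-1) * v')"
      by (rule formal_mult[OF formal_const f(2)]) (rule subf_uminus[OF K subf_1[OF K]])
    from formal_add[OF f(1) this] show "u - v \<in> {u. \<exists>u'. formal u u'}" by auto
    from formal_mult[OF f(1) f(3)] show "u / v \<in> {u. \<exists>u'. formal u u'}" by (auto simp: divide_inverse)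
  qed
  moreover have "K \<union> {x, y} \<subseteq> {u. \<exists>u'. formal u u'}"
    using formal_const formal_x formal_y by blast
  ultimately show ?thesis using field_gen_least assms by blast
qed

lemma ratio_in_K:
  assumes "p \<in> polys_over K" "d \<in> polys_over K" "d \<noteq> 0" "p = smult k d"
  shows "k \<in> K"
proof -
  from assms(3) obtain i where "poly.coeff d i \<noteq> 0" by (meson leading_coeff_0_iff)
  with assms(4) have "k = poly.coeff p i / poly.coeff d i" by simp
  moreover have "poly.coeff p i / poly.coeff d i \<in> K"
    using assms by (intro subf_divide[OF K]) (simp_all add: polys_over_def)
  ultimately show ?thesis by (simp only:)
qed

text \<open>
A constant function represents an element of \<open>K\<close>, since the constant is a ratio of coefficients from \<open>K\<close>.
\<close>

lemma formal_constD: assumes "formal u (fls_const k)" shows "u \<in> K"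
proof -
  from assms obtain p q d where mem: "p \<in> polys_over K" "q \<in> polys_over K" "d \<in> polys_over K" "d \<noteq> 0"
    and u: "u = (poly p x + poly q x * y) / poly d x" "fls_const k = (fin.ev p + fin.ev q * generic_y) / fin.ev d"
    unfolding formal_def by blast
  have "fin.ev d \<noteq> 0" using mem by (simp add: fin.ev_eq_0_iff)
  then have "fin.ev p + fin.ev q * generic_y = fin.ev (smult k d)"
    using u by (simp add: fls.evc_smult)
  then have "fin.ev p + fin.ev q * generic_y = fin.ev (smult k d) + fin.ev 0 * generic_y" by (simp add: fls.evc_0)
  from fin.indep_eq[OF this] have pq: "p = smult k d" "q = 0" by auto
  have "poly d x \<noteq> 0" using mem poly_x_0 by auto
  then have "u = k" unfolding u pq by simp
  with ratio_in_K mem pq show ?thesis by blast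
qed

lemma curve_point:
  assumes "u \<in> field_gen (K \<union> {x, y})" "v \<in> field_gen (K \<union> {x, y})" "v ^ 2 = sextic_value u"
  shows "u = x \<or> u \<in> K"
proof -
  from assms obtain u' v' where f: "formal u u'" "formal v v'" using field_gen_formal by blast
  have p: "formal (u ^ n) (u' ^ n)" for n
    by (induction n) (use formal_const[OF subf_1[OF K]] formal_mult f in auto)
  have two: "formal 2 2" using formal_const[OF subf_numeral[OF K]] by simp
  have "formal (sextic_value u) (2 * u' ^ 6 + 2 * u' + 2)"
    unfolding sextic_value_def by (intro formal_add formal_mult two p f)
  moreover have "formal (v ^ 2) (v' ^ 2)" unfolding power2_eq_square by (intro formal_mult f)
  ultimately have "v' ^ 2 = 2 * u' ^ 6 + 2 * u' + 2" using formal_iff assms(3) by blast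
  with formal_in_L f have "(\<exists>k. u' = fls_const k) \<or> u' = fls_X" by (intro generic_point_rigid) auto
  then show ?thesis
    using f formal_constD formal_iff[OF f(1) formal_x] by blast
qed

text \<open>
\<open>K\<close> is closed under square roots in \<open>K(x, y)\<close>: a function whose square is constant has derivative 0.
\<close>

lemma square_root_in_K:
  assumes "v \<in> field_gen (K \<union> {x, y})" "v ^ 2 \<in> K"
  shows "v \<in> K"
proof -
  from assms obtain v' where f: "formal v v'" using field_gen_formal by blast
  have "formal (v ^ 2) (v' ^ 2)" unfolding power2_eq_square by (intro formal_mult f)
  with formal_const[OF assms(2)] have "v' ^ 2 = fls_const (v ^ 2)" using formal_iff by blast
  then have "fls_deriv (v' * v') = 0" by (simp add: power2_eq_square)
  then have "2 * (v' * fls_deriv v') = 0" by (simp add: algebra_simps)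
  then have "v' = 0 \<or> fls_deriv v' = 0" using fls.two_neq_0 by (metis mult_eq_0_iff)
  then have "\<exists>k. v' = fls_const k" using fls_deriv_eq_0_iff fls_const_0 by metis
  with f formal_constD show ?thesis by blast
qed

text \<open>
An element of \<open>K' \<inter> K(x, y)\<close> satisfies a linear relation between \<open>1\<close> and \<open>y\<close> over \<open>K'[x]\<close>; such a relation is trivial, so
the element is again a ratio of coefficients from \<open>K\<close>.
\<close>

lemma not_linear_in_larger:
  assumes K': "generic_extension K' x y" "K \<subseteq> K'" and k: "k \<in> K'" "k \<in> field_gen (K \<union> {x, y})"
  shows "k \<in> K"
proof -
  from field_gen_formal[OF k(2)] obtain p q d where mem: "p \<in> polys_over K" "q \<in> polys_over K" "d \<in> polys_over K" "d \<noteq> 0"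
    and u: "k = (poly p x + poly q x * y) / poly d x"
    unfolding formal_def by blast
  interpret K': generic_extension K' x y by fact
  have "poly d x \<noteq> 0" using mem poly_x_0 by auto
  with u have "k * poly d x = poly p x + poly q x * y" by simp
  then have z: "poly (smult k d - p) x + poly (- q) x * y = 0" by simp
  have "polys_over K \<subseteq> polys_over K'"
    using K'(2) by (auto simp: polys_over_def)
  then have mem': "p \<in> polys_over K'" "q \<in> polys_over K'" "d \<in> polys_over K'"
    using mem by blast+
  have "smult k d - p = 0 \<and> - q = 0"
    by (rule K'.indep_K[OF K'.closed(4)[OF K'.closed(6)[OF k(1) mem'(3)] mem'(1)] K'.closed(5)[OF mem'(2)] z])
  then have "p = smult k d" by simp
  with mem show ?thesis by (intro ratio_in_K)
qed

end

section \<open>A tower of generic points\<close>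

text \<open>
This parity makes \<open>2 (r^6 + r + 1)\<close> have odd 2-adic valuation for every rational number \<open>r\<close>.
\<close>

lemma odd_sextic_form:
  fixes a b :: int
  assumes "coprime a b"
  shows "odd (a ^ 6 + a * b ^ 5 + b ^ 6)"
  using assms by (auto simp: even_add even_mult_iff even_power)

lemma no_rational_point:
  assumes "u \<in> \<rat>" "v \<in> \<rat>" "v ^ 2 = sextic_value u"
  shows False
proof -
  from assms(1,2) obtain r s where rs: "u = of_rat r" "v = of_rat s" by (auto elim!: Rats_cases)
  obtain a b where ab: "quotient_of r = (a, b)" by (cases "quotient_of r")
  obtain c d where cd: "quotient_of s = (c, d)" by (cases "quotient_of s")
  have co: "coprime a b" and b: "b > 0" and d: "d > 0"
    using quotient_of_coprime[OF ab] quotient_of_denom_pos[OF ab] quotient_of_denom_pos[OF cd] by auto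
  have u: "u = of_int a / of_int b" and v: "v = of_int c / of_int d"
    using quotient_of_div[OF ab] quotient_of_div[OF cd] rs by (simp_all add: of_rat_divide)
  let ?m = "a ^ 6 + a * b ^ 5 + b ^ 6"
  have bd: "of_int b \<noteq> (0 :: complex)" "of_int d \<noteq> (0 :: complex)" using b d by auto
  have e0: "(of_int c / of_int d) ^ 2 * (of_int d ^ 2 * of_int b ^ 6)
      = (2 * (of_int a / of_int b) ^ 6 + 2 * (of_int a / of_int b) + 2) * (of_int d ^ 2 * of_int b ^ 6 :: complex)"
    using assms(3) unfolding sextic_value_def u v by simp
  have e1: "(C / D) ^ 2 * (D ^ 2 * B ^ 6) = C ^ 2 * B ^ 6" if "D \<noteq> 0" for B C D :: complex
    using that by (simp add: power_divide)
  have e2: "(2 * (A / B) ^ 6 + 2 * (A / B) + 2) * (D * B ^ 6) = (2 * A ^ 6 + 2 * A * B ^ 5 + 2 * B ^ 6) * D"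
    if "B \<noteq> 0" for A B D :: complex
  proof -
    have "(A / B) ^ 6 * B ^ 6 = A ^ 6" "(A / B) * B ^ 6 = A * B ^ 5"
      using that by (simp_all add: power_divide power_eq_if)
    moreover have "(2 * (A / B) ^ 6 + 2 * (A / B) + 2) * (D * B ^ 6)
        = (2 * ((A / B) ^ 6 * B ^ 6) + 2 * ((A / B) * B ^ 6) + 2 * B ^ 6) * D"
      by (simp only: distrib_left distrib_right mult_ac)
    ultimately show ?thesis by (simp only: mult.assoc)
  qed
  have "of_int c ^ 2 * of_int b ^ 6 = (2 * of_int a ^ 6 + 2 * of_int a * of_int b ^ 5 + 2 * of_int b ^ 6) * (of_int d ^ 2 :: complex)"
    using e0 unfolding e1[OF bd(2)] e2[OF bd(1)] .
  then have "of_int (c ^ 2 * b ^ 6) = (of_int (2 * ?m * d ^ 2) :: complex)"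
    by (simp add: algebra_simps)
  \<comment> \<open>The multiplicity of 2 is even on the left and odd on the right.\<close>
  then have "c ^ 2 * b ^ 6 = 2 * ?m * d ^ 2" by (simp only: of_int_eq_iff)
  then have e: "(c * b ^ 3) ^ 2 = 2 * (?m * d ^ 2)" by (simp add: power_mult_distrib flip: power_mult)
  have m: "odd ?m" using co by (rule odd_sextic_form)
  then have m0: "?m \<noteq> 0" by fastforce
  have "(c * b ^ 3) ^ 2 \<noteq> 0" unfolding e using m0 d by simp
  then have "c * b ^ 3 \<noteq> 0" by (simp only: power_eq_0_iff) simp
  then have "multiplicity 2 ((c * b ^ 3) ^ 2) = 2 * multiplicity 2 (c * b ^ 3)"
    by (simp add: prime_elem_multiplicity_power_distrib)
  moreover have "multiplicity 2 (2 * (?m * d ^ 2)) = Suc (multiplicity 2 ?m + 2 * multiplicity 2 d)"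
  proof -
    have "multiplicity 2 (2 * (?m * d ^ 2)) = multiplicity 2 (2::int) + (multiplicity 2 ?m + multiplicity 2 (d ^ 2))"
      using m0 d by (subst prime_elem_multiplicity_mult_distrib; simp)+
    then show ?thesis using d by (simp add: prime_elem_multiplicity_power_distrib)
  qed
  moreover have "multiplicity 2 ?m = 0" using m by (intro not_dvd_imp_multiplicity_0)
  ultimately show False unfolding e by presburger
qed

lemma field_gen_empty: "field_gen {} \<subseteq> \<rat>"
  by (rule field_gen_least) (auto simp: is_subfield_def)

text \<open>
A sequence of points of the curve, each generic over the field generated by the earlier ones. Subfamilies, given by a
set of indices, are needed both to index the points by primes and to leave out one point.
\<close>

locale generic_tower =
  fixes a :: "nat \<Rightarrow> complex"
  assumes a: "transcendental_over (field_gen (curve_gens a {..<n})) (a n)"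
begin

definition y :: "nat \<Rightarrow> complex" where "y n = csqrt (sextic_value (a n))"

lemma y_sq: "y n ^ 2 = sextic_value (a n)"
  by (simp add: y_def)

abbreviation F :: "nat set \<Rightarrow> complex set" where "F I \<equiv> field_gen (curve_gens a I)"

lemma curve_gens_alt: "curve_gens a I = a ` I \<union> y ` I"
  by (auto simp: curve_gens_def y_def)

lemma F_mono: "I \<subseteq> J \<Longrightarrow> F I \<subseteq> F J"
  by (rule field_gen_mono) (auto simp: curve_gens_def)

lemma a_in_F: "i \<in> I \<Longrightarrow> a i \<in> F I" and y_in_F: "i \<in> I \<Longrightarrow> y i \<in> F I"
  by (auto simp: curve_gens_alt intro: field_gen.gen)

lemma subfield_F: "is_subfield (F I)"
  by (rule is_subfield_field_gen)

lemma transcendental_over_F: "J \<subseteq> {..<n} \<Longrightarrow> transcendental_over (F J) (a n)"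
  using a[of n] F_mono[of J "{..<n}"] by (auto simp: transcendental_over_def polys_over_def)

lemma extension: "J \<subseteq> {..<n} \<Longrightarrow> generic_extension (F J) (a n) (y n)"
  by unfold_locales (simp_all add: subfield_F transcendental_over_F y_sq)

abbreviation below :: "nat set \<Rightarrow> nat \<Rightarrow> nat set" where "below I n \<equiv> I \<inter> {..<n}"

lemma F_below_mono: "m \<le> n \<Longrightarrow> F (below I m) \<subseteq> F (below I n)"
  by (rule F_mono) auto

lemma below_Suc: "below I (Suc n) = (if n \<in> I then insert n (below I n) else below I n)"
  by (auto simp: less_Suc_eq)

lemma F_insert: "F (insert n J) \<subseteq> field_gen (F J \<union> {a n, y n})"
  by (rule field_gen_least[OF is_subfield_field_gen]) (auto simp: curve_gens_alt intro!: field_gen.gen)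

lemma F_finite_stage:
  assumes "z \<in> F I"
  shows "\<exists>n. z \<in> F (below I n)"
proof -
  have "is_subfield (\<Union>n. F (below I n))"
    unfolding is_subfield_def
  proof (intro conjI ballI)
    show "1 \<in> (\<Union>n. F (below I n))" by (auto intro: field_gen.one)
    fix u v assume "u \<in> (\<Union>n. F (below I n))" "v \<in> (\<Union>n. F (below I n))"
    then obtain m n where "u \<in> F (below I m)" "v \<in> F (below I n)" by auto
    then have "u \<in> F (below I (max m n))" "v \<in> F (below I (max m n))"
      using F_below_mono[of m "max m n" I] F_below_mono[of n "max m n" I] by auto
    then show "u - v \<in> (\<Union>n. F (below I n))" "u / v \<in> (\<Union>n. F (below I n))"
      by (blast intro: field_gen.intros)+
  qed
  moreover have "curve_gens a I \<subseteq> (\<Union>n. F (below I n))"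
  proof -
    have "a i \<in> F (below I (Suc i)) \<and> y i \<in> F (below I (Suc i))" if "i \<in> I" for i
      using that by (auto intro: a_in_F y_in_F)
    then show ?thesis by (auto simp: curve_gens_alt)
  qed
  ultimately show ?thesis using field_gen_least assms by blast
qed

text \<open>
By induction along the tower: adding a generic point adds no further points (\<open>curve_point\<close>), and there are none over the rationals.
\<close>

lemma curve_points_F:
  assumes "u \<in> F I" "v \<in> F I" "v ^ 2 = sextic_value u"
  shows "u \<in> a ` I"
proof -
  from assms(1,2) obtain m n where "u \<in> F (below I m)" "v \<in> F (below I n)" using F_finite_stage by blast
  then have "u \<in> F (below I (max m n))" "v \<in> F (below I (max m n))"
    using F_below_mono[of m "max m n" I] F_below_mono[of n "max m n" I] by auto
  then show ?thesis
  proof (induction "max m n" arbitrary: m n rule: nat_less_induct)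
    case 1
    then show ?case
    proof (cases "max m n")
      case 0
      then have "u \<in> \<rat>" "v \<in> \<rat>" using 1 field_gen_empty by (auto simp: curve_gens_def)
      with no_rational_point assms(3) show ?thesis by blast
    next
      case (Suc k)
      have IH: "u \<in> F (below I k) \<Longrightarrow> v \<in> F (below I k) \<Longrightarrow> ?thesis"
        using 1(1) Suc by (metis lessI max.idem)
      show ?thesis
      proof (cases "k \<in> I")
        case False
        with 1 Suc IH show ?thesis by (simp add: below_Suc)
      next
        case True
        interpret generic_extension "F (below I k)" "a k" "y k" by (rule extension) auto
        have "u \<in> field_gen (F (below I k) \<union> {a k, y k})" "v \<in> field_gen (F (below I k) \<union> {a k, y k})"
          using 1(2,3) Suc True F_insert by (auto simp: below_Suc)
        from curve_point[OF this assms(3)] this show ?thesis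
        proof (elim disjE)
          assume "u \<in> F (below I k)"
          then have "v ^ 2 \<in> F (below I k)" unfolding assms(3) sextic_value_def
            by (intro subf_add[OF K] subf_mult[OF K] subf_power[OF K] subf_numeral[OF K])
          with \<open>v \<in> field_gen (F (below I k) \<union> {a k, y k})\<close> square_root_in_K have "v \<in> F (below I k)" by blast
          with IH \<open>u \<in> F (below I k)\<close> show ?thesis by blast
        qed (use True in auto)
      qed
    qed
  qed
qed

text \<open>
Below stage \<open>j\<close> this is genericity of \<open>a j\<close>. A later point \<open>a n\<close> is generic over a field containing \<open>a j\<close>, so that
adjoining it cannot produce \<open>a j\<close>.
\<close>

lemma a_not_in_F_without:
  assumes "j \<notin> I"
  shows "a j \<notin> F I"
proof -
  have "a j \<notin> F (below I n)" for n
  proof (induction n)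
    case (Suc n)
    consider "n < j" | "n > j" "n \<in> I" | "n \<notin> I" using assms by (cases n j rule: linorder_cases) auto
    then show ?case
    proof cases
      case 1
      then have "transcendental_over (F (below I (Suc n))) (a j)" by (intro transcendental_over_F) auto
      moreover have "poly [:- a j, 1:] (a j) = 0" by simp
      ultimately have "[:- a j, 1:] \<notin> polys_over (F (below I (Suc n)))"
        unfolding transcendental_over_def by (metis one_neq_zero pCons_eq_0_iff)
      then show ?thesis
        using polys_over_closed(1)[OF subfield_F] polys_over_closed(7)[OF subfield_F] subf_1[OF subfield_F] subf_uminus[OF subfield_F]
        by (metis )
    next
      case 2
      interpret generic_extension "F (below I n)" "a n" "y n" by (rule extension) auto
      show ?thesis
      proof
        assume "a j \<in> F (below I (Suc n))"
        then have "a j \<in> field_gen (F (below I n) \<union> {a n, y n})" using 2 F_insert by (auto simp: below_Suc)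
        moreover have "generic_extension (F {..<n}) (a n) (y n)" by (rule extension) auto
        moreover have "F (below I n) \<subseteq> F {..<n}" by (rule F_mono) auto
        moreover have "a j \<in> F {..<n}" using 2 by (intro a_in_F) auto
        ultimately have "a j \<in> F (below I n)" using not_linear_in_larger by blast
        with Suc show False by blast
      qed
    next
      case 3
      with Suc show ?thesis by (simp add: below_Suc)
    qed
  next
    case 0
    have "transcendental_over (F {}) (a j)" by (intro transcendental_over_F) auto
    moreover have "poly [:- a j, 1:] (a j) = 0" by simp
    ultimately have "[:- a j, 1:] \<notin> polys_over (F {})"
      unfolding transcendental_over_def by (metis one_neq_zero pCons_eq_0_iff)
    then show ?case
      using polys_over_closed(1)[OF subfield_F] polys_over_closed(7)[OF subfield_F] subf_1[OF subfield_F] subf_uminus[OF subfield_F]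
      by (metis Int_empty_right lessThan_0)
  qed
  then show ?thesis using F_finite_stage by blast
qed

text \<open>
The powers \<open>1, y, a, a y, a^2, \<dots>\<close> form a basis of the coordinate ring of the curve with one index \<open>j\<close>. Products over several
points are indexed by positive natural numbers, the multiplicity of the prime \<open>p\<close> in \<open>r\<close> being the index at the \<open>p\<close>-th point.
\<close>

definition power_basis :: "nat \<Rightarrow> nat \<Rightarrow> complex" where
  "power_basis p j = a p ^ (j div 2) * y p ^ (j mod 2)"

definition monomial :: "nat \<Rightarrow> complex" where
  "monomial r = (\<Prod>p\<in>prime_factors r. power_basis p (multiplicity p r))"

abbreviation P :: "nat set" where "P \<equiv> {p. Factorial_Ring.prime p}"

lemma power_basis_0: "power_basis p 0 = 1" by (simp add: power_basis_def)

lemma power_basis_independent: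
  assumes c: "\<And>j. c j \<in> F (below I n)" and fin: "finite J" and sum: "(\<Sum>j\<in>J. c j * power_basis n j) = 0" and j: "j \<in> J"
  shows "c j = 0"
proof -
  interpret generic_extension "F (below I n)" "a n" "y n" by (rule extension) auto
  define p q where "p = (\<Sum>j\<in>{j\<in>J. even j}. Polynomial.monom (c j) (j div 2))"
    and "q = (\<Sum>j\<in>{j\<in>J. odd j}. Polynomial.monom (c j) (j div 2))"
  have mem: "(\<Sum>j\<in>A. Polynomial.monom (c j) (j div 2)) \<in> polys_over (F (below I n))" for A
    by (auto simp: polys_over_def coeff_sum intro!: subf_sum[OF K] c) (auto simp: subf_0[OF K] c)
  have "J = {j\<in>J. even j} \<union> {j\<in>J. odd j}" by auto
  then have "(\<Sum>j\<in>J. c j * power_basis n j) = (\<Sum>j\<in>{j\<in>J. even j} \<union> {j\<in>J. odd j}. c j * power_basis n j)" by simp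
  also have "\<dots> = (\<Sum>j\<in>{j\<in>J. even j}. c j * power_basis n j) + (\<Sum>j\<in>{j\<in>J. odd j}. c j * power_basis n j)"
    using fin by (intro sum.union_disjoint) auto
  also have "\<dots> = poly p (a n) + poly q (a n) * y n"
  proof -
    have "(\<Sum>j\<in>{j\<in>J. even j}. c j * power_basis n j) = poly p (a n)"
      unfolding p_def poly_sum poly_monom
      by (rule sum.cong) (auto simp: power_basis_def even_iff_mod_2_eq_zero)
    moreover have "(\<Sum>j\<in>{j\<in>J. odd j}. c j * power_basis n j) = poly q (a n) * y n"
      unfolding q_def poly_sum poly_monom sum_distrib_right
      by (rule sum.cong) (auto simp: power_basis_def odd_iff_mod_2_eq_one)
    ultimately show ?thesis by simp
  qed
  finally have "poly p (a n) + poly q (a n) * y n = 0" using sum by simp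
  then have pq: "p = 0" "q = 0" using indep_K[of p q] mem unfolding p_def q_def by blast+
  have cf: "poly.coeff (\<Sum>j\<in>A. Polynomial.monom (c j) (j div 2)) (j div 2) = c j"
    if "finite A" "j \<in> A" "\<And>i. i \<in> A \<Longrightarrow> even i \<longleftrightarrow> even j" for A
  proof -
    have "poly.coeff (\<Sum>i\<in>A. Polynomial.monom (c i) (i div 2)) (j div 2) = (\<Sum>i\<in>A. if i = j then c j else 0)"
      unfolding coeff_sum
    proof (rule sum.cong)
      fix i assume "i \<in> A"
      with that have "even i \<longleftrightarrow> even j" by blast
      then have "i div 2 = j div 2 \<longleftrightarrow> i = j" by presburger
      then show "poly.coeff (Polynomial.monom (c i) (i div 2)) (j div 2) = (if i = j then c j else 0)" by auto
    qed simp
    with that show ?thesis by simp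
  qed
  show ?thesis
  proof (cases "even j")
    case True
    have "poly.coeff p (j div 2) = c j" unfolding p_def by (rule cf) (use fin j True in auto)
    with pq show ?thesis by simp
  next
    case False
    have "poly.coeff q (j div 2) = c j" unfolding q_def by (rule cf) (use fin j False in auto)
    with pq show ?thesis by simp
  qed
qed

lemma monomial_in_F: "prime_factors r \<subseteq> I \<Longrightarrow> monomial r \<in> F I"
  unfolding monomial_def power_basis_def
  by (intro subf_prod[OF subfield_F] subf_mult[OF subfield_F] subf_power[OF subfield_F] a_in_F y_in_F) auto

lemma monomial_split:
  assumes "Factorial_Ring.prime n" "r > 0"
  shows "monomial r = power_basis n (multiplicity n r) * monomial (r div n ^ multiplicity n r)"
proof -
  define k r' where "k = multiplicity n r" and "r' = r div n ^ k"
  have r: "r = n ^ k * r'" unfolding r'_def k_def by (simp add: multiplicity_dvd)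
  have r'0: "r' > 0" using assms r by (cases r') auto
  have "\<not> n dvd r'"
    using multiplicity_decompose[of r n] assms prime_gt_1_nat[OF assms(1)] unfolding r'_def k_def by simp
  have mp: "multiplicity p r = multiplicity p r'" if "Factorial_Ring.prime p" "p \<noteq> n" for p
    unfolding r using that assms r'0
    by (subst prime_elem_multiplicity_mult_distrib) (auto simp: multiplicity_distinct_prime_power)
  have "p = n" if "Factorial_Ring.prime p" "p dvd n ^ k" for p
    using that assms(1) by (meson prime_dvd_power primes_dvd_imp_eq)
  then have pf: "prime_factors r - {n} = prime_factors r'"
    unfolding r using \<open>\<not> n dvd r'\<close> assms r'0
    by (auto simp: prime_factors_dvd prime_dvd_mult_iff)
  have n1: "n dvd r" if "power_basis n (multiplicity n r) \<noteq> 1"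
    using that not_dvd_imp_multiplicity_0[of n r] power_basis_0[of n] by (cases "n dvd r") auto
  have "monomial r = (\<Prod>p\<in>insert n (prime_factors r - {n}). power_basis p (multiplicity p r))"
    unfolding monomial_def using assms
    by (intro prod.mono_neutral_left) (use assms in \<open>auto simp: prime_factors_dvd dest: n1\<close>)
  also have "\<dots> = power_basis n k * (\<Prod>p\<in>prime_factors r'. power_basis p (multiplicity p r))"
  proof -
    have "prime_factors r' - {n} = prime_factors r'"
      using \<open>\<not> n dvd r'\<close> by (auto simp: prime_factors_dvd)
    then show ?thesis by (subst prod.insert_remove) (simp_all add: k_def pf)
  qed
  also have "(\<Prod>p\<in>prime_factors r'. power_basis p (multiplicity p r)) = monomial r'"
    unfolding monomial_def
  proof (rule prod.cong)
    fix p assume "p \<in> prime_factors r'"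
    then have "Factorial_Ring.prime p" "p \<noteq> n" using \<open>\<not> n dvd r'\<close> by (auto simp: prime_factors_dvd)
    then show "power_basis p (multiplicity p r) = power_basis p (multiplicity p r')" using mp[of p] by simp
  qed simp
  finally show ?thesis by (simp add: k_def r'_def)
qed

text \<open>
Collecting the terms by the multiplicity of the largest prime writes the sum as a combination of the powers at the last point, with
coefficients in the field generated by the earlier points; these vanish because that point is generic.
\<close>

lemma monomials_independent_below:
  assumes "finite T" "\<And>r. r \<in> T \<Longrightarrow> r > 0 \<and> prime_factors r \<subseteq> {..<n}" "\<And>r. c r \<in> F {}"
    and "(\<Sum>r\<in>T. c r * monomial r) = 0" "r \<in> T"
  shows "c r = 0"
  using assms
proof (induction n arbitrary: T c r)
  case 0
  have "r = 1" if "r \<in> T" for r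
    using 0(2)[OF that] by (auto simp: prime_factorization_empty_iff)
  then have "T = {1}" using 0 by auto
  with 0 show ?case by (simp add: monomial_def)
next
  case (Suc n)
  show ?case
  proof (cases "Factorial_Ring.prime n")
    case False
    then have "prime_factors s \<subseteq> {..<n}" if "s \<in> T" for s
      using Suc.prems(2)[OF that] by (auto simp: less_Suc_eq subset_iff in_prime_factors_iff)
    with Suc.IH[OF Suc.prems(1) _ Suc.prems(3,4,5)] Suc.prems(2) show ?thesis by blast
  next
    case True
    let ?m = "multiplicity n"
    define T' where "T' j = {s\<in>T. ?m s = j}" for j
    define g where "g s = s div n ^ ?m s" for s
    define S where "S j = (\<Sum>s\<in>T' j. c s * monomial (g s))" for j
    have g: "g s > 0" "prime_factors (g s) \<subseteq> {..<n}" "s = n ^ ?m s * g s" if "s \<in> T" for s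
    proof -
      have s: "s > 0" "prime_factors s \<subseteq> {..<Suc n}" using Suc.prems(2)[OF that] by auto
      show eq: "s = n ^ ?m s * g s" unfolding g_def by (simp add: multiplicity_dvd)
      then show "g s > 0" using s by (cases "g s") auto
      have "\<not> n dvd g s"
        using multiplicity_decompose[of s n] True s prime_gt_1_nat[OF True] unfolding g_def by simp
      moreover have "prime_factors (g s) \<subseteq> prime_factors s"
      proof (rule dvd_prime_factors)
        show "g s dvd s" using eq by (metis dvd_triv_right)
      qed (use s in simp)
      ultimately show "prime_factors (g s) \<subseteq> {..<n}" using s(2)
        by (auto simp: less_Suc_eq subset_iff in_prime_factors_iff)
    qed
    have "(\<Sum>s\<in>T. c s * monomial s) = (\<Sum>j\<in>?m ` T. \<Sum>s\<in>T' j. c s * monomial s)"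
      unfolding T'_def using Suc.prems(1) by (rule sum.image_gen)
    also have "\<dots> = (\<Sum>j\<in>?m ` T. S j * power_basis n j)"
    proof (rule sum.cong)
      fix j
      show "(\<Sum>s\<in>T' j. c s * monomial s) = S j * power_basis n j"
        unfolding S_def sum_distrib_right
      proof (rule sum.cong)
        fix s assume "s \<in> T' j"
        then have "s \<in> T" "?m s = j" by (auto simp: T'_def)
        with monomial_split[OF True, of s] Suc.prems(2) show "c s * monomial s = c s * monomial (g s) * power_basis n j"
          by (simp add: g_def)
      qed simp
    qed simp
    finally have "(\<Sum>j\<in>?m ` T. S j * power_basis n j) = 0" using Suc.prems by simp
    moreover have "S j \<in> F (below UNIV n)" for j
      unfolding S_def
    proof (intro subf_sum[OF subfield_F] subf_mult[OF subfield_F])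
      fix s assume "s \<in> T' j"
      then show "monomial (g s) \<in> F (below UNIV n)" using g by (intro monomial_in_F) (auto simp: T'_def)
      show "c s \<in> F (below UNIV n)" using Suc.prems(3)[of s] F_mono[of "{}" "below UNIV n"] by auto
    qed
    ultimately have S0: "S (?m r) = 0"
      using Suc.prems(1,5) by (intro power_basis_independent[of S UNIV n "?m ` T"]) auto
    have inj: "inj_on g (T' j)" for j
    proof (rule inj_onI)
      fix s t assume "s \<in> T' j" "t \<in> T' j" "g s = g t"
      with g(3)[of s] g(3)[of t] show "s = t" by (simp add: T'_def)
    qed
    define j where "j = ?m r"
    define c' where "c' t = (if t \<in> g ` T' j then c (the_inv_into (T' j) g t) else 0)" for t
    have c': "c' (g s) = c s" if "s \<in> T' j" for s
      using that inj by (simp add: c'_def the_inv_into_f_f)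
    have "(\<Sum>t\<in>g ` T' j. c' t * monomial t) = S j"
      unfolding S_def using c' by (subst sum.reindex[OF inj]) (auto intro!: sum.cong)
    with S0 have "(\<Sum>t\<in>g ` T' j. c' t * monomial t) = 0" by (simp add: j_def)
    moreover have "r \<in> T' j" using Suc.prems(5) by (simp add: T'_def j_def)
    ultimately have "c' (g r) = 0"
      using Suc.prems(1,3) g by (intro Suc.IH[of "g ` T' j" c']) (auto simp: T'_def c'_def subf_0[OF subfield_F])
    with c' \<open>r \<in> T' j\<close> show ?thesis by simp
  qed
qed

lemma monomials_independent:
  assumes "finite T" "0 \<notin> T" "\<And>r. c r \<in> F {}" "(\<Sum>r\<in>T. c r * monomial r) = 0" "r \<in> T"
  shows "c r = 0"
proof (rule monomials_independent_below[OF assms(1) _ assms(3,4,5)])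
  fix s assume s: "s \<in> T"
  then have "s > 0" "s \<le> Max T" using assms(1,2) by (auto intro: Max_ge gr0I)
  then have "prime_factors s \<subseteq> {..<Suc (Max T)}"
    by (auto simp: less_Suc_eq_le prime_factors_dvd dest!: dvd_imp_le)
  with s assms(2) show "s > 0 \<and> prime_factors s \<subseteq> {..<Suc (Max T)}" by (metis gr0I)
qed

end

section \<open>Fraction fields with a computable integral basis\<close>

text \<open>
Every natural number codes a sequence with finite support by iterated unpairing: the head is the first component and the tail is the
second one. The number 0 codes the zero sequence.
\<close>

definition nth_code :: "nat \<Rightarrow> nat \<Rightarrow> nat" where
  "nth_code P i = pfst (rec_nat P (\<lambda>_ r. psnd r) i)"

lemma rec_psnd_shift: "rec_nat (psnd P) (\<lambda>_ r. psnd r) i = rec_nat P (\<lambda>_ r. psnd r) (Suc i)"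
  by (induction i) simp_all

lemma nth_code_0: "nth_code P 0 = pfst P" and nth_code_Suc: "nth_code P (Suc i) = nth_code (psnd P) i"
  by (simp add: nth_code_def) (simp add: nth_code_def rec_psnd_shift del: nat.rec(2))

lemma nth_code_zero: "nth_code 0 i = 0"
proof -
  have 0: "prod_decode 0 = (0, 0)" by (simp add: prod_decode_def prod_decode_aux.simps)
  then show ?thesis by (induction i) (simp_all add: nth_code_0 nth_code_Suc)
qed

text \<open>
The tail of \<open>P\<close> is a smaller number, except for \<open>P = 0\<close> and \<open>P = 1\<close>, which are their own tails and have head 0.
\<close>

lemma nth_code_eq_0: "P \<le> i \<Longrightarrow> nth_code P i = 0"
proof (induction i arbitrary: P)
  case 0
  then show ?case by (simp add: nth_code_zero)
next
  case (Suc i)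
  obtain a b where ab: "prod_decode P = (a, b)" by (cases "prod_decode P")
  then have P: "P = triangle (a + b) + a"
    using prod_decode_inverse[of P] by (simp add: prod_encode_def)
  have tri: "n \<le> triangle n" for n by (induction n) auto
  have tri2: "n < triangle n" if "n \<ge> 2" for n
    using that by (induction rule: dec_induct) (simp_all add: numeral_2_eq_2)
  show ?case
  proof (cases "b < P")
    case True
    then have "b \<le> i" using Suc.prems by simp
    with Suc.IH[of b] ab show ?thesis by (simp add: nth_code_Suc)
  next
    case False
    then have "\<not> (a + b \<ge> 2)" "a = 0" using tri2[of "a + b"] tri[of "a + b"] P by linarith+
    then have "b = 0 \<or> b = 1" by linarith
    then have "P = b" using P \<open>a = 0\<close> by auto
    then have "prod_decode P = (0, P)" using ab \<open>a = 0\<close> by simp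
    then have "nth_code P j = 0" for j by (induction j) (simp_all add: nth_code_0 nth_code_Suc)
    then show ?thesis .
  qed
qed

definition tabulate :: "(nat \<Rightarrow> nat) \<Rightarrow> nat \<Rightarrow> nat" where
  "tabulate g M = rec_nat 0 (\<lambda>k r. pair (g (M - 1 - k)) r) M"

lemma nth_code_tabulate: "nth_code (tabulate g M) i = (if i < M then g i else 0)"
proof -
  have "nth_code (rec_nat 0 (\<lambda>k r. pair (g (M - 1 - k)) r) k) i = (if i < k then g (M - k + i) else 0)"
    if "k \<le> M" for k i
    using that
  proof (induction k arbitrary: i)
    case (Suc k)
    then show ?case by (cases i) (auto simp: nth_code_0 nth_code_Suc Suc_diff_Suc)
  qed (simp add: nth_code_zero)
  from this[of M i] show ?thesis by (simp add: tabulate_def)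
qed

lemma computable1_nth_code [comp_intros]:
  "computable1 f \<Longrightarrow> computable1 g \<Longrightarrow> computable1 (\<lambda>x. nth_code (f x) (g x))"
  unfolding nth_code_def by (intro comp_intros)

lemma computable1_tabulate [comp_intros]:
  assumes "computable1 (\<lambda>z. g (pfst z) (psnd z))" "computable1 M"
  shows "computable1 (\<lambda>x. tabulate (g x) (M x))"
proof -
  have "computable2 g" using assms(1) by (simp add: computable2_uncurry)
  then show ?thesis unfolding tabulate_def
    by (intro comp_intros assms computable1_app2[OF \<open>computable2 g\<close>] computable1_comp[OF assms(2)])
qed

definition same_coeffs :: "nat \<Rightarrow> nat \<Rightarrow> bool" where
  "same_coeffs P Q \<longleftrightarrow> (\<forall>i<P + Q. nth_code P i = nth_code Q i)"

definition add_code :: "nat \<Rightarrow> nat \<Rightarrow> nat" where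
  "add_code P Q = tabulate (\<lambda>i. nth_code P i + nth_code Q i) (P + Q)"

text \<open>
A ring that is free over the integers on \<open>\<beta> 0, \<beta> 1, \<dots>\<close>, with computable structure constants \<open>\<gamma>\<close> that vanish from \<open>bd\<close> on. The
structure constants are natural numbers, so that combinations with natural coefficients are closed under multiplication; elements of the ring are differences of these, and elements of its field of fractions are quotients of differences.
\<close>

locale computable_basis =
  fixes \<beta> :: "nat \<Rightarrow> complex" and \<gamma> :: "nat \<Rightarrow> nat \<Rightarrow> nat \<Rightarrow> nat" and bd :: "nat \<Rightarrow> nat \<Rightarrow> nat"
  assumes \<beta>_0: "\<beta> 0 = 1"
    and \<beta>_mult: "\<beta> i * \<beta> j = (\<Sum>k<bd i j. of_nat (\<gamma> i j k) * \<beta> k)"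
    and \<gamma>_bd: "bd i j \<le> k \<Longrightarrow> \<gamma> i j k = 0"
    and \<beta>_indep: "(\<Sum>i<N. of_int (c i) * \<beta> i) = 0 \<Longrightarrow> i < N \<Longrightarrow> c i = 0"
    and computable_\<gamma>: "computable1 (\<lambda>z. \<gamma> (pfst z) (pfst (psnd z)) (psnd (psnd z)))"
    and computable_bd: "computable2 bd"
begin

definition comb_value :: "nat \<Rightarrow> complex" where
  "comb_value P = (\<Sum>i<P. of_nat (nth_code P i) * \<beta> i)"

lemma comb_value_eq: "P \<le> N \<Longrightarrow> comb_value P = (\<Sum>i<N. of_nat (nth_code P i) * \<beta> i)"
  unfolding comb_value_def by (rule sum.mono_neutral_left) (auto simp: nth_code_eq_0)

lemma comb_value_tabulate: "comb_value (tabulate g M) = (\<Sum>i<M. of_nat (g i) * \<beta> i)"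
proof -
  have "comb_value (tabulate g M) = (\<Sum>i<max M (tabulate g M). of_nat (nth_code (tabulate g M) i) * \<beta> i)"
    by (rule comb_value_eq) simp
  also have "\<dots> = (\<Sum>i<M. of_nat (g i) * \<beta> i)"
    by (rule sum.mono_neutral_cong_right) (auto simp: nth_code_tabulate)
  finally show ?thesis .
qed

lemma comb_value_add_code: "comb_value (add_code P Q) = comb_value P + comb_value Q"
  unfolding add_code_def comb_value_tabulate
  using comb_value_eq[of P "P + Q"] comb_value_eq[of Q "P + Q"] by (simp add: algebra_simps sum.distrib)

definition mult_code :: "nat \<Rightarrow> nat \<Rightarrow> nat" where
  "mult_code P Q = tabulate (\<lambda>k. \<Sum>i<P. \<Sum>j<Q. nth_code P i * nth_code Q j * \<gamma> i j k) (\<Sum>i<P. \<Sum>j<Q. bd i j)"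

lemma comb_value_mult_code: "comb_value (mult_code P Q) = comb_value P * comb_value Q"
proof -
  define M where "M = (\<Sum>i<P. \<Sum>j<Q. bd i j)"
  have "bd i j \<le> M" if "i < P" "j < Q" for i j
  proof -
    have "bd i j \<le> (\<Sum>j<Q. bd i j)" using that by (intro member_le_sum) auto
    also have "\<dots> \<le> M" unfolding M_def using that by (intro member_le_sum) auto
    finally show ?thesis .
  qed
  then have \<beta>: "\<beta> i * \<beta> j = (\<Sum>k<M. of_nat (\<gamma> i j k) * \<beta> k)" if "i < P" "j < Q" for i j
    unfolding \<beta>_mult using that by (intro sum.mono_neutral_left) (auto simp: \<gamma>_bd)
  have "comb_value P * comb_value Q = (\<Sum>i<P. \<Sum>j<Q. of_nat (nth_code P i * nth_code Q j) * (\<beta> i * \<beta> j))"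
    unfolding comb_value_def sum_product by (intro sum.cong refl) simp
  also have "\<dots> = (\<Sum>i<P. \<Sum>j<Q. \<Sum>k<M. of_nat (nth_code P i * nth_code Q j * \<gamma> i j k) * \<beta> k)"
    by (intro sum.cong refl) (simp add: \<beta> sum_distrib_left mult.assoc)
  also have "\<dots> = (\<Sum>i<P. \<Sum>k<M. \<Sum>j<Q. of_nat (nth_code P i * nth_code Q j * \<gamma> i j k) * \<beta> k)"
    by (intro sum.cong refl sum.swap)
  also have "\<dots> = (\<Sum>k<M. \<Sum>i<P. \<Sum>j<Q. of_nat (nth_code P i * nth_code Q j * \<gamma> i j k) * \<beta> k)"
    by (rule sum.swap)
  also have "\<dots> = comb_value (mult_code P Q)"
    unfolding mult_code_def comb_value_tabulate M_def[symmetric] by (simp add: sum_distrib_right)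
  finally show ?thesis ..
qed

lemma comb_value_inject: "comb_value P = comb_value Q \<longleftrightarrow> same_coeffs P Q"
proof
  assume eq: "comb_value P = comb_value Q"
  have "(\<Sum>i<P + Q. of_int (int (nth_code P i) - int (nth_code Q i)) * \<beta> i) = comb_value P - comb_value Q"
    using comb_value_eq[of P "P + Q"] comb_value_eq[of Q "P + Q"] by (simp add: algebra_simps sum_subtractf)
  with eq have "(\<Sum>i<P + Q. of_int (int (nth_code P i) - int (nth_code Q i)) * \<beta> i) = 0" by simp
  from \<beta>_indep[OF this] show "same_coeffs P Q" unfolding same_coeffs_def by simp
next
  assume "same_coeffs P Q"
  then show "comb_value P = comb_value Q"
    using comb_value_eq[of P "P + Q"] comb_value_eq[of Q "P + Q"] by (simp add: same_coeffs_def)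
qed

lemma decidable_same_coeffs [comp_intros]:
  assumes "computable1 f" "computable1 g" shows "decidable (\<lambda>x. same_coeffs (f x) (g x))"
  unfolding same_coeffs_def
  by (intro comp_intros assms computable1_comp[OF assms(1)] computable1_comp[OF assms(2)])

lemma computable1_add_code [comp_intros]:
  assumes "computable1 f" "computable1 g" shows "computable1 (\<lambda>x. add_code (f x) (g x))"
  unfolding add_code_def
  by (intro comp_intros assms computable1_comp[OF assms(1)] computable1_comp[OF assms(2)])

lemma computable1_mult_code [comp_intros]:
  assumes "computable1 f" "computable1 g" shows "computable1 (\<lambda>x. mult_code (f x) (g x))"
proof -
  have \<gamma>: "computable1 (\<lambda>x. \<gamma> (i x) (j x) (k x))" if "computable1 i" "computable1 j" "computable1 k" for i j k
    using computable1_comp[OF computable_\<gamma>, of "\<lambda>x. pair (i x) (pair (j x) (k x))"] that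
    by (simp add: computable1_app2[OF computable2_prod_encode])
  show ?thesis unfolding mult_code_def
    by (intro comp_intros assms computable1_comp[OF assms(1)] computable1_comp[OF assms(2)] \<gamma> computable1_app2[OF computable_bd])
qed

text \<open>
A pair of codes stands for the difference of their values.
\<close>

definition diff_value :: "nat \<Rightarrow> complex" where
  "diff_value z = comb_value (pfst z) - comb_value (psnd z)"

definition diff_add :: "nat \<Rightarrow> nat \<Rightarrow> nat" where
  "diff_add z w = pair (add_code (pfst z) (pfst w)) (add_code (psnd z) (psnd w))"

definition diff_mult :: "nat \<Rightarrow> nat \<Rightarrow> nat" where
  "diff_mult z w = pair (add_code (mult_code (pfst z) (pfst w)) (mult_code (psnd z) (psnd w)))
     (add_code (mult_code (pfst z) (psnd w)) (mult_code (psnd z) (pfst w)))"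

lemma diff_value_ops:
  "diff_value (diff_add z w) = diff_value z + diff_value w"
  "diff_value (diff_mult z w) = diff_value z * diff_value w"
  "diff_value (pair (psnd z) (pfst z)) = - diff_value z"
  by (simp_all add: diff_value_def diff_add_def diff_mult_def comb_value_add_code comb_value_mult_code algebra_simps)

lemma diff_value_eq_0: "diff_value z = 0 \<longleftrightarrow> same_coeffs (pfst z) (psnd z)"
  by (simp add: diff_value_def comb_value_inject)

lemma computable1_diff_ops [comp_intros]:
  assumes "computable1 f" "computable1 g"
  shows "computable1 (\<lambda>x. diff_add (f x) (g x))" "computable1 (\<lambda>x. diff_mult (f x) (g x))"
  unfolding diff_add_def diff_mult_def by (intro comp_intros assms)+

lemma decidable_diff_value [comp_intros]:
  assumes "computable1 f" shows "decidable (\<lambda>x. diff_value (f x) = 0)"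
  unfolding diff_value_eq_0 by (intro comp_intros assms)

text \<open>
A pair of differences stands for their quotient, with value 0 if the denominator has value 0. Addition has to
treat such pairs separately because cross-multiplication would lose the other summand.
\<close>

definition frac_value :: "nat \<Rightarrow> complex" where
  "frac_value n = diff_value (pfst n) / diff_value (psnd n)"

definition frac_add :: "nat \<Rightarrow> nat \<Rightarrow> nat" where
  "frac_add m n = (if diff_value (psnd m) = 0 then n else if diff_value (psnd n) = 0 then m
     else pair (diff_add (diff_mult (pfst m) (psnd n)) (diff_mult (pfst n) (psnd m))) (diff_mult (psnd m) (psnd n)))"

definition frac_mult :: "nat \<Rightarrow> nat \<Rightarrow> nat" where
  "frac_mult m n = pair (diff_mult (pfst m) (pfst n)) (diff_mult (psnd m) (psnd n))"

definition frac_minus :: "nat \<Rightarrow> nat" where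
  "frac_minus n = pair (pair (psnd (pfst n)) (pfst (pfst n))) (psnd n)"

lemma frac_value_add: "frac_value (frac_add m n) = frac_value m + frac_value n"
  by (auto simp: frac_value_def frac_add_def diff_value_ops add_frac_eq)

lemma frac_value_mult: "frac_value (frac_mult m n) = frac_value m * frac_value n"
  by (simp add: frac_value_def frac_mult_def diff_value_ops)

lemma frac_value_minus: "frac_value (frac_minus n) = - frac_value n"
  by (simp add: frac_value_def frac_minus_def diff_value_ops)

lemma frac_value_inverse: "frac_value (pair (psnd n) (pfst n)) = 1 / frac_value n"
  by (simp add: frac_value_def)

lemma computable1_frac_ops [comp_intros]:
  assumes "computable1 f" "computable1 g"
  shows "computable1 (\<lambda>x. frac_add (f x) (g x))" "computable1 (\<lambda>x. frac_mult (f x) (g x))"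
  unfolding frac_add_def frac_mult_def by (intro comp_intros assms)+

lemma computable1_frac_minus [comp_intros]: "computable1 f \<Longrightarrow> computable1 (\<lambda>x. frac_minus (f x))"
  unfolding frac_minus_def by (intro comp_intros)

lemma decidable_frac_value_eq [comp_intros]:
  assumes "computable1 f" "computable1 g"
  shows "decidable (\<lambda>x. frac_value (f x) = frac_value (g x))"
proof -
  have "frac_value m = frac_value n \<longleftrightarrow> frac_value (frac_add m (frac_minus n)) = 0" for m n
    by (simp add: frac_value_add frac_value_minus)
  moreover have "frac_value m = 0 \<longleftrightarrow> diff_value (pfst m) = 0 \<or> diff_value (psnd m) = 0" for m
    by (simp add: frac_value_def)
  ultimately have "frac_value m = frac_value n \<longleftrightarrow> diff_value (pfst (frac_add m (frac_minus n))) = 0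
      \<or> diff_value (psnd (frac_add m (frac_minus n))) = 0" for m n by simp
  then show ?thesis by (simp only:) (intro comp_intros assms)
qed

text \<open>
The fractions form a subfield, so they exhaust the field generated by the basis.
\<close>

lemma range_frac_value: "range frac_value = field_gen (range \<beta>)"
proof
  have \<beta>: "\<beta> i \<in> field_gen (range \<beta>)" for i by (auto intro: field_gen.gen)
  have "comb_value P \<in> field_gen (range \<beta>)" for P
    unfolding comb_value_def
    by (intro subf_sum[OF is_subfield_field_gen] subf_mult[OF is_subfield_field_gen] subf_of_nat[OF is_subfield_field_gen] \<beta>)
  then show "range frac_value \<subseteq> field_gen (range \<beta>)"
    by (auto simp: frac_value_def diff_value_def intro!: field_gen.divide field_gen.diff)
  have "is_subfield (range frac_value)"
    unfolding is_subfield_def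
  proof (intro conjI ballI)
    have v: "comb_value (tabulate (\<lambda>_. 1) 1) = 1" "comb_value 0 = 0"
      unfolding comb_value_tabulate by (simp_all add: \<beta>_0 comb_value_def)
    then have "frac_value (pair (pair (tabulate (\<lambda>_. 1) 1) 0) (pair (tabulate (\<lambda>_. 1) 1) 0)) = 1"
      by (simp add: frac_value_def diff_value_def)
    then show "1 \<in> range frac_value" by (metis rangeI)
    fix u v assume "u \<in> range frac_value" "v \<in> range frac_value"
    then obtain m n where "u = frac_value m" "v = frac_value n" by auto
    then have "u - v = frac_value (frac_add m (frac_minus n))"
      "u / v = frac_value (frac_mult m (pair (psnd n) (pfst n)))"
      by (simp_all only: frac_value_add frac_value_minus frac_value_mult frac_value_inverse) simp_all
    then show "u - v \<in> range frac_value" "u / v \<in> range frac_value" by auto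
  qed
  moreover have "range \<beta> \<subseteq> range frac_value"
  proof safe
    fix i
    have "comb_value (tabulate (\<lambda>j. if j = i then 1 else 0) (Suc i)) = \<beta> i"
      unfolding comb_value_tabulate by simp
    moreover have "comb_value (tabulate (\<lambda>_. 1) 1) = 1" "comb_value 0 = 0"
      unfolding comb_value_tabulate by (simp_all add: \<beta>_0 comb_value_def)
    ultimately have "frac_value (pair (pair (tabulate (\<lambda>j. if j = i then 1 else 0) (Suc i)) 0) (pair (tabulate (\<lambda>_. 1) 1) 0)) = \<beta> i"
      by (simp add: frac_value_def diff_value_def)
    then show "\<beta> i \<in> range frac_value" by (metis rangeI)
  qed
  ultimately show "field_gen (range \<beta>) \<subseteq> range frac_value" by (rule field_gen_least)
qed

end

text \<open>
A numbering with decidable equality is made injective by keeping only the least code of every element and listing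
these codes in increasing order.
\<close>

lemma computable_numbering_bijective:
  fixes e :: "nat \<Rightarrow> 'a"
  assumes eq: "decidable (\<lambda>z. e (pfst z) = e (psnd z))" and inf: "infinite (range e)"
  shows "\<exists>r. computable1 r \<and> bij_betw (\<lambda>x. e (r x)) UNIV (range e)"
proof -
  define S where "S = {m. \<forall>j<m. e j \<noteq> e m}"
  have dS: "decidable (\<lambda>m. m \<in> S)"
  proof -
    have "decidable (\<lambda>z. e (psnd z) = e (pfst z))"
      using decidable_comp[OF eq, of "\<lambda>z. pair (psnd z) (pfst z)"] by (simp add: comp_intros)
    then have "decidable (\<lambda>m. \<forall>j<m. \<not> e j = e m)" by (intro comp_intros)
    then show ?thesis by (simp add: S_def)
  qed
  have rep: "\<exists>m\<in>S. e m = e n" for n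
  proof -
    define m where "m = (LEAST m. e m = e n)"
    have m: "e m = e n" unfolding m_def by (rule LeastI[of _ n]) simp
    have "e j \<noteq> e m" if "j < m" for j
      using not_less_Least[of j "\<lambda>m. e m = e n"] that m by (simp add: m_def)
    with m have "m \<in> S" by (simp add: S_def)
    with m show ?thesis by blast
  qed
  have infS: "infinite S"
  proof
    assume "finite S"
    moreover have "range e \<subseteq> e ` S" using rep by (metis (full_types) image_iff image_subsetI)
    ultimately show False using inf finite_subset by blast
  qed
  define r where "r = enumerate S"
  have r_rec: "r = (\<lambda>n. rec_nat (LEAST m. m \<in> S) (\<lambda>_ q. LEAST m. m \<in> S \<and> q < m) n)"
  proof
    fix n show "r n = rec_nat (LEAST m. m \<in> S) (\<lambda>_ q. LEAST m. m \<in> S \<and> q < m) n"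
      by (induction n) (simp_all add: r_def enumerate_0 enumerate_Suc''[OF infS])
  qed
  have "computable1 (\<lambda>n. rec_nat (LEAST m. m \<in> S) (\<lambda>_ q. LEAST m. m \<in> S \<and> q < m) n)"
  proof (rule computable1_rec[OF computable1_id computable1_const])
    have "computable1 (\<lambda>q. LEAST m. m \<in> S \<and> q < m)"
    proof (rule computable1_Least)
      show "decidable (\<lambda>z. psnd z \<in> S \<and> pfst z < psnd z)"
        by (intro comp_intros decidable_comp[OF dS])
      show "\<exists>m. m \<in> S \<and> q < m" for q using infS infinite_nat_iff_unbounded by blast
    qed
    then show "computable1 (\<lambda>z. LEAST m. m \<in> S \<and> pfst (psnd z) < m)"
      by (rule computable1_comp) (intro comp_intros)
  qed
  then have "computable1 r" unfolding r_rec .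
  moreover have "bij_betw (\<lambda>x. e (r x)) UNIV (range e)"
    unfolding bij_betw_def
  proof
    show "inj (\<lambda>x. e (r x))"
    proof (rule injI)
      fix x y assume *: "e (r x) = e (r y)"
      have "r x \<in> S" "r y \<in> S" by (simp_all add: r_def enumerate_in_set infS)
      with * have "r x = r y" unfolding S_def by (metis (mono_tags, lifting) linorder_neqE_nat mem_Collect_eq)
      then show "x = y" using enumerate_mono_iff[OF infS] by (metis linorder_neqE_nat r_def less_irrefl)
    qed
    show "range (\<lambda>x. e (r x)) = range e"
    proof safe
      fix n
      obtain m where "m \<in> S" "e m = e n" using rep by blast
      then show "e n \<in> range (\<lambda>x. e (r x))" using enumerate_Ex[OF infS] unfolding r_def by (metis rangeI)
    qed auto
  qed
  ultimately show ?thesis by blast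
qed

section \<open>The monomial basis\<close>

text \<open>
The structure constants for the powers at one point. If both indices are odd, then \<open>y^2 = 2 a^6 + 2 a + 2\<close> is substituted; as
\<open>a\<close> counts for 2, the three terms shift the index \<open>j + k - 2\<close> by \<open>12\<close>, \<open>2\<close> and \<open>0\<close>.
\<close>

definition power_coeff :: "nat \<Rightarrow> nat \<Rightarrow> nat \<Rightarrow> nat" where
  "power_coeff j k l = (if odd j \<and> odd k then if l = j + k + 10 \<or> l = j + k \<or> l + 2 = j + k then 2 else 0
     else if l = j + k then 1 else 0)"

definition monomial_coeff :: "nat \<Rightarrow> nat \<Rightarrow> nat \<Rightarrow> nat" where
  "monomial_coeff r s t = (\<Prod>p<r + s + t + 1. if Factorial_Ring.prime p
     then power_coeff (multiplicity p r) (multiplicity p s) (multiplicity p t) else 1)"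

text \<open>
The worst case is \<open>j = k = 1\<close> with \<open>l = 12\<close>, whence the factor 6.
\<close>

lemma power_coeff_nz_le: "power_coeff j k l \<noteq> 0 \<Longrightarrow> l \<le> 6 * (j + k)"
  unfolding power_coeff_def by (auto split: if_splits elim!: oddE)

lemma monomial_coeff_nz_dvd:
  assumes "monomial_coeff r s t \<noteq> 0" "r > 0" "s > 0" "t > 0"
  shows "t dvd (r * s) ^ 6"
proof (rule multiplicity_le_imp_dvd)
  fix p :: nat assume p: "Factorial_Ring.prime p"
  have rs: "multiplicity p ((r * s) ^ 6) = 6 * (multiplicity p r + multiplicity p s)"
    using assms p by (simp add: prime_elem_multiplicity_power_distrib prime_elem_multiplicity_mult_distrib)
  show "multiplicity p t \<le> multiplicity p ((r * s) ^ 6)"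
  proof (cases "p dvd t")
    case True
    then have "p < r + s + t + 1" using assms(4) by (auto dest: dvd_imp_le)
    moreover have "\<forall>p\<in>{..<r + s + t + 1}. (if Factorial_Ring.prime p
        then power_coeff (multiplicity p r) (multiplicity p s) (multiplicity p t) else 1) \<noteq> 0"
      using assms(1) unfolding monomial_coeff_def by (simp only: prod_zero_iff finite_lessThan simp_thms) (rule ballI, erule contrapos_nn, rule bexI)
    ultimately have "power_coeff (multiplicity p r) (multiplicity p s) (multiplicity p t) \<noteq> 0"
      using p by (metis lessThan_iff)
    then show ?thesis unfolding rs by (rule power_coeff_nz_le)
  qed (simp add: not_dvd_imp_multiplicity_0)
qed (use assms in simp)

lemma computable1_multiplicity:
  "computable1 (\<lambda>z. \<Sum>k<psnd z. if pfst z ^ Suc k dvd psnd z then 1 else 0)"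
  by (intro comp_intros)

lemma computable1_monomial_coeff:
  "computable1 (\<lambda>z. monomial_coeff (Suc (pfst z)) (Suc (pfst (psnd z))) (Suc (psnd (psnd z))))"
proof -
  define mu :: "nat \<Rightarrow> nat \<Rightarrow> nat" where "mu p r = (\<Sum>k<r. if p ^ Suc k dvd r then 1 else 0)" for p r
  have mu: "computable1 (\<lambda>x. mu (f x) (g x))" if "computable1 f" "computable1 g" for f g
    using computable1_app2[OF computable2_uncurry[THEN iffD2] that, of mu] computable1_multiplicity
    by (simp add: mu_def)
  have pc: "computable1 (\<lambda>x. power_coeff (f x) (g x) (h x))" if "computable1 f" "computable1 g" "computable1 h" for f g h
    unfolding power_coeff_def by (intro comp_intros that)
  have "monomial_coeff (Suc i) (Suc j) (Suc k) = (\<Prod>p<Suc i + Suc j + Suc k + 1. if Factorial_Ring.prime p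
     then power_coeff (mu p (Suc i)) (mu p (Suc j)) (mu p (Suc k)) else 1)" for i j k
    unfolding monomial_coeff_def mu_def
    by (intro prod.cong refl if_cong) (simp_all only: multiplicity_count zero_less_Suc)
  then show ?thesis
    by (simp only:) (intro comp_intros pc mu decidable_comp[OF decidable_prime])
qed

context generic_tower
begin

lemma power_basis_mult:
  assumes "6 * (j + k) \<le> N"
  shows "power_basis p j * power_basis p k = (\<Sum>l\<le>N. of_nat (power_coeff j k l) * power_basis p l)"
proof (cases "odd j \<and> odd k")
  case True
  then obtain j' k' where jk: "j = 2 * j' + 1" "k = 2 * k' + 1" by (auto elim!: oddE)
  have "(\<Sum>l\<le>N. of_nat (power_coeff j k l) * power_basis p l)
      = (\<Sum>l\<in>{j + k + 10, j + k, j + k - 2}. of_nat (power_coeff j k l) * power_basis p l)"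
    using True assms jk by (intro sum.mono_neutral_right) (auto simp: power_coeff_def)
  also have "\<dots> = 2 * power_basis p (j + k + 10) + 2 * power_basis p (j + k) + 2 * power_basis p (j + k - 2)"
    using jk by (simp add: power_coeff_def)
  also have "\<dots> = a p ^ (j' + k') * (2 * a p ^ 6 + 2 * a p + 2)"
  proof -
    have "(j + k + 10) div 2 = j' + k' + 6" "(j + k + 10) mod 2 = 0" "(j + k) div 2 = j' + k' + 1"
      "(j + k) mod 2 = 0" "(j + k - 2) div 2 = j' + k'" "(j + k - 2) mod 2 = 0" by (simp_all add: jk)
    then show ?thesis by (simp add: power_basis_def algebra_simps power_add)
  qed
  also have "\<dots> = a p ^ (j' + k') * (y p * y p)"
    using y_sq[of p] by (simp add: sextic_value_def power2_eq_square)
  also have "\<dots> = power_basis p j * power_basis p k"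
    by (simp add: power_basis_def jk power_add)
  finally show ?thesis ..
next
  case False
  have "(\<Sum>l\<le>N. of_nat (power_coeff j k l) * power_basis p l) = (\<Sum>l\<in>{j + k}. of_nat (power_coeff j k l) * power_basis p l)"
    using False assms by (intro sum.mono_neutral_right) (auto simp: power_coeff_def)
  also have "\<dots> = power_basis p (j + k)" using False by (auto simp: power_coeff_def)
  also have "\<dots> = power_basis p j * power_basis p k"
  proof -
    from False consider "even j" | "even k" by blast
    then have "(j + k) div 2 = j div 2 + k div 2 \<and> (j + k) mod 2 = j mod 2 + k mod 2"
      by cases (auto elim!: evenE)
    then show ?thesis by (simp add: power_basis_def power_add)
  qed
  finally show ?thesis ..
qed

lemma monomial_superset:
  assumes "finite A" "\<And>p. p \<in> A \<Longrightarrow> Factorial_Ring.prime p" "prime_factors r \<subseteq> A" "r > 0"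
  shows "monomial r = (\<Prod>p\<in>A. power_basis p (multiplicity p r))"
  unfolding monomial_def using assms
  by (intro prod.mono_neutral_left) (auto simp: prime_factors_multiplicity power_basis_0)

text \<open>
The product is taken separately at every prime. Expanding the product of sums yields one summand for every choice of
exponents, and these choices correspond to the divisors of \<open>(r s)^6\<close>.
\<close>

lemma monomial_mult:
  assumes r: "r > 0" and s: "s > 0"
  shows "monomial r * monomial s = (\<Sum>t\<in>{1..(r * s) ^ 6}. of_nat (monomial_coeff r s t) * monomial t)"
proof -
  define A where "A = prime_factors (r * s)"
  define B where "B p = {..6 * (multiplicity p r + multiplicity p s)}" for p
  define T where "T = {t. t dvd (r * s) ^ 6}"
  have A: "finite A" "\<And>p. p \<in> A \<Longrightarrow> Factorial_Ring.prime p" "prime_factors r \<subseteq> A" "prime_factors s \<subseteq> A"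
    using r s by (auto simp: A_def prime_factors_product)
  have T: "finite T" "\<And>t. t \<in> T \<Longrightarrow> t > 0" "T \<subseteq> {1..(r * s) ^ 6}"
  proof -
    show pos: "t > 0" if "t \<in> T" for t using that r s by (auto simp: T_def intro: gr0I)
    show "T \<subseteq> {1..(r * s) ^ 6}" using pos r s by (auto simp: T_def Suc_le_eq intro!: dvd_imp_le)
    then show "finite T" using finite_subset by blast
  qed
  have pfT: "prime_factors t \<subseteq> A" if "t \<in> T" for t
  proof
    fix p assume "p \<in> prime_factors t"
    then have p: "Factorial_Ring.prime p" "p dvd t" by auto
    with that have "p dvd (r * s) ^ 6" unfolding T_def using dvd_trans by blast
    with p(1) have "p dvd r * s" by (rule prime_dvd_power)
    with p(1) r s show "p \<in> A" by (simp add: A_def prime_factors_dvd)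
  qed
  have mT: "multiplicity p t \<le> 6 * (multiplicity p r + multiplicity p s)" if "t \<in> T" "Factorial_Ring.prime p" for p t
  proof -
    have "multiplicity p t \<le> multiplicity p ((r * s) ^ 6)"
      using that r s unfolding T_def by (intro dvd_imp_multiplicity_le) auto
    also have "\<dots> = 6 * (multiplicity p r + multiplicity p s)"
      using r s that by (simp add: prime_elem_multiplicity_power_distrib prime_elem_multiplicity_mult_distrib)
    finally show ?thesis .
  qed
  let ?c = "\<lambda>p l. of_nat (power_coeff (multiplicity p r) (multiplicity p s) l) * power_basis p l"
  have "monomial r * monomial s = (\<Prod>p\<in>A. power_basis p (multiplicity p r) * power_basis p (multiplicity p s))"
    using A r s by (simp add: monomial_superset[of A] prod.distrib)
  also have "\<dots> = (\<Prod>p\<in>A. \<Sum>l\<in>B p. ?c p l)"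
    unfolding B_def by (intro prod.cong refl power_basis_mult) simp
  also have "\<dots> = (\<Sum>g\<in>PiE A B. \<Prod>p\<in>A. ?c p (g p))"
    using A by (intro prod_sum_PiE) (auto simp: B_def)
  also have "\<dots> = (\<Sum>t\<in>T. of_nat (monomial_coeff r s t) * monomial t)"
  proof (rule sum.reindex_bij_witness[where i = "\<lambda>t. \<lambda>p\<in>A. multiplicity p t" and j = "\<lambda>g. \<Prod>p\<in>A. p ^ g p"])
    fix g assume g: "g \<in> PiE A B"
    let ?t = "\<Prod>p\<in>A. p ^ g p"
    have mult: "multiplicity p ?t = (if p \<in> A then g p else 0)" if "Factorial_Ring.prime p" for p
      using A that by (intro multiplicity_prod_prime_powers) auto
    have t0: "?t > 0" using A by (intro prod_pos) (auto intro: prime_gt_0_nat)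
    show "(\<lambda>p\<in>A. multiplicity p ?t) = g"
      using g A mult by (auto simp: fun_eq_iff restrict_def PiE_def extensional_def)
    show tT: "?t \<in> T" unfolding T_def
    proof (rule CollectI, rule multiplicity_le_imp_dvd)
      fix p :: nat assume p: "Factorial_Ring.prime p"
      have "multiplicity p ((r * s) ^ 6) = 6 * (multiplicity p r + multiplicity p s)"
        using r s p by (simp add: prime_elem_multiplicity_power_distrib prime_elem_multiplicity_mult_distrib)
      then show "multiplicity p ?t \<le> multiplicity p ((r * s) ^ 6)"
        using g mult[OF p] by (auto simp: B_def PiE_def Pi_def)
    qed (use t0 in simp)
    have "monomial_coeff r s ?t = (\<Prod>p\<in>A. power_coeff (multiplicity p r) (multiplicity p s) (g p))"
    proof -
      have "monomial_coeff r s ?t = (\<Prod>p\<in>A. if Factorial_Ring.prime p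
         then power_coeff (multiplicity p r) (multiplicity p s) (multiplicity p ?t) else 1)"
        unfolding monomial_coeff_def
      proof (rule prod.mono_neutral_right)
        show "A \<subseteq> {..<r + s + ?t + 1}"
        proof
          fix p assume "p \<in> A"
          then have "p dvd r \<or> p dvd s" unfolding A_def
            by (metis in_prime_factors_imp_dvd in_prime_factors_imp_prime prime_dvd_mult_iff)
          then have "p \<le> r + s" using r s by (auto dest: dvd_imp_le)
          then show "p \<in> {..<r + s + ?t + 1}" by simp
        qed
        show "\<forall>p\<in>{..<r + s + ?t + 1} - A. (if Factorial_Ring.prime p
         then power_coeff (multiplicity p r) (multiplicity p s) (multiplicity p ?t) else 1) = 1"
        proof
          fix p assume p: "p \<in> {..<r + s + ?t + 1} - A"
          show "(if Factorial_Ring.prime p then power_coeff (multiplicity p r) (multiplicity p s) (multiplicity p ?t) else 1) = 1"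
          proof (cases "Factorial_Ring.prime p")
            case True
            then have "p \<in> prime_factors r \<longleftrightarrow> p dvd r" "p \<in> prime_factors s \<longleftrightarrow> p dvd s"
              using r s by (simp_all add: prime_factors_dvd)
            then have "\<not> p dvd r" "\<not> p dvd s" using p A(3,4) by blast+
            then have "multiplicity p r = 0" "multiplicity p s = 0" by (simp_all add: not_dvd_imp_multiplicity_0)
            moreover have "multiplicity p ?t = 0" using mult[OF True] p by simp
            ultimately show ?thesis by (simp add: power_coeff_def)
          qed simp
        qed
      qed simp
      also have "\<dots> = (\<Prod>p\<in>A. power_coeff (multiplicity p r) (multiplicity p s) (g p))"
        using A mult by (intro prod.cong refl) simp
      finally show ?thesis .
    qed
    moreover have "monomial ?t = (\<Prod>p\<in>A. power_basis p (g p))"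
    proof -
      have "monomial ?t = (\<Prod>p\<in>A. power_basis p (multiplicity p ?t))"
        using A t0 pfT[OF tT] by (intro monomial_superset)
      also have "\<dots> = (\<Prod>p\<in>A. power_basis p (g p))" using A mult by (intro prod.cong refl) simp
      finally show ?thesis .
    qed
    ultimately show "of_nat (monomial_coeff r s ?t) * monomial ?t = (\<Prod>p\<in>A. ?c p (g p))"
      by (simp add: prod.distrib)
  next
    fix t assume t: "t \<in> T"
    show "(\<lambda>p\<in>A. multiplicity p t) \<in> PiE A B" using mT[OF t] A by (auto simp: B_def)
    have "(\<Prod>p\<in>A. p ^ (\<lambda>p\<in>A. multiplicity p t) p) = (\<Prod>p\<in>A. p ^ multiplicity p t)"
      by (intro prod.cong) auto
    also have "\<dots> = (\<Prod>p\<in>prime_factors t. p ^ multiplicity p t)"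
      using A pfT[OF t] T(2)[OF t] by (intro prod.mono_neutral_right) (auto simp: prime_factors_multiplicity)
    also have "\<dots> = t" using T(2)[OF t] by (simp add: prod_prime_factors)
    finally show "(\<Prod>p\<in>A. p ^ (\<lambda>p\<in>A. multiplicity p t) p) = t" .
  qed
  also have "\<dots> = (\<Sum>t\<in>{1..(r * s) ^ 6}. of_nat (monomial_coeff r s t) * monomial t)"
  proof (rule sum.mono_neutral_left)
    show "\<forall>t\<in>{1..(r * s) ^ 6} - T. of_nat (monomial_coeff r s t) * monomial t = 0"
    proof
      fix t assume t: "t \<in> {1..(r * s) ^ 6} - T"
      then have "monomial_coeff r s t = 0"
        using monomial_coeff_nz_dvd[of r s t] r s by (cases "monomial_coeff r s t = 0") (auto simp: T_def)
      then show "of_nat (monomial_coeff r s t) * monomial t = 0" by simp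
    qed
  qed (use T in auto)
  finally show ?thesis .
qed

sublocale computable_basis "\<lambda>i. monomial (Suc i)" "\<lambda>i j k. monomial_coeff (Suc i) (Suc j) (Suc k)"
  "\<lambda>i j. (Suc i * Suc j) ^ 6"
proof
  show "monomial (Suc 0) = 1" by (simp add: monomial_def)
  show "monomial (Suc i) * monomial (Suc j) = (\<Sum>k<(Suc i * Suc j) ^ 6. of_nat (monomial_coeff (Suc i) (Suc j) (Suc k)) * monomial (Suc k))" for i j
    unfolding monomial_mult[OF zero_less_Suc zero_less_Suc]
    by (rule sum.reindex_bij_witness[where i = Suc and j = "\<lambda>t. t - 1"]) auto
  show "monomial_coeff (Suc i) (Suc j) (Suc k) = 0" if "(Suc i * Suc j) ^ 6 \<le> k" for i j k
  proof (rule ccontr)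
    assume "monomial_coeff (Suc i) (Suc j) (Suc k) \<noteq> 0"
    then have "Suc k dvd (Suc i * Suc j) ^ 6" by (rule monomial_coeff_nz_dvd) auto
    then have "Suc k \<le> (Suc i * Suc j) ^ 6" by (rule dvd_imp_le) simp
    with that show False by simp
  qed
  show "c i = 0" if "(\<Sum>i<N. of_int (c i) * monomial (Suc i)) = 0" "i < N" for c i N
  proof -
    have "(\<Sum>r\<in>{1..N}. of_int (c (r - 1)) * monomial r) = (\<Sum>i<N. of_int (c i) * monomial (Suc i))"
      by (rule sum.reindex_bij_witness[where i = Suc and j = "\<lambda>t. t - 1"]) auto
    moreover have "of_int k \<in> F {}" for k
      by (cases k) (auto intro!: subf_uminus[OF subfield_F] subf_of_nat[OF subfield_F] subf_diff[OF subfield_F] subf_1[OF subfield_F])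
    ultimately have "of_int (c (Suc i - 1)) = (0 :: complex)"
      using that by (intro monomials_independent[of "{1..N}" "\<lambda>r. of_int (c (r - 1))" "Suc i"]) auto
    then show ?thesis by simp
  qed
  show "computable1 (\<lambda>z. monomial_coeff (Suc (pfst z)) (Suc (pfst (psnd z))) (Suc (psnd (psnd z))))"
    by (rule computable1_monomial_coeff)
  show "computable2 (\<lambda>i j. (Suc i * Suc j) ^ 6)"
    unfolding computable2_uncurry by (intro comp_intros)
qed

lemma range_frac_value_F: "range frac_value = F P"
  unfolding range_frac_value
proof
  show "field_gen (range (\<lambda>i. monomial (Suc i))) \<subseteq> F P"
    by (rule field_gen_least[OF subfield_F]) (auto intro!: monomial_in_F)
  have "a p = monomial (Suc (p ^ 2 - 1))" "y p = monomial (Suc (p - 1))" if "Factorial_Ring.prime p" for p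
  proof -
    have "q = p" if "Factorial_Ring.prime q" "q dvd p ^ n" for q n
      using that \<open>Factorial_Ring.prime p\<close> by (meson prime_dvd_power primes_dvd_imp_eq)
    from this[of _ 1] this[of _ 2] have "prime_factors (p ^ 2) = {p}" "prime_factors p = {p}" "p > 0"
      using that by (auto simp: prime_factors_dvd prime_gt_0_nat)
    moreover from this have "Suc (p ^ 2 - 1) = p ^ 2" "Suc (p - 1) = p" by simp_all
    ultimately show "a p = monomial (Suc (p ^ 2 - 1))" "y p = monomial (Suc (p - 1))"
      using that by (simp_all add: monomial_def power_basis_def multiplicity_prime)
  qed
  then have "curve_gens a P \<subseteq> range (\<lambda>i. monomial (Suc i))"
    unfolding curve_gens_alt by (auto simp del: One_nat_def)
  then show "F P \<subseteq> field_gen (range (\<lambda>i. monomial (Suc i)))" by (rule field_gen_mono)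
qed

end

section \<open>Transporting a subfield of the complex numbers to the natural numbers\<close>

text \<open>
The field structure on the natural numbers pulled back along an injection \<open>\<phi>\<close> whose range is a subfield of the complex numbers.
\<close>

definition transported_field :: "(nat \<Rightarrow> complex) \<Rightarrow> nat ring" where
  "transported_field \<phi> = \<lparr>carrier = UNIV, monoid.mult = \<lambda>x y. inv_into UNIV \<phi> (\<phi> x * \<phi> y), monoid.one = inv_into UNIV \<phi> 1,
     ring.zero = inv_into UNIV \<phi> 0, ring.add = \<lambda>x y. inv_into UNIV \<phi> (\<phi> x + \<phi> y)\<rparr>"

locale transported =
  fixes \<phi> :: "nat \<Rightarrow> complex"
  assumes inj: "inj \<phi>" and S: "is_subfield (range \<phi>)"
begin

abbreviation R :: "nat ring" where "R \<equiv> transported_field \<phi>"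

lemma \<phi>_inv: "z \<in> range \<phi> \<Longrightarrow> \<phi> (inv_into UNIV \<phi> z) = z"
  by (rule f_inv_into_f)

lemma carrier_R: "carrier R = UNIV"
  and \<phi>_mult: "\<phi> (x \<otimes>\<^bsub>R\<^esub> y) = \<phi> x * \<phi> y"
  and \<phi>_one: "\<phi> \<one>\<^bsub>R\<^esub> = 1"
  and \<phi>_zero: "\<phi> \<zero>\<^bsub>R\<^esub> = 0"
  and \<phi>_add: "\<phi> (x \<oplus>\<^bsub>R\<^esub> y) = \<phi> x + \<phi> y"
  using subf_0[OF S] subf_1[OF S] subf_add[OF S, of "\<phi> x" "\<phi> y"] subf_mult[OF S, of "\<phi> x" "\<phi> y"]
  by (auto simp: transported_field_def \<phi>_inv)

lemmas \<phi>_simps = \<phi>_mult \<phi>_one \<phi>_zero \<phi>_add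

lemma R_eq_iff: "x = y \<longleftrightarrow> \<phi> x = \<phi> y"
  using inj by (auto dest: injD)

lemma field_R: "field R"
proof -
  interpret cring R
  proof (intro cringI abelian_groupI comm_monoidI)
    fix x assume "x \<in> carrier R"
    have "- \<phi> x \<in> range \<phi>" by (rule subf_uminus[OF S]) simp
    then have "inv_into UNIV \<phi> (- \<phi> x) \<oplus>\<^bsub>R\<^esub> x = \<zero>\<^bsub>R\<^esub>"
      unfolding R_eq_iff by (simp add: \<phi>_simps \<phi>_inv)
    then show "\<exists>y\<in>carrier R. y \<oplus>\<^bsub>R\<^esub> x = \<zero>\<^bsub>R\<^esub>" by (auto simp: carrier_R)
  qed (simp_all add: carrier_R R_eq_iff \<phi>_simps algebra_simps)
  show ?thesis
  proof (rule cring_fieldI2)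
    show "\<zero>\<^bsub>R\<^esub> \<noteq> \<one>\<^bsub>R\<^esub>" by (simp add: R_eq_iff \<phi>_simps)
    fix x assume "x \<noteq> \<zero>\<^bsub>R\<^esub>"
    then have "\<phi> x \<noteq> 0" by (simp add: R_eq_iff \<phi>_simps)
    moreover have "inverse (\<phi> x) \<in> range \<phi>" by (rule subf_inverse[OF S]) simp
    ultimately have "x \<otimes>\<^bsub>R\<^esub> inv_into UNIV \<phi> (inverse (\<phi> x)) = \<one>\<^bsub>R\<^esub>"
      unfolding R_eq_iff by (simp add: \<phi>_simps \<phi>_inv)
    then show "\<exists>b\<in>carrier R. x \<otimes>\<^bsub>R\<^esub> b = \<one>\<^bsub>R\<^esub>" by (auto simp: carrier_R)
  qed
qed

sublocale R: field R by (rule field_R)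

lemma \<phi>_uminus: "\<phi> (\<ominus>\<^bsub>R\<^esub> x) = - \<phi> x"
proof -
  have "\<phi> (\<ominus>\<^bsub>R\<^esub> x \<oplus>\<^bsub>R\<^esub> x) = 0" by (simp add: R.l_neg carrier_R \<phi>_zero)
  then show ?thesis by (simp only: \<phi>_add add_eq_0_iff) simp
qed

lemma \<phi>_inverse: "x \<noteq> \<zero>\<^bsub>R\<^esub> \<Longrightarrow> \<phi> (inv\<^bsub>R\<^esub> x) = inverse (\<phi> x)"
proof -
  assume x: "x \<noteq> \<zero>\<^bsub>R\<^esub>"
  then have "x \<in> Units R" by (simp add: R.field_Units carrier_R)
  then have "\<phi> (x \<otimes>\<^bsub>R\<^esub> inv\<^bsub>R\<^esub> x) = 1" by (simp add: R.Units_r_inv \<phi>_one)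
  moreover have "\<phi> x \<noteq> 0" using x by (simp add: R_eq_iff \<phi>_simps)
  ultimately show ?thesis by (simp add: \<phi>_mult field_simps)
qed

lemma \<phi>_pow: "\<phi> (x [^]\<^bsub>R\<^esub> (n::nat)) = \<phi> x ^ n"
  by (induction n) (simp_all add: \<phi>_simps)

lemma \<phi>_finsum: "\<phi> (finsum R g T) = (\<Sum>t\<in>T. \<phi> (g t))"
  by (induction T rule: infinite_finite_induct)
    (simp_all add: R.finsum_infinite \<phi>_simps R.finsum_insert carrier_R)

lemma \<phi>_finprod: "\<phi> (finprod R g T) = (\<Prod>t\<in>T. \<phi> (g t))"
  by (induction T rule: infinite_finite_induct)
    (simp_all add: R.finprod_infinite \<phi>_simps R.finprod_insert carrier_R)

lemma characteristic_zero_R: "R.characteristic_zero"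
proof -
  have "\<phi> (add_pow R n \<one>\<^bsub>R\<^esub>) = of_nat n" for n :: nat
    by (induction n) (simp_all add: \<phi>_simps R.add.nat_pow_Suc carrier_R)
  then have "\<phi> (add_pow R n \<one>\<^bsub>R\<^esub>) \<noteq> \<phi> \<zero>\<^bsub>R\<^esub>" if "n > 0" for n :: nat
    using that by (simp add: \<phi>_zero)
  then show ?thesis unfolding R.characteristic_zero_def by metis
qed

lemma \<phi>_generate_field: "x \<in> generate_field R H \<Longrightarrow> \<phi> x \<in> field_gen (\<phi> ` H)"
proof (induction rule: generate_field.induct)
  case (m_inv h)
  then show ?case by (simp add: \<phi>_inverse subf_inverse[OF is_subfield_field_gen])
qed (simp_all add: \<phi>_simps \<phi>_uminus field_gen.one field_gen.gen subf_uminus[OF is_subfield_field_gen]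
    subf_add[OF is_subfield_field_gen] subf_mult[OF is_subfield_field_gen])

lemma \<phi>_image_is_subfield:
  assumes "subfield k R"
  shows "is_subfield (\<phi> ` k)"
  unfolding is_subfield_def
proof (intro conjI ballI)
  have k: "subring k R" using assms by (rule subfieldE)
  show "1 \<in> \<phi> ` k" using subringE(3)[OF k] \<phi>_one by (metis imageI)
  fix u v assume "u \<in> \<phi> ` k" "v \<in> \<phi> ` k"
  then obtain x y where xy: "x \<in> k" "y \<in> k" "u = \<phi> x" "v = \<phi> y" by auto
  have "x \<oplus>\<^bsub>R\<^esub> \<ominus>\<^bsub>R\<^esub> y \<in> k" using xy subringE(5,7)[OF k] by blast
  moreover have "\<phi> (x \<oplus>\<^bsub>R\<^esub> \<ominus>\<^bsub>R\<^esub> y) = u - v" by (simp add: xy \<phi>_add \<phi>_uminus)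
  ultimately show "u - v \<in> \<phi> ` k" by (metis imageI)
  show "u / v \<in> \<phi> ` k"
  proof (cases "y = \<zero>\<^bsub>R\<^esub>")
    case True
    then have "u / v = \<phi> \<zero>\<^bsub>R\<^esub>" by (simp add: xy \<phi>_zero)
    then show ?thesis using subringE(2)[OF k] by (metis imageI)
  next
    case False
    then have "inv\<^bsub>R\<^esub> y \<in> k" using R.subfield_m_inv(1)[OF assms, of y] xy by simp
    then have "x \<otimes>\<^bsub>R\<^esub> inv\<^bsub>R\<^esub> y \<in> k" using xy subringE(6)[OF k] by blast
    moreover have "\<phi> (x \<otimes>\<^bsub>R\<^esub> inv\<^bsub>R\<^esub> y) = u / v"
      using False by (simp add: xy \<phi>_mult \<phi>_inverse divide_inverse)
    ultimately show ?thesis by (metis imageI)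
  qed
qed

lemma algebraic_if_square:
  assumes k: "subfield k R" and "x \<otimes>\<^bsub>R\<^esub> x \<in> k"
  shows "(R.algebraic over k) x"
proof (rule R.algebraicI)
  let ?p = "[\<one>\<^bsub>R\<^esub>, \<zero>\<^bsub>R\<^esub>, \<ominus>\<^bsub>R\<^esub> (x \<otimes>\<^bsub>R\<^esub> x)]"
  have sub: "subring k R" using k by (rule subfieldE)
  show "?p \<in> carrier (univ_poly R k)"
    using subringE(2,3,5)[OF sub] assms(2) unfolding univ_poly_def polynomial_def by auto
  show "?p \<noteq> []" by simp
  show "R.eval ?p x = \<zero>\<^bsub>R\<^esub>"
    by (simp add: R_eq_iff \<phi>_simps \<phi>_uminus \<phi>_pow power2_eq_square numeral_2_eq_2)
qed

text \<open>
The elements algebraic over a subfield form a subfield, so it suffices to look at generators: those in \<open>A\<close> lie in the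
ground field, and those in \<open>Z\<close> are square roots of elements of it.
\<close>

lemma algebraic_over_generators:
  assumes A: "\<And>z. z \<in> A \<Longrightarrow> z \<in> \<phi> ` B" and Z: "\<And>z. z \<in> Z \<Longrightarrow> z \<in> range \<phi> \<and> z * z \<in> field_gen A"
    and gen: "range \<phi> \<subseteq> field_gen (A \<union> Z)"
  shows "(R.algebraic over generate_field R (k \<union> B)) x"
proof -
  let ?k = "generate_field R (k \<union> B)"
  have k: "subfield ?k R" by (rule R.generate_field_is_subfield) (simp add: carrier_R)
  have self: "(R.algebraic over ?k) b" if "b \<in> ?k" for b
    by (rule R.algebraic_self[OF subfieldE(1)[OF k] that])
  have "A \<subseteq> \<phi> ` ?k"
    using A by (auto dest!: A intro!: imageI generate_field.incl)
  then have Ak: "field_gen A \<subseteq> \<phi> ` ?k" by (rule field_gen_least[OF \<phi>_image_is_subfield[OF k]])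
  let ?alg = "{x \<in> carrier R. (R.algebraic over ?k) x}"
  have alg: "is_subfield (\<phi> ` ?alg)"
    by (intro \<phi>_image_is_subfield R.subfield_of_algebraics k)
  have "A \<union> Z \<subseteq> \<phi> ` ?alg"
  proof
    fix z assume "z \<in> A \<union> Z"
    then show "z \<in> \<phi> ` ?alg"
    proof
      assume "z \<in> A"
      then obtain b where "b \<in> ?k" "z = \<phi> b" using \<open>A \<subseteq> \<phi> ` ?k\<close> by blast
      then show ?thesis using self by (auto simp: carrier_R)
    next
      assume "z \<in> Z"
      then obtain b where b: "z = \<phi> b" "\<phi> b * \<phi> b \<in> field_gen A" using Z by blast
      then have "\<phi> (b \<otimes>\<^bsub>R\<^esub> b) \<in> \<phi> ` ?k" using Ak by (auto simp: \<phi>_mult)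
      then have "b \<otimes>\<^bsub>R\<^esub> b \<in> ?k" using inj by (simp add: inj_image_mem_iff)
      with algebraic_if_square[OF k] b show ?thesis by (auto simp: carrier_R)
    qed
  qed
  then have "range \<phi> \<subseteq> \<phi> ` ?alg" using gen field_gen_least[OF alg] by blast
  then have "\<phi> x \<in> \<phi> ` ?alg" by blast
  then show ?thesis using inj by (auto simp: inj_image_mem_iff)
qed

lemma indexed_poly_support:
  assumes "Q \<in> R.indexed_pset I k" "\<zero>\<^bsub>R\<^esub> \<in> k" "\<And>a b. a \<in> k \<Longrightarrow> b \<in> k \<Longrightarrow> a \<oplus>\<^bsub>R\<^esub> b \<in> k"
  shows "finite {m. Q m \<noteq> \<zero>\<^bsub>R\<^esub>} \<and> (\<forall>m. Q m \<in> k) \<and> (\<forall>m. Q m \<noteq> \<zero>\<^bsub>R\<^esub> \<longrightarrow> set_mset m \<subseteq> I)"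
  using assms(1)
proof (induction rule: R.indexed_pset.induct)
  case (indexed_const c)
  have "finite {m. R.indexed_const c m \<noteq> \<zero>\<^bsub>R\<^esub>}"
    by (rule finite_subset[of _ "{{#}}"]) (auto simp: R.indexed_const_def)
  then show ?case using indexed_const assms(2) by (auto simp: R.indexed_const_def)
next
  case (indexed_padd P Q)
  have "{m. R.indexed_padd P Q m \<noteq> \<zero>\<^bsub>R\<^esub>} \<subseteq> {m. P m \<noteq> \<zero>\<^bsub>R\<^esub>} \<union> {m. Q m \<noteq> \<zero>\<^bsub>R\<^esub>}"
    by (auto simp: R.indexed_padd_def carrier_R)
  moreover from this have "\<forall>m. R.indexed_padd P Q m \<noteq> \<zero>\<^bsub>R\<^esub> \<longrightarrow> set_mset m \<subseteq> I"
    using indexed_padd.IH by blast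
  ultimately have "finite {m. R.indexed_padd P Q m \<noteq> \<zero>\<^bsub>R\<^esub>}"
    "\<forall>m. R.indexed_padd P Q m \<noteq> \<zero>\<^bsub>R\<^esub> \<longrightarrow> set_mset m \<subseteq> I"
    using indexed_padd.IH by (simp_all add: finite_subset)
  then show ?case using indexed_padd.IH assms(3) by (simp add: R.indexed_padd_def)
next
  case (indexed_pmult P i)
  have "{m. R.indexed_pmult P i m \<noteq> \<zero>\<^bsub>R\<^esub>} \<subseteq> (\<lambda>m. add_mset i m) ` {m. P m \<noteq> \<zero>\<^bsub>R\<^esub>}"
  proof
    fix m assume "m \<in> {m. R.indexed_pmult P i m \<noteq> \<zero>\<^bsub>R\<^esub>}"
    then have "i \<in># m" "P (m - {#i#}) \<noteq> \<zero>\<^bsub>R\<^esub>" by (auto simp: R.indexed_pmult_def split: if_splits)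
    then show "m \<in> (\<lambda>m. add_mset i m) ` {m. P m \<noteq> \<zero>\<^bsub>R\<^esub>}"
      by (intro image_eqI[of _ _ "m - {#i#}"]) auto
  qed
  moreover from this have "\<forall>m. R.indexed_pmult P i m \<noteq> \<zero>\<^bsub>R\<^esub> \<longrightarrow> set_mset m \<subseteq> I"
    using indexed_pmult by fastforce
  ultimately have "finite {m. R.indexed_pmult P i m \<noteq> \<zero>\<^bsub>R\<^esub>}"
    "\<forall>m. R.indexed_pmult P i m \<noteq> \<zero>\<^bsub>R\<^esub> \<longrightarrow> set_mset m \<subseteq> I"
    using indexed_pmult.IH by (simp_all add: finite_subset)
  then show ?case using indexed_pmult.IH assms(2) by (simp add: R.indexed_pmult_def)
qed

lemma algebraically_independent_if_monomials:
  assumes indep: "\<And>T c. finite T \<Longrightarrow> (\<And>m. m \<in> T \<Longrightarrow> set_mset m \<subseteq> B) \<Longrightarrow> (\<And>m. c m \<in> field_gen {}) \<Longrightarrow>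
       (\<Sum>m\<in>T. c m * (\<Prod>i\<in>set_mset m. \<phi> i ^ count m i)) = 0 \<Longrightarrow> \<forall>m\<in>T. c m = 0"
  shows "R.algebraically_independent (R.prime_subfield) B"
  unfolding R.algebraically_independent_def
proof (intro conjI ballI impI)
  fix Q assume Q: "Q \<in> R.indexed_pset B R.prime_subfield" and 0: "R.mpoly_value (\<lambda>a. a) Q = \<zero>\<^bsub>R\<^esub>"
  have k: "subfield R.prime_subfield R"
    unfolding R.prime_subfield_def by (rule R.generate_field_is_subfield) simp
  define T where "T = {m. Q m \<noteq> \<zero>\<^bsub>R\<^esub>}"
  have sup: "finite T" "\<And>m. Q m \<in> R.prime_subfield" "\<And>m. m \<in> T \<Longrightarrow> set_mset m \<subseteq> B"
    using indexed_poly_support[OF Q subringE(2)[OF subfieldE(1)[OF k]] subringE(7)[OF subfieldE(1)[OF k]]]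
    by (auto simp: T_def)
  have "\<phi> (R.mpoly_value (\<lambda>a. a) Q) = (\<Sum>m\<in>T. \<phi> (Q m) * (\<Prod>i\<in>set_mset m. \<phi> i ^ count m i))"
    unfolding R.mpoly_value_def T_def \<phi>_finsum \<phi>_mult \<phi>_finprod \<phi>_pow ..
  with 0 have "(\<Sum>m\<in>T. \<phi> (Q m) * (\<Prod>i\<in>set_mset m. \<phi> i ^ count m i)) = 0" by (simp add: \<phi>_zero)
  moreover have "\<phi> (Q m) \<in> field_gen {}" for m
    using sup(2)[of m] \<phi>_generate_field[of "Q m" "{}"] by (simp add: R.prime_subfield_def)
  ultimately have "\<forall>m\<in>T. \<phi> (Q m) = 0" using sup by (intro indep) auto
  then have "Q m = \<zero>\<^bsub>R\<^esub>" for m by (cases "m \<in> T") (auto simp: T_def R_eq_iff \<phi>_zero)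
  then show "Q = R.indexed_const \<zero>\<^bsub>R\<^esub>" by (auto simp: R.indexed_zero_def)
qed (simp add: carrier_R)

end

section \<open>Deciding the basis in a computable copy\<close>

lemma (in generic_tower) a_inj: "a i = a j \<Longrightarrow> i = j"
  using a_not_in_F_without[of j "{i}"] a_in_F[of i "{i}"] by auto

text \<open>
A copy of the field on the natural numbers with computable operations \<open>gadd\<close> and \<open>gmul\<close>; the isomorphism \<open>\<chi>\<close> to the field inside the complex
numbers is arbitrary.
\<close>

locale computable_model = generic_tower +
  fixes \<chi> :: "nat \<Rightarrow> complex" and gadd gmul :: "nat \<Rightarrow> nat \<Rightarrow> nat"
  assumes inj: "inj \<chi>" and range: "range \<chi> = F P"
    and gadd: "\<chi> (gadd u v) = \<chi> u + \<chi> v" and gmul: "\<chi> (gmul u v) = \<chi> u * \<chi> v"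
    and computable_gadd: "computable2 gadd" and computable_gmul: "computable2 gmul"
begin

definition zero_elem :: nat where "zero_elem = inv_into UNIV \<chi> 0"
definition one_elem :: nat where "one_elem = inv_into UNIV \<chi> 1"

lemma \<chi>_surj: "z \<in> F P \<Longrightarrow> \<exists>w. \<chi> w = z"
  using range by (metis imageE)

lemma \<chi>_zero: "\<chi> zero_elem = 0" and \<chi>_one: "\<chi> one_elem = 1"
  unfolding zero_elem_def one_elem_def
  by (rule f_inv_into_f, simp add: range subf_0[OF subfield_F] subf_1[OF subfield_F])+

lemma \<chi>_in_F: "\<chi> w \<in> F P" using range by auto

lemma \<chi>_eq: "u = v \<longleftrightarrow> \<chi> u = \<chi> v" using inj by (auto dest: injD)

text \<open>
The equation of the curve, written with the operations of the copy.
\<close>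

definition on_curve :: "nat \<Rightarrow> nat \<Rightarrow> bool" where
  "on_curve b c \<longleftrightarrow> gmul c c =
     gadd (gadd (gadd (gmul (gmul (gmul b b) (gmul b b)) (gmul b b)) b) one_elem)
          (gadd (gadd (gmul (gmul (gmul b b) (gmul b b)) (gmul b b)) b) one_elem)"

lemma on_curve_iff: "on_curve b c \<longleftrightarrow> \<chi> c ^ 2 = sextic_value (\<chi> b)"
  unfolding on_curve_def \<chi>_eq gadd gmul \<chi>_one sextic_value_def
  by (simp add: numeral_eq_Suc algebra_simps)

text \<open>
The basis is existentially definable; this is where the rigidity of the curve enters.
\<close>

lemma ex_on_curve_iff: "(\<exists>c. on_curve b c) \<longleftrightarrow> \<chi> b \<in> a ` P"
proof
  assume "\<exists>c. on_curve b c"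
  then show "\<chi> b \<in> a ` P" using curve_points_F[OF \<chi>_in_F \<chi>_in_F] on_curve_iff by blast
next
  assume "\<chi> b \<in> a ` P"
  then obtain p where p: "p \<in> P" "\<chi> b = a p" by auto
  then obtain c where "\<chi> c = y p" using \<chi>_surj[OF y_in_F] by blast
  then have "on_curve b c" using p by (simp add: on_curve_iff y_sq)
  then show "\<exists>c. on_curve b c" ..
qed

text \<open>
A code \<open>n = (t, i, j, k)\<close> stands for a step of a derivation whose earlier results are stored, the latest first, in \<open>h\<close>. The tags 0 and 1 introduce the
two coordinates of a point, whose first coordinate is \<open>i\<close> and whose second coordinate is the number that codes \<open>(j, k)\<close>, unless the first
coordinate is the forbidden element \<open>x\<close>; the tag 2 claims that \<open>k\<close> is the difference of the results \<open>i\<close> and \<open>j\<close>, any larger tag that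
it is their quotient. The claims are verified by an addition or a multiplication, so no inverse operation is needed, and steps that fail the test produce 1.
\<close>

definition step :: "nat \<Rightarrow> nat \<Rightarrow> nat \<Rightarrow> nat" where
  "step x n h =
    (if pfst n = 0 then if on_curve (pfst (psnd n)) (psnd (psnd n)) \<and> \<not> pfst (psnd n) = x then pfst (psnd n) else one_elem
     else if pfst n = 1 then if on_curve (pfst (psnd n)) (psnd (psnd n)) \<and> \<not> pfst (psnd n) = x then psnd (psnd n) else one_elem
     else if pfst (psnd n) < n \<and> pfst (psnd (psnd n)) < n then
       if pfst n = 2 then
         if gadd (psnd (psnd (psnd n))) (nth_code h (n - 1 - pfst (psnd (psnd n)))) = nth_code h (n - 1 - pfst (psnd n))
         then psnd (psnd (psnd n)) else one_elem
       else if \<not> nth_code h (n - 1 - pfst (psnd (psnd n))) = zero_elem \<and>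
           gmul (psnd (psnd (psnd n))) (nth_code h (n - 1 - pfst (psnd (psnd n)))) = nth_code h (n - 1 - pfst (psnd n))
         then psnd (psnd (psnd n)) else one_elem
     else one_elem)"

definition history :: "nat \<Rightarrow> nat \<Rightarrow> nat" where
  "history x n = rec_nat 0 (\<lambda>n h. pair (step x n h) h) n"

definition derived :: "nat \<Rightarrow> nat \<Rightarrow> nat" where
  "derived x n = step x n (history x n)"

lemma nth_history: "i < n \<Longrightarrow> nth_code (history x n) (n - 1 - i) = derived x i"
proof (induction n)
  case (Suc n)
  have h: "history x (Suc n) = pair (derived x n) (history x n)" by (simp add: history_def derived_def)
  show ?case
  proof (cases "i = n")
    case True
    then show ?thesis by (simp add: h nth_code_0)
  next
    case False
    with Suc have "Suc n - 1 - i = Suc (n - 1 - i)" "i < n" by simp_all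
    with Suc.IH show ?thesis by (simp only: h nth_code_Suc) simp
  qed
qed simp

lemma derived_point_x: "on_curve b c \<Longrightarrow> b \<noteq> x \<Longrightarrow> derived x (pair 0 (pair b c)) = b"
  and derived_point_y: "on_curve b c \<Longrightarrow> b \<noteq> x \<Longrightarrow> derived x (pair 1 (pair b c)) = c"
  and derived_one: "derived x (pair 0 (pair x 0)) = one_elem"
  by (simp_all add: derived_def step_def)

lemma pair_code_bounds:
  "i < pair (Suc t) (pair i (pair j k))" "j < pair (Suc t) (pair i (pair j k))"
proof -
  have "z < pair (Suc t) z" for z
  proof -
    have "z \<le> triangle (Suc t + z)" by (induction z) auto
    then show ?thesis by (simp add: prod_encode_def)
  qed
  note * = this[of "pair i (pair j k)"]
  have "i \<le> pair i (pair j k)" "j \<le> pair i (pair j k)"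
    using le_prod_encode_1[of i "pair j k"] le_prod_encode_2[of "pair j k" i] le_prod_encode_1[of j k] by linarith+
  with * show "i < pair (Suc t) (pair i (pair j k))" "j < pair (Suc t) (pair i (pair j k))" by linarith+
qed

lemma derived_diff:
  assumes "gadd k (derived x j) = derived x i"
  shows "derived x (pair 2 (pair i (pair j k))) = k"
proof -
  define n where "n = pair 2 (pair i (pair j k))"
  have n: "pfst n = 2" "pfst (psnd n) = i" "pfst (psnd (psnd n)) = j" "psnd (psnd (psnd n)) = k"
    by (simp_all add: n_def)
  have ij: "i < n" "j < n"
    using pair_code_bounds[where t = 1 and i = i and j = j and k = k] by (simp_all add: n_def eval_nat_numeral)
  have "derived x n = k"
    unfolding derived_def[of x n] step_def n nth_history[OF ij(1)] nth_history[OF ij(2)]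
    using assms ij by simp
  then show ?thesis by (simp only: n_def)
qed

lemma derived_divide:
  assumes "gmul k (derived x j) = derived x i" "derived x j \<noteq> zero_elem"
  shows "derived x (pair 3 (pair i (pair j k))) = k"
proof -
  define n where "n = pair 3 (pair i (pair j k))"
  have n: "pfst n = 3" "pfst (psnd n) = i" "pfst (psnd (psnd n)) = j" "psnd (psnd (psnd n)) = k"
    by (simp_all add: n_def)
  have ij: "i < n" "j < n"
    using pair_code_bounds[where t = 2 and i = i and j = j and k = k] by (simp_all add: n_def eval_nat_numeral)
  have "derived x n = k"
    unfolding derived_def[of x n] step_def n nth_history[OF ij(1)] nth_history[OF ij(2)]
    using assms ij by simp
  then show ?thesis by (simp only: n_def)
qed

text \<open>
No point is forbidden here, so the derived elements form a subfield that contains all generators.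
\<close>

lemma derived_complete:
  assumes x: "\<chi> x \<notin> a ` P"
  shows "\<exists>n. derived x n = x"
proof -
  let ?W = "range (derived x)"
  have sub: "is_subfield (\<chi> ` ?W)"
    unfolding is_subfield_def
  proof (intro conjI ballI)
    show "1 \<in> \<chi> ` ?W" using derived_one[of x] \<chi>_one by (metis imageI rangeI)
    fix u v assume "u \<in> \<chi> ` ?W" "v \<in> \<chi> ` ?W"
    then obtain i j where ij: "u = \<chi> (derived x i)" "v = \<chi> (derived x j)" by auto
    obtain k where k: "\<chi> k = u - v"
      using \<chi>_surj[of "u - v"] subf_diff[OF subfield_F] ij \<chi>_in_F by blast
    then have "gadd k (derived x j) = derived x i" by (simp add: \<chi>_eq gadd ij)
    then have "derived x (pair 2 (pair i (pair j k))) = k" by (rule derived_diff)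
    then show d: "u - v \<in> \<chi> ` ?W" unfolding k[symmetric] by (metis imageI rangeI)
    show "u / v \<in> \<chi> ` ?W"
    proof (cases "v = 0")
      case True
      have "one_elem \<in> ?W" using derived_one[of x] by (metis rangeI)
      obtain k where k: "\<chi> k = 0" using \<chi>_zero by blast
      then have "gadd k (derived x i) = derived x i" by (simp add: \<chi>_eq gadd)
      then have "derived x (pair 2 (pair i (pair i k))) = k" by (rule derived_diff)
      moreover have "u / v = \<chi> k" using True k by simp
      ultimately show ?thesis by (metis imageI rangeI)
    next
      case False
      obtain k where k: "\<chi> k = u / v"
        using \<chi>_surj[of "u / v"] subf_divide[OF subfield_F] ij \<chi>_in_F by blast
      then have "gmul k (derived x j) = derived x i" using False by (simp add: \<chi>_eq gmul flip: ij)
      moreover have "derived x j \<noteq> zero_elem" using False by (simp add: \<chi>_eq \<chi>_zero flip: ij)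
      ultimately have "derived x (pair 3 (pair i (pair j k))) = k" by (rule derived_divide)
      then show ?thesis unfolding k[symmetric] by (metis imageI rangeI)
    qed
  qed
  have "curve_gens a P \<subseteq> \<chi> ` ?W"
  proof -
    have "a p \<in> \<chi> ` ?W \<and> y p \<in> \<chi> ` ?W" if p: "p \<in> P" for p
    proof -
      obtain b where b: "\<chi> b = a p" using \<chi>_surj[OF a_in_F[OF p]] by blast
      obtain c where c: "\<chi> c = y p" using \<chi>_surj[OF y_in_F[OF p]] by blast
      note bc = b c
      then have oc: "on_curve b c" by (simp add: on_curve_iff y_sq)
      have bx: "b \<noteq> x" using x bc p by auto
      have "b \<in> ?W" "c \<in> ?W"
        using derived_point_x[OF oc bx] derived_point_y[OF oc bx] by (metis rangeI)+
      then show ?thesis unfolding bc[symmetric] by blast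
    qed
    then show ?thesis by (auto simp: curve_gens_alt)
  qed
  then have "F P \<subseteq> \<chi> ` ?W" using sub by (intro field_gen_least)
  then have "\<chi> x \<in> \<chi> ` ?W" using \<chi>_in_F by blast
  then have "x \<in> ?W" using inj by (simp only: inj_image_mem_iff)
  then show ?thesis by (metis imageE)
qed

text \<open>
All points over \<open>a j\<close> are forbidden here, so everything derived lies in the field generated by the other points.
\<close>

lemma derived_sound:
  assumes x: "\<chi> x = a j" "j \<in> P"
  shows "derived x n \<noteq> x"
proof -
  let ?K = "F (P - {j})"
  have pt: "\<chi> b \<in> ?K \<and> \<chi> c \<in> ?K" if "on_curve b c" "b \<noteq> x" for b c
  proof -
    from that(1) ex_on_curve_iff obtain i where i: "i \<in> P" "\<chi> b = a i" by blast
    have "\<chi> b \<noteq> \<chi> x" using that(2) by (simp add: \<chi>_eq[of b x])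
    with i x have "i \<noteq> j" by auto
    with i have in_K: "a i \<in> ?K" "y i \<in> ?K" by (auto intro: a_in_F y_in_F)
    have "\<chi> c ^ 2 = y i ^ 2" using that(1) i by (simp add: on_curve_iff y_sq)
    then have "\<chi> c = y i \<or> \<chi> c = - y i" by (simp add: power2_eq_iff)
    with in_K i show ?thesis using subf_uminus[OF subfield_F] by auto
  qed
  have one: "\<chi> one_elem \<in> ?K" unfolding \<chi>_one by (rule subf_1[OF subfield_F])
  have "\<chi> (derived x n) \<in> ?K"
  proof (induction n rule: less_induct)
    case (less n)
    define i j k where "i = pfst (psnd n)" and "j = pfst (psnd (psnd n))" and "k = psnd (psnd (psnd n))"
    have hist: "nth_code (history x n) (n - 1 - m) = derived x m" if "m < n" for m
      using nth_history[OF that] .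
    have sub: "\<chi> k \<in> ?K" if "i < n" "j < n" "gadd k (derived x j) = derived x i"
    proof -
      have "\<chi> k = \<chi> (derived x i) - \<chi> (derived x j)" using that(3)[symmetric] by (simp add: gadd)
      then show ?thesis using less.IH that by (simp add: subf_diff[OF subfield_F])
    qed
    have dv: "\<chi> k \<in> ?K" if "i < n" "j < n" "derived x j \<noteq> zero_elem" "gmul k (derived x j) = derived x i"
    proof -
      have "\<chi> (derived x j) \<noteq> 0" using that(3) by (simp add: \<chi>_eq \<chi>_zero)
      then have "\<chi> k = \<chi> (derived x i) / \<chi> (derived x j)" using that(4)[symmetric] by (simp add: gmul)
      then show ?thesis using less.IH that by (simp add: subf_divide[OF subfield_F])
    qed
    have if_in: "\<chi> (if Q then u else v) \<in> ?K" if "Q \<Longrightarrow> \<chi> u \<in> ?K" "\<not> Q \<Longrightarrow> \<chi> v \<in> ?K" for Q u v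
      using that by simp
    show ?case
      unfolding derived_def[of x n] step_def i_def[symmetric] j_def[symmetric] k_def[symmetric]
    proof (intro if_in one)
      assume "on_curve i (psnd (psnd n)) \<and> \<not> i = x"
      then show "\<chi> i \<in> ?K" "\<chi> (psnd (psnd n)) \<in> ?K" using pt by blast+
    next
      assume "i < n \<and> j < n"
        "gadd k (nth_code (history x n) (n - 1 - j)) = nth_code (history x n) (n - 1 - i)"
      then show "\<chi> k \<in> ?K" using sub by (simp only: hist)
    next
      assume ij: "i < n \<and> j < n" and *: "nth_code (history x n) (n - 1 - j) \<noteq> zero_elem \<and>
        gmul k (nth_code (history x n) (n - 1 - j)) = nth_code (history x n) (n - 1 - i)"
      have "derived x j \<noteq> zero_elem \<and> gmul k (derived x j) = derived x i"
        using * unfolding hist[OF conjunct1[OF ij]] hist[OF conjunct2[OF ij]] .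
      with dv ij show "\<chi> k \<in> ?K" by blast
    qed
  qed
  then show ?thesis using a_not_in_F_without[of j "P - {j}"] x by auto
qed

lemma computable1_ops [comp_intros]:
  assumes "computable1 f" "computable1 g"
  shows "computable1 (\<lambda>x. gadd (f x) (g x))" "computable1 (\<lambda>x. gmul (f x) (g x))"
  by (rule computable1_app2[OF computable_gadd assms], rule computable1_app2[OF computable_gmul assms])

lemma decidable_on_curve [comp_intros]:
  assumes "computable1 f" "computable1 g" shows "decidable (\<lambda>x. on_curve (f x) (g x))"
  unfolding on_curve_def by (intro comp_intros assms)

lemma computable1_step [comp_intros]:
  assumes "computable1 f" "computable1 g" "computable1 h"
  shows "computable1 (\<lambda>x. step (f x) (g x) (h x))"
  unfolding step_def by (intro comp_intros assms)

lemma computable1_derived [comp_intros]: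
  assumes "computable1 f" "computable1 g"
  shows "computable1 (\<lambda>x. derived (f x) (g x))"
  unfolding derived_def history_def
  by (intro comp_intros assms computable1_comp[OF assms(1)])

text \<open>
Every \<open>x\<close> either lies on the curve with some second coordinate or is derived from points with other first coordinates, but not both, so a
search for the first witness of either kind terminates and gives the answer.
\<close>

theorem computable_set_basis: "computable_set {x. \<chi> x \<in> a ` P}"
proof -
  define m where "m x = (LEAST w. on_curve x w \<or> derived x w = x)" for x
  have ex: "\<exists>w. on_curve x w \<or> derived x w = x" for x
    using ex_on_curve_iff derived_complete by blast
  have "computable1 m" unfolding m_def
    by (rule computable1_Least[OF _ ex]) (intro comp_intros)
  moreover have "\<chi> x \<in> a ` P \<longleftrightarrow> on_curve x (m x)" for x
  proof
    assume "\<chi> x \<in> a ` P"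
    then have "derived x (m x) \<noteq> x" using derived_sound by blast
    then show "on_curve x (m x)" using LeastI_ex[OF ex[of x]] unfolding m_def by blast
  qed (use ex_on_curve_iff in blast)
  ultimately have "decidable (\<lambda>x. \<chi> x \<in> a ` P)"
    by (simp only:) (intro comp_intros)
  then show ?thesis by (simp add: decidable_def computable_set_def)
qed

end

section \<open>The intrinsically computable transcendence basis\<close>

context generic_tower
begin

text \<open>
Monomials in the \<open>a p\<close> are products of even powers: a multiset of indices corresponds to the natural number in which every prime has
twice its multiplicity. Hence algebraic independence is a special case of \<open>monomials_independent\<close>.
\<close>

lemma monomials_in_a_independent:
  fixes v :: "'i \<Rightarrow> complex"
  assumes T: "finite T" "\<And>m. m \<in> T \<Longrightarrow> set_mset m \<subseteq> B" and v: "inj_on v B" "v ` B \<subseteq> a ` P"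
    and c: "\<And>m. c m \<in> field_gen {}" and sum: "(\<Sum>m\<in>T. c m * (\<Prod>i\<in>set_mset m. v i ^ count m i)) = 0"
  shows "\<forall>m\<in>T. c m = 0"
proof -
  have "\<forall>i\<in>B. \<exists>p. Factorial_Ring.prime p \<and> v i = a p" using v(2) by blast
  then obtain q where q: "\<And>i. i \<in> B \<Longrightarrow> Factorial_Ring.prime (q i)" "\<And>i. i \<in> B \<Longrightarrow> v i = a (q i)"
    by metis
  have inj_q: "inj_on q B" using v(1) q(2) by (metis inj_on_def)
  define r where "r m = (\<Prod>i\<in>set_mset m. q i ^ (2 * count m i))" for m
  have mult_r: "multiplicity (q i) (r m) = 2 * count m i" if "set_mset m \<subseteq> B" "i \<in> B" for m i
  proof -
    have inj': "inj_on q (set_mset m)" using inj_q that(1) by (rule inj_on_subset)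
    define e where "e p = 2 * count m (the_inv_into B q p)" for p
    have e: "e (q i) = 2 * count m i" if "i \<in> B" for i
      using that inj_q by (simp add: e_def the_inv_into_f_f)
    have rm: "r m = (\<Prod>p\<in>q ` set_mset m. p ^ e p)"
      unfolding r_def prod.reindex[OF inj'] using that(1) e by (intro prod.cong) auto
    then have "multiplicity (q i) (r m) = (if q i \<in> q ` set_mset m then e (q i) else 0)"
      unfolding rm using q that by (intro multiplicity_prod_prime_powers) auto
    moreover have "q i \<in> q ` set_mset m \<longleftrightarrow> i \<in># m"
      using inj_q that by (meson inj_on_image_mem_iff)
    ultimately show ?thesis using e that by (auto simp: not_in_iff)
  qed
  have r0: "r m > 0" if "set_mset m \<subseteq> B" for m
    unfolding r_def using q that by (intro prod_pos) (auto intro!: prime_gt_0_nat)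
  have mono_r: "monomial (r m) = (\<Prod>i\<in>set_mset m. v i ^ count m i)" if m: "set_mset m \<subseteq> B" for m
  proof -
    have inj': "inj_on q (set_mset m)" using inj_q m by (rule inj_on_subset)
    have "prime_factors (r m) \<subseteq> q ` set_mset m"
    proof
      fix p assume "p \<in> prime_factors (r m)"
      then have p: "Factorial_Ring.prime p" "p dvd r m" by auto
      then obtain i where "i \<in># m" "p dvd q i ^ (2 * count m i)"
        unfolding r_def by (auto simp: prime_dvd_prod_iff)
      moreover from this have "p dvd q i" using p(1) prime_dvd_power by blast
      ultimately show "p \<in> q ` set_mset m" using p(1) q m by (metis image_eqI primes_dvd_imp_eq subsetD)
    qed
    then have "monomial (r m) = (\<Prod>p\<in>q ` set_mset m. power_basis p (multiplicity p (r m)))"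
      using q m r0[OF m] by (intro monomial_superset) auto
    also have "\<dots> = (\<Prod>i\<in>set_mset m. power_basis (q i) (multiplicity (q i) (r m)))"
      by (simp add: prod.reindex[OF inj'])
    also have "\<dots> = (\<Prod>i\<in>set_mset m. v i ^ count m i)"
      using m q(2) mult_r[OF m] by (intro prod.cong) (auto simp: power_basis_def subset_iff)
    finally show ?thesis .
  qed
  have inj_r: "inj_on r T"
  proof (rule inj_onI)
    fix m m' assume m: "m \<in> T" "m' \<in> T" "r m = r m'"
    have "count m i = count m' i" for i
    proof (cases "i \<in> B")
      case True
      then show ?thesis using mult_r[OF T(2)[OF m(1)] True] mult_r[OF T(2)[OF m(2)] True] m(3) by simp
    next
      case False
      then have "i \<notin># m" "i \<notin># m'" using T(2) m by blast+
      then show ?thesis by (simp add: not_in_iff)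
    qed
    then show "m = m'" by (rule multiset_eqI)
  qed
  define c' where "c' s = (if s \<in> r ` T then c (the_inv_into T r s) else 0)" for s
  have c': "c' (r m) = c m" if "m \<in> T" for m
    using that inj_r by (simp add: c'_def the_inv_into_f_f)
  have "(\<Sum>s\<in>r ` T. c' s * monomial s) = (\<Sum>m\<in>T. c m * (\<Prod>i\<in>set_mset m. v i ^ count m i))"
    unfolding sum.reindex[OF inj_r] using T(2) by (intro sum.cong) (simp_all add: c' mono_r)
  then have 0: "(\<Sum>s\<in>r ` T. c' s * monomial s) = 0" using sum by simp
  show ?thesis
  proof
    fix m assume m: "m \<in> T"
    have "c' (r m) = 0"
    proof (rule monomials_independent[OF _ _ _ 0])
      show "c' s \<in> F {}" for s
        using c subf_0[OF is_subfield_field_gen] by (auto simp: c'_def curve_gens_def)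
      show "0 \<notin> r ` T"
      proof
        assume "0 \<in> r ` T"
        then obtain m where m: "m \<in> T" "r m = 0" by (metis imageE)
        with r0[OF T(2)[OF m(1)]] show False by simp
      qed
    qed (use T m in auto)
    then show "c m = 0" by (simp add: c'[OF m])
  qed
qed

end

lemma computable_fieldI_UNIV:
  assumes "field G" "carrier G = UNIV" "computable2 (add G)" "computable2 (monoid.mult G)"
  shows "computable_field G"
  using assms unfolding computable_field_def by blast

text \<open>
An infinite initial segment is the set of all natural numbers, so the operations agree everywhere with the given computable
functions.
\<close>

lemma computable_field_UNIV:
  assumes G: "computable_field G" and inf: "infinite (carrier G)"
  shows "carrier G = UNIV" "computable2 (add G)" "computable2 (monoid.mult G)"
proof -
  show c: "carrier G = UNIV"
  proof (intro equalityI subsetI)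
    fix x :: nat assume "x \<in> UNIV"
    obtain z where "z \<in> carrier G" "x < z" using inf infinite_nat_iff_unbounded by blast
    then show "x \<in> carrier G" using G unfolding computable_field_def by blast
  qed simp
  from G c obtain g h where "computable2 g" "\<And>x y. g x y = x \<oplus>\<^bsub>G\<^esub> y" "computable2 h" "\<And>x y. h x y = x \<otimes>\<^bsub>G\<^esub> y"
    unfolding computable_field_def by auto
  moreover from this have "g = add G" "h = monoid.mult G" by (auto simp: fun_eq_iff)
  ultimately show "computable2 (add G)" "computable2 (monoid.mult G)" by simp_all
qed

theorem theorem4p2:
  shows "\<exists>F :: nat ring. computable_field F \<and>
           ring.characteristic_zero F \<and>
           field.infinite_transcendence_degree F (field.prime_subfield F) \<and>
           (\<exists>A. field.transcendence_basis F (field.prime_subfield F) A \<and>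
                intrinsically_computable F A)"
proof -
  obtain a where "\<forall>n. transcendental_over (field_gen (curve_gens a {..<n})) (a n)"
    using ex_generic_sequence by blast
  then interpret generic_tower a by unfold_locales blast
  have inf: "infinite (range frac_value)"
  proof
    assume "finite (range frac_value)"
    moreover have "range (of_nat :: nat \<Rightarrow> complex) \<subseteq> range frac_value"
      unfolding range_frac_value_F by (auto intro: subf_of_nat[OF subfield_F])
    ultimately have "finite (range (of_nat :: nat \<Rightarrow> complex))" by (rule finite_subset[rotated])
    then show False using range_inj_infinite[OF inj_of_nat] by blast
  qed
  have "decidable (\<lambda>z. frac_value (pfst z) = frac_value (psnd z))" by (intro comp_intros)
  from computable_numbering_bijective[OF this inf] obtain r where r: "computable1 r"
    and bij: "bij_betw (\<lambda>x. frac_value (r x)) UNIV (range frac_value)" by blast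
  define \<phi> where "\<phi> x = frac_value (r x)" for x
  have \<phi>: "inj \<phi>" "range \<phi> = F P"
    using bij unfolding \<phi>_def bij_betw_def range_frac_value_F by auto
  have surj_\<phi>: "\<exists>w. \<phi> w = frac_value m" for m
  proof -
    have "frac_value m \<in> range frac_value" by simp
    then have "frac_value m \<in> range \<phi>" by (simp only: \<phi>(2) range_frac_value_F)
    then show ?thesis by (metis imageE)
  qed
  interpret transported \<phi> by unfold_locales (simp_all add: \<phi> subfield_F)
  have op: "computable2 (\<lambda>x y. inv_into UNIV \<phi> (frac_value (g (r x) (r y))))"
    if "\<And>f h. computable1 f \<Longrightarrow> computable1 h \<Longrightarrow> computable1 (\<lambda>x. g (f x) (h x))" for g
  proof -
    have "inv_into UNIV \<phi> (frac_value n) = (LEAST w. frac_value (r w) = frac_value n)" for n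
    proof -
      obtain w where w: "\<phi> w = frac_value n" using surj_\<phi> by blast
      have "(LEAST w. \<phi> w = \<phi> w') = w'" for w'
        using \<phi>(1) by (intro Least_equality) (auto dest: injD)
      from this[of w] w have "(LEAST w. frac_value (r w) = frac_value n) = w" by (simp add: \<phi>_def)
      moreover have "inv_into UNIV \<phi> (frac_value n) = w" using w \<phi>(1) by (metis inv_f_f)
      ultimately show ?thesis by simp
    qed
    moreover have "computable1 (\<lambda>z. LEAST w. frac_value (r w) = frac_value (g (r (pfst z)) (r (psnd z))))"
    proof (rule computable1_Least)
      show "decidable (\<lambda>z. frac_value (r (psnd z)) = frac_value (g (r (pfst (pfst z))) (r (psnd (pfst z)))))"
        by (intro comp_intros that computable1_comp[OF r])
      show "\<exists>w. frac_value (r w) = frac_value (g (r (pfst z)) (r (psnd z)))" for z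
        using surj_\<phi> unfolding \<phi>_def .
    qed
    ultimately show ?thesis by (simp add: computable2_uncurry)
  qed
  have add_R: "computable2 (add R)"
  proof -
    have "add R = (\<lambda>x y. inv_into UNIV \<phi> (frac_value (frac_add (r x) (r y))))"
      unfolding frac_value_add \<phi>_def[symmetric] by (simp add: transported_field_def)
    then show ?thesis using op[OF computable1_frac_ops(1)] by (simp only:)
  qed
  have mult_R: "computable2 (monoid.mult R)"
  proof -
    have "monoid.mult R = (\<lambda>x y. inv_into UNIV \<phi> (frac_value (frac_mult (r x) (r y))))"
      unfolding frac_value_mult \<phi>_def[symmetric] by (simp add: transported_field_def)
    then show ?thesis using op[OF computable1_frac_ops(2)] by (simp only:)
  qed
  have comp: "computable_field R" by (rule computable_fieldI_UNIV[OF field_R carrier_R add_R mult_R])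

  define A where "A = {x. \<phi> x \<in> a ` P}"
  have aF: "a ` P \<subseteq> range \<phi>" unfolding \<phi>(2) using a_in_F by auto
  have "A = \<phi> -` (a ` P)" by (simp add: A_def vimage_def)
  then have "\<phi> ` A = a ` P \<inter> range \<phi>" by (simp only: image_vimage_eq)
  then have \<phi>A: "\<phi> ` A = a ` P" using aF by blast
  have basis: "R.transcendence_basis R.prime_subfield A"
    unfolding R.transcendence_basis_def
  proof
    show "R.algebraically_independent R.prime_subfield A"
    proof (rule algebraically_independent_if_monomials)
      fix T :: "nat multiset set" and c
      assume "finite T" "\<And>m. m \<in> T \<Longrightarrow> set_mset m \<subseteq> A" "\<And>m. c m \<in> field_gen {}"
        "(\<Sum>m\<in>T. c m * (\<Prod>i\<in>set_mset m. \<phi> i ^ count m i)) = 0"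
      moreover have "inj_on \<phi> A" using \<phi>(1) by (rule inj_on_subset) simp
      ultimately show "\<forall>m\<in>T. c m = 0" using \<phi>A by (intro monomials_in_a_independent) auto
    qed
    show "\<forall>x\<in>carrier R. (R.algebraic over generate_field R (R.prime_subfield \<union> A)) x"
    proof
      fix x
      show "(R.algebraic over generate_field R (R.prime_subfield \<union> A)) x"
      proof (rule algebraic_over_generators)
        show "z \<in> \<phi> ` A" if "z \<in> a ` P" for z using that \<phi>A by simp
        show "z \<in> range \<phi> \<and> z * z \<in> field_gen (a ` P)" if "z \<in> y ` P" for z
        proof -
          from that obtain p where p: "p \<in> P" "z = y p" by blast
          have "sextic_value (a p) \<in> field_gen (a ` P)"
            unfolding sextic_value_def using p(1)
            by (intro subf_add[OF is_subfield_field_gen] subf_mult[OF is_subfield_field_gen]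
                subf_power[OF is_subfield_field_gen] subf_numeral[OF is_subfield_field_gen] field_gen.gen) auto
          with p show ?thesis using y_in_F[OF p(1)] y_sq[of p] by (simp add: \<phi>(2) power2_eq_square)
        qed
        show "range \<phi> \<subseteq> field_gen (a ` P \<union> y ` P)" unfolding \<phi>(2) curve_gens_alt ..
      qed
    qed
  qed
  \<comment> \<open>\<open>a\<close> is injective and there are infinitely many primes.\<close>
  have "infinite A"
  proof
    assume "finite A"
    then have "finite (a ` P)" by (simp flip: \<phi>A)
    then have "finite P" by (rule finite_imageD) (auto intro: inj_onI dest: a_inj)
    then show False using primes_infinite by simp
  qed
  with basis have itd: "R.infinite_transcendence_degree R.prime_subfield"
    unfolding R.infinite_transcendence_degree_def by blast

  have "intrinsically_computable R A"
    unfolding intrinsically_computable_def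
  proof (intro allI impI)
    fix G f assume G: "computable_field G" and f: "f \<in> ring_iso R G"
    have bij_f: "bij_betw f UNIV (carrier G)" using f by (simp add: ring_iso_def carrier_R)
    then have "infinite (carrier G)" using bij_betw_finite by blast
    note G' = computable_field_UNIV[OF G this]
    define \<chi> where "\<chi> w = \<phi> (inv_into UNIV f w)" for w
    have bij: "bij f" using bij_f G'(1) by simp
    then have fi: "f (inv_into UNIV f w) = w" "inv_into UNIV f (f x) = x" for w x
      by (simp_all add: bij_is_inj bij_is_surj surj_f_inv_f)
    have hom: "f (x \<oplus>\<^bsub>R\<^esub> x') = f x \<oplus>\<^bsub>G\<^esub> f x'" "f (x \<otimes>\<^bsub>R\<^esub> x') = f x \<otimes>\<^bsub>G\<^esub> f x'" for x x'
      using f by (simp_all add: ring_iso_def ring_hom_def carrier_R)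
    have \<chi>f: "\<chi> (f x) = \<phi> x" for x by (simp add: \<chi>_def fi)
    have "computable_model a \<chi> (add G) (monoid.mult G)"
    proof (unfold_locales)
      show "inj \<chi>"
      proof (rule injI)
        fix u v assume "\<chi> u = \<chi> v"
        then have "inv_into UNIV f u = inv_into UNIV f v" using \<phi>(1) unfolding \<chi>_def by (rule injD[rotated])
        then show "u = v" using fi(1) by metis
      qed
      show "range \<chi> = F P" unfolding \<phi>(2)[symmetric]
      proof
        show "range \<chi> \<subseteq> range \<phi>" unfolding \<chi>_def by blast
        show "range \<phi> \<subseteq> range \<chi>"
        proof (rule image_subsetI)
          fix x show "\<phi> x \<in> range \<chi>" unfolding \<chi>f[symmetric] by (rule rangeI)
        qed
      qed
      fix u v
      have "u \<oplus>\<^bsub>G\<^esub> v = f (inv_into UNIV f u \<oplus>\<^bsub>R\<^esub> inv_into UNIV f v)" "u \<otimes>\<^bsub>G\<^esub> v = f (inv_into UNIV f u \<otimes>\<^bsub>R\<^esub> inv_into UNIV f v)"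
        by (simp_all only: hom fi(1))
      then show "\<chi> (u \<oplus>\<^bsub>G\<^esub> v) = \<chi> u + \<chi> v" "\<chi> (u \<otimes>\<^bsub>G\<^esub> v) = \<chi> u * \<chi> v"
        by (simp_all only: \<chi>f \<phi>_add \<phi>_mult) (simp_all only: \<chi>_def)
    qed (use G' in auto)
    then interpret M: computable_model a \<chi> "add G" "monoid.mult G" .
    have "f ` A = {w. \<chi> w \<in> a ` P}"
    proof
      show "f ` A \<subseteq> {w. \<chi> w \<in> a ` P}" by (auto simp: A_def \<chi>f)
      show "{w. \<chi> w \<in> a ` P} \<subseteq> f ` A"
      proof
        fix w assume "w \<in> {w. \<chi> w \<in> a ` P}"
        then have "inv_into UNIV f w \<in> A" by (simp add: A_def \<chi>_def)
        then show "w \<in> f ` A" using fi(1)[of w] by (metis imageI)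
      qed
    qed
    then show "computable_set (f ` A)" using M.computable_set_basis by simp
  qed
  with comp characteristic_zero_R itd basis show ?thesis by blast
qed

end
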